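(* For $x_0\in\mathbb R^n$ and a control $u$, let $y(t,x_0,u)=Cx(t)$, $t\ge0$, where $x$ is the solution of the system with $B=0$, $$dx(t)=\Big[A x(t)+ \sum_{k=1}^m N_k x(t) u_k(t)\Big]dt+ \sum_{i=1}^v H_i x(t-)\, dM_i(t),\qquad x(0)=x_0.$$ Let $Q$ be the observability Gramian, i.e. the symmetric solution of $$A^TQ+QA+\sum_{k=1}^m N_k^TQN_k+\sum_{i,j=1}^v H_i^TQH_jk_{ij}=-C^TC,$$ and assume $Q>0$. Then for every $T>0$, every $x_0\in\mathbb R^n$ and every control $u$, $$\mathbb E\int_0^T\|y(s,x_0,u)\|_2^2\,ds\;\le\;x_0^TQx_0\,\exp\Big(\int_0^T\|u(s)\|_2^2\,ds\Big).$$
   Context: $A,N_k,H_i\in\mathbb R^{n\times n}$ ($k=1,\dots,m$, $i=1,\dots,v$), $C\in\mathbb R^{p\times n}$. $M=(M_1,\dots,M_v)^T$ is an $\mathbb R^v$-valued Lévy process with mean zero and $\mathbb E\|M(t)\|_2^2<\infty$ for all $t\ge0$; its covariance matrix is $K=(k_{ij})_{i,j=1,\dots,v}$, i.e. $\mathbb E[M(t)M^T(t)]=Kt$. Controls $u=(u_1,\dots,u_m)^T$ are deterministic with $\int_0^T\|u(t)\|_2^2\,dt<\infty$ for every $T>0$. $x(t-):=\lim_{s\uparrow t}x(s)$. Standing assumption (mean square asymptotic stability): all eigenvalues of $A\otimes I+I\otimes A+\sum_{k=1}^m N_k\otimes N_k+\sum_{i,j=1}^v H_i\otimes H_j k_{ij}$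 lie in the open left half-plane $\mathbb C_-$. *)

theory Defs
  imports "HOL-Probability.Probability"
begin

text \<open>Matrices. Row and column indices of a Kronecker product are pairs, so \<open>kron A B\<close> for
  \<open>n \<times> n\<close> matrices is a matrix over the index type \<open>'n \<times> 'n\<close> (with \<open>n\<^sup>2\<close> elements).\<close>

definition kron :: "real^'b^'a \<Rightarrow> real^'d^'c \<Rightarrow> real^('b \<times> 'd)^('a \<times> 'c)" where
  "kron A B = (\<chi> i j. A $ fst i $ fst j * B $ snd i $ snd j)"

definition is_eigenvalue :: "complex^'a^'a \<Rightarrow> complex \<Rightarrow> bool" where
  "is_eigenvalue L z \<longleftrightarrow> (\<exists>w. w \<noteq> 0 \<and> L *v w = z *s w)"

definition mean_square_matrix ::
    "real^'n^'n \<Rightarrow> ('m::finite \<Rightarrow> real^'n^'n) \<Rightarrow> ('v::finite \<Rightarrow> real^'n^'n) \<Rightarrow> real^'v^'v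
      \<Rightarrow> real^('n \<times> 'n)^('n \<times> 'n)" where
  "mean_square_matrix A N H K =
     kron A (mat 1) + kron (mat 1) A + (\<Sum>k\<in>UNIV. kron (N k) (N k))
     + (\<Sum>i\<in>UNIV. \<Sum>j\<in>UNIV. (K $ i $ j) *\<^sub>R kron (H i) (H j))"

definition mean_square_asymptotically_stable ::
    "real^'n^'n \<Rightarrow> ('m::finite \<Rightarrow> real^'n^'n) \<Rightarrow> ('v::finite \<Rightarrow> real^'n^'n) \<Rightarrow> real^'v^'v \<Rightarrow> bool" where
  "mean_square_asymptotically_stable A N H K \<longleftrightarrow>
     (\<forall>z. is_eigenvalue (map_matrix complex_of_real (mean_square_matrix A N H K)) z \<longrightarrow> Re z < 0)"

text \<open>Under mean square asymptotic stability the matrix equation has exactly one solution, so this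
  predicate determines \<open>Q\<close>.\<close>

definition is_observability_gramian ::
    "real^'n^'n \<Rightarrow> ('m::finite \<Rightarrow> real^'n^'n) \<Rightarrow> ('v::finite \<Rightarrow> real^'n^'n) \<Rightarrow> real^'n^'p \<Rightarrow> real^'v^'v
      \<Rightarrow> real^'n^'n \<Rightarrow> bool" where
  "is_observability_gramian A N H C K Q \<longleftrightarrow>
     transpose Q = Q \<and>
     transpose A ** Q + Q ** A + (\<Sum>k\<in>UNIV. transpose (N k) ** Q ** N k)
     + (\<Sum>i\<in>UNIV. \<Sum>j\<in>UNIV. (K $ i $ j) *\<^sub>R (transpose (H i) ** Q ** H j))
     = - (transpose C ** C)"

definition positive_definite :: "real^'n^'n \<Rightarrow> bool" where
  "positive_definite Q \<longleftrightarrow> transpose Q = Q \<and> (\<forall>w. w \<noteq> 0 \<longrightarrow> 0 < w \<bullet> (Q *v w))"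

text \<open>Processes are functions of real time of which only the values at times \<open>t \<ge> 0\<close> matter.\<close>

definition filtered :: "'a measure \<Rightarrow> (real \<Rightarrow> 'a measure) \<Rightarrow> bool" where
  "filtered P F \<longleftrightarrow> (\<forall>t\<ge>0. subalgebra P (F t)) \<and> (\<forall>s t. 0 \<le> s \<and> s \<le> t \<longrightarrow> sets (F s) \<subseteq> sets (F t))"

definition adapted :: "(real \<Rightarrow> 'a measure) \<Rightarrow> (real \<Rightarrow> 'a \<Rightarrow> 'b::topological_space) \<Rightarrow> bool" where
  "adapted F X \<longleftrightarrow> (\<forall>t\<ge>0. X t \<in> borel_measurable (F t))"

definition cadlag :: "(real \<Rightarrow> 'b::topological_space) \<Rightarrow> bool" where
  "cadlag f \<longleftrightarrow>
     (\<forall>t\<ge>0. (f \<longlongrightarrow> f t) (at_right t)) \<and> (\<forall>t>0. \<exists>l. (f \<longlongrightarrow> l) (at_left t))"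

text \<open>A Levy process with respect to a filtration: increments after time \<open>s\<close> are independent of
  \<open>F s\<close>. For the filtration generated by the process this is independence of increments.
  Cadlag paths are not demanded; stochastic continuity ensures a cadlag modification.\<close>

definition levy_process ::
    "'a measure \<Rightarrow> (real \<Rightarrow> 'a measure) \<Rightarrow> (real \<Rightarrow> 'a \<Rightarrow> 'b::euclidean_space) \<Rightarrow> bool" where
  "levy_process P F M \<longleftrightarrow>
     adapted F M \<and>
     (AE \<omega> in P. M 0 \<omega> = 0) \<and>
     (\<forall>s t. 0 \<le> s \<and> s \<le> t \<longrightarrow>
        prob_space.indep_set P (sets (F s))
          (sets (vimage_algebra (space P) (\<lambda>\<omega>. M t \<omega> - M s \<omega>) borel))) \<and>
     (\<forall>s t. 0 \<le> s \<and> s \<le> t \<longrightarrow>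
        distr P borel (\<lambda>\<omega>. M t \<omega> - M s \<omega>) = distr P borel (M (t - s))) \<and>
     (\<forall>t\<ge>0. \<forall>\<epsilon>>0.
        ((\<lambda>s. measure P {\<omega>\<in>space P. norm (M s \<omega> - M t \<omega>) > \<epsilon>}) \<longlongrightarrow> 0) (at t within {0..}))"

definition tendsto_0_in_prob :: "'a measure \<Rightarrow> (nat \<Rightarrow> 'a \<Rightarrow> ennreal) \<Rightarrow> bool" where
  "tendsto_0_in_prob P X \<longleftrightarrow>
     (\<forall>\<epsilon>>0. (\<lambda>n. measure P {\<omega>\<in>space P. X n \<omega> > ennreal \<epsilon>}) \<longlonglongrightarrow> 0)"

text \<open>Only times \<open>t > 0\<close> play a role for integrals over \<open>(0,t]\<close>, so the predictable
  \<open>\<sigma>\<close>-algebra is taken on \<open>(0,\<infinity>) \<times> \<Omega>\<close>.\<close>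

definition predictable_sigma :: "'a measure \<Rightarrow> (real \<Rightarrow> 'a measure) \<Rightarrow> (real \<times> 'a) measure" where
  "predictable_sigma P F =
     sigma ({0<..} \<times> space P) {{s<..t} \<times> B |s t B. 0 \<le> s \<and> s \<le> t \<and> B \<in> sets (F s)}"

definition predictable ::
    "'a measure \<Rightarrow> (real \<Rightarrow> 'a measure) \<Rightarrow> (real \<Rightarrow> 'a \<Rightarrow> 'b::topological_space) \<Rightarrow> bool" where
  "predictable P F \<Phi> \<longleftrightarrow> (\<lambda>(t, \<omega>). \<Phi> t \<omega>) \<in> borel_measurable (predictable_sigma P F)"

text \<open>The simple predictable process \<open>\<Sum>\<^sub>j \<xi>\<^sub>j 1\<^bsub>(\<tau>\<^sub>j, \<tau>\<^sub>j\<^sub>+\<^sub>1]\<^esub>\<close>, \<open>j < k\<close>, and its integral over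
  \<open>(0,t]\<close> with respect to a real-valued process.\<close>

definition simple_integrand ::
    "'a measure \<Rightarrow> (real \<Rightarrow> 'a measure) \<Rightarrow> nat \<Rightarrow> (nat \<Rightarrow> real) \<Rightarrow> (nat \<Rightarrow> 'a \<Rightarrow> 'b::euclidean_space)
      \<Rightarrow> bool" where
  "simple_integrand P F k \<tau> \<xi> \<longleftrightarrow>
     0 \<le> \<tau> 0 \<and> (\<forall>j<k. \<tau> j \<le> \<tau> (Suc j)) \<and>
     (\<forall>j<k. \<xi> j \<in> borel_measurable (F (\<tau> j)) \<and> (\<exists>b. \<forall>\<omega>\<in>space P. norm (\<xi> j \<omega>) \<le> b))"

definition simple_process ::
    "nat \<Rightarrow> (nat \<Rightarrow> real) \<Rightarrow> (nat \<Rightarrow> 'a \<Rightarrow> 'b::euclidean_space) \<Rightarrow> real \<Rightarrow> 'a \<Rightarrow> 'b" where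
  "simple_process k \<tau> \<xi> s \<omega> = (\<Sum>j<k. indicator {\<tau> j<..\<tau> (Suc j)} s *\<^sub>R \<xi> j \<omega>)"

definition simple_integral ::
    "(real \<Rightarrow> 'a \<Rightarrow> real) \<Rightarrow> nat \<Rightarrow> (nat \<Rightarrow> real) \<Rightarrow> (nat \<Rightarrow> 'a \<Rightarrow> 'b::euclidean_space) \<Rightarrow> real \<Rightarrow> 'a \<Rightarrow> 'b"
  where
  "simple_integral L k \<tau> \<xi> t \<omega> =
     (\<Sum>j<k. (L (min t (\<tau> (Suc j))) \<omega> - L (min t (\<tau> j)) \<omega>) *\<^sub>R \<xi> j \<omega>)"

text \<open>\<open>has_stoch_integral P F L \<Phi> t J\<close>: the random variable \<open>J\<close> is (a version of) the Ito integral
  \<open>\<integral>\<^sub>0\<^sup>t \<Phi>(s) dL(s)\<close>, for predictable \<open>\<Phi>\<close> with \<open>\<integral>\<^sub>0\<^sup>t \<parallel>\<Phi>(s)\<parallel>\<^sup>2 ds < \<infinity>\<close> almost surely. It is meant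
  for \<open>L\<close> a square integrable mean zero Levy process, whose angle bracket is a multiple of
  \<open>t\<close>; this is why integrands are approximated in \<open>L\<^sup>2(ds)\<close>. The approximation in probability
  extends the \<open>L\<^sup>2(ds \<otimes> P)\<close> theory and needs no moments of \<open>\<Phi>\<close>.\<close>

definition has_stoch_integral ::
    "'a measure \<Rightarrow> (real \<Rightarrow> 'a measure) \<Rightarrow> (real \<Rightarrow> 'a \<Rightarrow> real)
      \<Rightarrow> (real \<Rightarrow> 'a \<Rightarrow> 'b::euclidean_space) \<Rightarrow> real \<Rightarrow> ('a \<Rightarrow> 'b) \<Rightarrow> bool" where
  "has_stoch_integral P F L \<Phi> t J \<longleftrightarrow>
     predictable P F \<Phi> \<and> J \<in> borel_measurable P \<and>
     (\<exists>k \<tau> \<xi>.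
        (\<forall>n. simple_integrand P F (k n) (\<tau> n) (\<xi> n)) \<and>
        tendsto_0_in_prob P (\<lambda>n \<omega>.
          \<integral>\<^sup>+s\<in>{0<..t}. ennreal ((norm (\<Phi> s \<omega> - simple_process (k n) (\<tau> n) (\<xi> n) s \<omega>))\<^sup>2) \<partial>lborel) \<and>
        tendsto_0_in_prob P (\<lambda>n \<omega>.
          ennreal (norm (simple_integral L (k n) (\<tau> n) (\<xi> n) t \<omega> - J \<omega>))))"

definition left_lim :: "(real \<Rightarrow> 'a \<Rightarrow> 'b::t2_space) \<Rightarrow> real \<Rightarrow> 'a \<Rightarrow> 'b" where
  "left_lim x t \<omega> = Lim (at_left t) (\<lambda>s. x s \<omega>)"

definition is_control :: "(real \<Rightarrow> real^'m) \<Rightarrow> bool" where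
  "is_control u \<longleftrightarrow>
     set_borel_measurable lebesgue {0..} u \<and>
     (\<forall>T>0. set_integrable lebesgue {0..T} (\<lambda>t. (norm (u t))\<^sup>2))"

text \<open>Solutions of \<open>dx = [A x + \<Sum>\<^sub>k N\<^sub>k x u\<^sub>k] dt + \<Sum>\<^sub>i H\<^sub>i x(t-) dM\<^sub>i\<close>, \<open>x(0) = x\<^sub>0\<close>, in integral form;
  \<open>J i t\<close> is a version of \<open>\<integral>\<^sub>0\<^sup>t H\<^sub>i x(s-) dM\<^sub>i(s)\<close>. No integrability of the solution is part of
  the definition.\<close>

definition is_solution ::
    "'a measure \<Rightarrow> (real \<Rightarrow> 'a measure) \<Rightarrow> (real \<Rightarrow> 'a \<Rightarrow> real^'v)
      \<Rightarrow> real^'n^'n \<Rightarrow> ('m::finite \<Rightarrow> real^'n^'n) \<Rightarrow> ('v::finite \<Rightarrow> real^'n^'n)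
      \<Rightarrow> (real \<Rightarrow> real^'m) \<Rightarrow> real^'n \<Rightarrow> (real \<Rightarrow> 'a \<Rightarrow> real^'n) \<Rightarrow> bool" where
  "is_solution P F M A N H u x0 x \<longleftrightarrow>
     adapted F x \<and> (\<forall>\<omega>\<in>space P. cadlag (\<lambda>t. x t \<omega>)) \<and>
     (\<exists>J. (\<forall>i. \<forall>t\<ge>0.
             has_stoch_integral P F (\<lambda>s \<omega>. M s \<omega> $ i) (\<lambda>s \<omega>. H i *v left_lim x s \<omega>) t (J i t)) \<and>
          (\<forall>t\<ge>0. AE \<omega> in P.
             x t \<omega> = x0
               + (LINT s:{0..t}|lebesgue. A *v x s \<omega> + (\<Sum>k\<in>UNIV. (u s $ k) *\<^sub>R (N k *v x s \<omega>)))
               + (\<Sum>i\<in>UNIV. J i t \<omega>)))"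

end

theory Submission
  imports Defs
begin

text \<open>
  Kill the solution when it leaves a ball: \<open>X = x\<close> as long as \<open>\<parallel>x\<parallel> \<le> R\<close> has held up to now and \<open>X = 0\<close>
  afterwards. On the event that \<open>x\<close> is still alive at time \<open>t\<close>, the process \<open>x(t)\<close> is the limit in probability of
  \<open>Z\<^sub>n(t) = x\<^sub>0 + \<integral>\<^sub>0\<^sup>t (A X + \<Sum>\<^sub>k u\<^sub>k N\<^sub>k X) ds + \<Sum>\<^sub>i \<integral>\<^sub>0\<^sup>t H\<^sub>i X\<^sub>n dM\<^sub>i\<close>, where \<open>X\<^sub>n\<close> samples \<open>X\<close> on a
  grid; this needs only a Lenglart inequality for simple integrands. For \<open>Z\<^sub>n\<close> the Ito formula for the quadratic form of \<open>Q\<close> holds in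
  expectation by Fubini's theorem, the martingale property and the isometry of simple integrals.
  In the limit, with the Gramian equation and
  \<open>2 u\<^sub>k X\<^sup>T Q N\<^sub>k X \<le> (N\<^sub>k X)\<^sup>T Q N\<^sub>k X + u\<^sub>k\<^sup>2 X\<^sup>T Q X\<close>, the function \<open>W(t) = E X(t)\<^sup>T Q X(t)\<close> satisfies
  \<open>W(t) + \<integral>\<^sub>0\<^sup>t E \<parallel>C X\<parallel>\<^sup>2 ds \<le> x\<^sub>0\<^sup>T Q x\<^sub>0 + \<integral>\<^sub>0\<^sup>t \<parallel>u\<parallel>\<^sup>2 W ds\<close>. Gronwall's inequality bounds
  \<open>\<integral>\<^sub>0\<^sup>T E \<parallel>C X\<parallel>\<^sup>2 ds\<close>, and \<open>R \<rightarrow> \<infinity>\<close> recovers \<open>x\<close> because cadlag paths are bounded.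
\<close>

section \<open>Real analysis\<close>

text \<open>The solution is known only through almost sure equations and limits in probability, so
  no moment of \<open>x\<close> is at hand; the killed process supplies boundedness instead.
  Stopping would not: a jump may carry \<open>x\<close> arbitrarily far beyond \<open>R\<close>, and
  the stopped process would keep that value. Killing discards it, at the price that
  \<open>killed\<close> satisfies no equation after the exit. This price is paid with the sign of
  the form: after the exit the energy of Z_n is nonnegative while that of X is zero, so an identity
  for Z_n becomes an inequality for X in the needed direction. The survival event is stated at each
  fixed time, which avoids stopping times and any right-continuity of the filtration. Only the noise
  of Z_n is sampled; its drift uses X itself, so that on the survival event x - Z_n consists of
  errors of stochastic integrals alone.\<close>

lemma cadlag_bounded:
  fixes f :: "real \<Rightarrow> 'b::metric_space"
  assumes "cadlag f"
  shows "bounded (f ` {0..T})"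
proof (cases "0 \<le> T")
  case True
  \<comment> \<open>Bolzano's lemma tests intervals around 0 that contain negative times, where
    \<open>cadlag\<close> says nothing; hence the intersection with \<open>{0..}\<close>.\<close>
  let ?P = "\<lambda>a b. bounded (f ` ({a..b} \<inter> {0..}))"
  have "?P 0 T"
  proof (rule Bolzano[where P = ?P, OF True])
    fix a b c :: real
    assume *: "?P a b" "?P b c" "a \<le> b" "b \<le> c"
    have "{a..c} = {a..b} \<union> {b..c}" using * by auto
    then show "?P a c" using * by (simp add: Int_Un_distrib2 image_Un)
  next
    fix x :: real assume x: "0 \<le> x" "x \<le> T"
    have "(f \<longlongrightarrow> f x) (at_right x)" using assms x by (auto simp: cadlag_def)
    then have "\<forall>\<^sub>F s in at_right x. dist (f s) (f x) < 1" by (rule tendstoD) simp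
    then obtain b where b: "b > x" "\<And>s. x < s \<Longrightarrow> s < b \<Longrightarrow> dist (f s) (f x) < 1"
      by (auto simp: eventually_at_right_field)
    have "\<exists>l c. c < x \<and> (\<forall>s. 0 \<le> s \<and> c < s \<and> s < x \<longrightarrow> dist (f s) l < 1)"
    proof (cases "x = 0")
      \<comment> \<open>No time in \<open>{0..}\<close> lies to the left of 0, so any limit value
        and any negative \<open>c\<close> serve.\<close>
      case True then show ?thesis by (intro exI[of _ "f 0"] exI[of _ "-1"]) auto
    next
      case False
      then have "x > 0" using x by simp
      then obtain l where "(f \<longlongrightarrow> l) (at_left x)" using assms by (auto simp: cadlag_def)
      then have "\<forall>\<^sub>F s in at_left x. dist (f s) l < 1" by (rule tendstoD) simp
      then show ?thesis by (auto simp: eventually_at_left_field)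
    qed
    then obtain l c where c: "c < x" "\<And>s. 0 \<le> s \<Longrightarrow> c < s \<Longrightarrow> s < x \<Longrightarrow> dist (f s) l < 1" by blast
    show "\<exists>d>0. \<forall>a b. a \<le> x \<and> x \<le> b \<and> b - a < d \<longrightarrow> ?P a b"
    proof (intro exI[of _ "min (b - x) (x - c)"] conjI allI impI)
      fix a' b' assume *: "a' \<le> x \<and> x \<le> b' \<and> b' - a' < min (b - x) (x - c)"
      have "f ` ({a'..b'} \<inter> {0..}) \<subseteq> ball (f x) 1 \<union> ball l 1"
      proof (rule image_subsetI)
        fix s assume s: "s \<in> {a'..b'} \<inter> {0..}"
        consider "s = x" | "s > x" | "s < x" by linarith
        then show "f s \<in> ball (f x) 1 \<union> ball l 1"
          using b(2)[of s] c(2)[of s] s * by cases (auto simp: dist_commute)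
      qed
      then show "?P a' b'" by (rule bounded_subset[rotated]) simp
    qed (use b c in auto)
  qed
  moreover have "{0..T} \<inter> {0..} = {0..T}" by auto
  ultimately show ?thesis by simp
qed simp

text \<open>Points where the oscillation exceeds a fixed \<open>e\<close> cannot accumulate:
  one-sided limits make the oscillation small in a punctured neighbourhood of every point. Hence
  only finitely many of them lie in \<open>{0..T}\<close>, and every discontinuity has oscillation
  above some 1 / (n + 1).\<close>

lemma cadlag_countable_discontinuities:
  fixes f :: "real \<Rightarrow> 'b::metric_space"
  assumes "cadlag f"
  shows "countable {s. 0 < s \<and> \<not> isCont f s}"
proof -
  \<comment> \<open>Two nearby points are compared with each other and not with \<open>s\<close>, so
    that both can be estimated by the one-sided limit at \<open>x\<close>.\<close>
  define D where "D e = {s. 0 < s \<and> (\<forall>d>0. \<exists>r r'. \<bar>r - s\<bar> < d \<and> \<bar>r' - s\<bar> < d \<and> dist (f r) (f r') > e)}"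
    for e :: real
  have fin: "finite (D e \<inter> {0..T})" if e: "e > 0" and T: "T \<ge> 0" for e T
  proof (rule Bolzano[where P = "\<lambda>a b. finite (D e \<inter> {a..b})", OF T])
    fix a b c :: real
    assume *: "finite (D e \<inter> {a..b})" "finite (D e \<inter> {b..c})" "a \<le> b" "b \<le> c"
    have "{a..c} = {a..b} \<union> {b..c}" using * by auto
    then show "finite (D e \<inter> {a..c})" using * by (simp add: Int_Un_distrib)
  next
    fix x :: real assume x: "0 \<le> x" "x \<le> T"
    have "(f \<longlongrightarrow> f x) (at_right x)" using assms x by (auto simp: cadlag_def)
    then have "\<forall>\<^sub>F s in at_right x. dist (f s) (f x) < e / 2" by (rule tendstoD) (simp add: e)
    then obtain b where b: "b > x" "\<And>s. x < s \<Longrightarrow> s < b \<Longrightarrow> dist (f s) (f x) < e / 2"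
      by (auto simp: eventually_at_right_field)
    have "\<exists>l c. c < x \<and> (\<forall>s. 0 < s \<and> c < s \<and> s < x \<longrightarrow> dist (f s) l < e / 2)"
    proof (cases "x = 0")
      case True then show ?thesis by (intro exI[of _ "f 0"] exI[of _ "-1"]) auto
    next
      case False
      then have "x > 0" using x by simp
      then obtain l where "(f \<longlongrightarrow> l) (at_left x)" using assms by (auto simp: cadlag_def)
      then have "\<forall>\<^sub>F s in at_left x. dist (f s) l < e / 2" by (rule tendstoD) (simp add: e)
      then show ?thesis by (auto simp: eventually_at_left_field)
    qed
    then obtain l c where c: "c < x" "\<And>s. 0 < s \<Longrightarrow> c < s \<Longrightarrow> s < x \<Longrightarrow> dist (f s) l < e / 2" by blast
    show "\<exists>d>0. \<forall>a b. a \<le> x \<and> x \<le> b \<and> b - a < d \<longrightarrow> finite (D e \<inter> {a..b})"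
    proof (intro exI[of _ "min (b - x) (x - c)"] conjI allI impI)
      fix a' b' assume *: "a' \<le> x \<and> x \<le> b' \<and> b' - a' < min (b - x) (x - c)"
      have "D e \<inter> {a'..b'} \<subseteq> {x}"
      proof (rule ccontr)
        assume "\<not> D e \<inter> {a'..b'} \<subseteq> {x}"
        then obtain s where s: "s \<in> D e" "a' \<le> s" "s \<le> b'" "s \<noteq> x" by (auto simp: subset_iff)
        have s0: "s > 0" using s by (auto simp: D_def)
        consider "s > x" | "s < x" using s by linarith
        then show False
        proof cases
          case 1
          have "min (s - x) (b - s) > 0" using 1 s * by auto
          then obtain r r' where r: "\<bar>r - s\<bar> < min (s - x) (b - s)" "\<bar>r' - s\<bar> < min (s - x) (b - s)"
            "dist (f r) (f r') > e" using s(1) unfolding D_def by blast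
          have "x < r" "r < b" "x < r'" "r' < b" using r(1,2) by auto
          then have "dist (f r) (f x) < e / 2" "dist (f r') (f x) < e / 2" by (simp_all only: b(2))
          then show False using r(3) dist_triangle_half_l[of "f r" "f x" e "f r'"] by (auto simp: dist_commute)
        next
          case 2
          \<comment> \<open>The entry \<open>s\<close> in the minimum keeps \<open>r\<close> and
            \<open>r'\<close> positive, where the estimate by the left limit is available.\<close>
          have "min (x - s) (min s (s - c)) > 0" using 2 s * s0 by auto
          then obtain r r' where r: "\<bar>r - s\<bar> < min (x - s) (min s (s - c))"
            "\<bar>r' - s\<bar> < min (x - s) (min s (s - c))"
            "dist (f r) (f r') > e" using s(1) unfolding D_def by blast
          have "0 < r" "c < r" "r < x" "0 < r'" "c < r'" "r' < x" using r(1,2) by auto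
          then have "dist (f r) l < e / 2" "dist (f r') l < e / 2" by (simp_all only: c(2))
          then show False using r(3) dist_triangle_half_l[of "f r" l e "f r'"] by (auto simp: dist_commute)
        qed
      qed
      then show "finite (D e \<inter> {a'..b'})" by (rule finite_subset) simp
    qed (use b c in auto)
  qed
  have "{s. 0 < s \<and> \<not> isCont f s} \<subseteq> (\<Union>n::nat. \<Union>m::nat. D (1 / Suc n) \<inter> {0..real m})"
  proof
    fix s assume "s \<in> {s. 0 < s \<and> \<not> isCont f s}"
    then have s: "0 < s" "\<not> isCont f s" by auto
    then obtain e where e: "e > 0" "\<And>d. d > 0 \<Longrightarrow> \<exists>r. dist r s < d \<and> \<not> dist (f r) (f s) < e"
      unfolding continuous_at_eps_delta by blast
    obtain n where n: "1 / real (Suc n) < e" using nat_approx_posE[OF e(1)] by auto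
    have "s \<in> D (1 / Suc n)" unfolding D_def
    proof (intro CollectI conjI allI impI)
      fix d :: real assume "d > 0"
      then obtain r where "dist r s < d" "\<not> dist (f r) (f s) < e" using e(2) by blast
      then show "\<exists>r r'. \<bar>r - s\<bar> < d \<and> \<bar>r' - s\<bar> < d \<and> 1 / real (Suc n) < dist (f r) (f r')"
        using n \<open>d > 0\<close> by (intro exI[of _ r] exI[of _ s]) (auto simp: dist_real_def)
    qed (use s in auto)
    moreover obtain m where "s \<le> real m" using real_arch_simple by blast
    ultimately show "s \<in> (\<Union>n::nat. \<Union>m::nat. D (1 / Suc n) \<inter> {0..real m})" using s(1) by auto
  qed
  then show ?thesis
    by (rule countable_subset) (intro countable_UN countableI_type countable_finite fin; simp)
qed

text \<open>Cells may be empty, so grids truncated by \<open>min t\<close> qualify. The half-open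
  cells match the intervals on which simple processes are constant.\<close>

lemma step_integral:
  fixes f :: "real \<Rightarrow> real" and c :: "nat \<Rightarrow> real"
  assumes "\<And>l. l < m \<Longrightarrow> g l \<le> g (Suc l)"
    and "\<And>l s. l < m \<Longrightarrow> g l < s \<Longrightarrow> s \<le> g (Suc l) \<Longrightarrow> f s = c l"
  shows "set_integrable lborel {g 0<..g m} f"
    and "(LINT s:{g 0<..g m}|lborel. f s) = (\<Sum>l<m. (g (Suc l) - g l) * c l)"
proof -
  have "g 0 \<le> g m \<and> set_integrable lborel {g 0<..g m} f \<and>
     (LINT s:{g 0<..g m}|lborel. f s) = (\<Sum>l<m. (g (Suc l) - g l) * c l)"
    using assms
  proof (induction m)
    case 0 then show ?case by (simp add: set_integrable_def set_lebesgue_integral_def)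
  next
    case (Suc m)
    then have IH: "g 0 \<le> g m" "set_integrable lborel {g 0<..g m} f"
      "(LINT s:{g 0<..g m}|lborel. f s) = (\<Sum>l<m. (g (Suc l) - g l) * c l)" by auto
    have le: "g m \<le> g (Suc m)" using Suc.prems by simp
    have eq: "{g 0<..g (Suc m)} = {g 0<..g m} \<union> {g m<..g (Suc m)}" using IH le by auto
    have i0: "set_integrable lborel {g m<..g (Suc m)} (\<lambda>_. c m)"
      unfolding set_integrable_def using le by (intro integrable_scaleR_left) (auto intro!: integrable_real_indicator simp: emeasure_lborel_Ioc)
    have fc: "\<And>s. s \<in> {g m<..g (Suc m)} \<Longrightarrow> f s = c m" using Suc.prems(2)[of m] by auto
    have i1: "set_integrable lborel {g m<..g (Suc m)} f"
      using i0 set_integrable_cong[OF refl refl, of _ f "\<lambda>_. c m" lborel] fc by blast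
    have "(LINT s:{g m<..g (Suc m)}|lborel. f s) = (LINT s:{g m<..g (Suc m)}|lborel. c m)"
      by (rule set_lebesgue_integral_cong) (auto simp: fc)
    also have "\<dots> = (g (Suc m) - g m) * c m" using le by (simp add: set_lebesgue_integral_def)
    finally have v: "(LINT s:{g m<..g (Suc m)}|lborel. f s) = (g (Suc m) - g m) * c m" .
    have dis: "{g 0<..g m} \<inter> {g m<..g (Suc m)} = {}" by auto
    show ?case unfolding eq
      using IH le i1 v set_integrable_Un[OF IH(2) i1] set_integral_Un[OF dis IH(2) i1] by auto
  qed
  then show "set_integrable lborel {g 0<..g m} f"
    and "(LINT s:{g 0<..g m}|lborel. f s) = (\<Sum>l<m. (g (Suc l) - g l) * c l)" by auto
qed

text \<open>No continuity of \<open>f\<close> or \<open>a\<close> is assumed, so nothing is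
  differentiated. With \<open>\<alpha>\<close> the integral of \<open>a\<close>, the right side
  \<open>g\<close> increases and satisfies
  \<open>g t \<le> g r + (\<alpha> t - \<alpha> r) * g t\<close>. Cutting \<open>{0..T}\<close>
  where \<open>\<alpha>\<close> takes n equally spaced levels gives
  \<open>(1 - \<alpha> T / n) ^ n * g T \<le> v\<close>, and n tends to infinity.\<close>

lemma gronwall_integral:
  fixes f a :: "real \<Rightarrow> real"
  assumes T: "0 \<le> T"
    and a: "set_integrable lborel {0..T} a" "\<And>s. 0 \<le> a s"
    and af: "set_integrable lborel {0..T} (\<lambda>s. a s * f s)"
    and f: "\<And>s. s \<in> {0..T} \<Longrightarrow> 0 \<le> f s"
      "\<And>t. t \<in> {0..T} \<Longrightarrow> f t \<le> v + (LINT s:{0..t}|lborel. a s * f s)"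
  shows "f T \<le> v * exp (LINT s:{0..T}|lborel. a s)"
proof -
  define \<alpha> where "\<alpha> t = (LINT s:{0..t}|lborel. a s)" for t
  define g where "g t = v + (LINT s:{0..t}|lborel. a s * f s)" for t
  have sub: "set_integrable lborel S h"
    if "set_integrable lborel {0..T} h" "S \<subseteq> {0..T}" "S \<in> sets lborel" for S and h :: "real \<Rightarrow> real"
    using set_integrable_subset[OF that(1)] that by auto
  have split: "(LINT s:{0..t}|lborel. h s) = (LINT s:{0..r}|lborel. h s) + (LINT s:{r<..t}|lborel. h s)"
    if h: "set_integrable lborel {0..T} h" and rt: "0 \<le> r" "r \<le> t" "t \<le> T" for h :: "real \<Rightarrow> real" and r t
  proof -
    have "{0..t} = {0..r} \<union> {r<..t}" using rt by auto
    then show ?thesis using rt by (auto intro!: set_integral_Un sub[OF h])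
  qed
  have nn: "0 \<le> (LINT s:{r<..t}|lborel. a s * f s)" if "0 \<le> r" "t \<le> T" for r t
    unfolding set_lebesgue_integral_def using that by (intro integral_nonneg_AE AE_I2) (auto simp: indicator_def a f)
  have mono: "g r \<le> g t" if "0 \<le> r" "r \<le> t" "t \<le> T" for r t
    using split[OF af that] nn[OF that(1,3)] by (simp add: g_def)
  have amono: "\<alpha> r \<le> \<alpha> t" if "0 \<le> r" "r \<le> t" "t \<le> T" for r t
  proof -
    have "0 \<le> (LINT s:{r<..t}|lborel. a s)"
      unfolding set_lebesgue_integral_def by (intro integral_nonneg_AE AE_I2) (auto simp: indicator_def a)
    then show ?thesis using split[OF a(1) that] by (simp add: \<alpha>_def)
  qed
  have step: "g t \<le> g r + (\<alpha> t - \<alpha> r) * g t" if rt: "0 \<le> r" "r \<le> t" "t \<le> T" for r t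
  proof -
    have "(LINT s:{r<..t}|lborel. a s * f s) \<le> (LINT s:{r<..t}|lborel. a s * g t)"
    proof (rule set_integral_mono)
      show "a s * f s \<le> a s * g t" if "s \<in> {r<..t}" for s
        using that rt f(2)[of s] mono[of s t] by (intro mult_left_mono a) (auto simp: g_def)
    qed (use rt in \<open>auto intro!: sub[OF af] sub[OF a(1)] set_integrable_mult_left\<close>)
    also have "\<dots> = (\<alpha> t - \<alpha> r) * g t" using split[OF a(1) rt] by (simp add: \<alpha>_def)
    finally show ?thesis using split[OF af rt] by (simp add: g_def)
  qed
  have g0: "g 0 = v" and \<alpha>0: "\<alpha> 0 = 0"
  proof -
    have "(LINT s:{0..0}|lborel. h s) = 0" for h :: "real \<Rightarrow> real"
      unfolding set_lebesgue_integral_def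
      by (rule integral_eq_zero_AE, rule eventually_mono[OF AE_lborel_singleton[of "0::real"]]) auto
    then show "g 0 = v" "\<alpha> 0 = 0" by (auto simp: g_def \<alpha>_def)
  qed
  have \<alpha>T: "0 \<le> \<alpha> T" using amono[of 0 T] T \<alpha>0 by simp
  have g_nonneg: "0 \<le> g t" if "t \<in> {0..T}" for t using f[OF that] by (simp add: g_def)
  have cont: "continuous_on {0..T} \<alpha>"
  proof -
    have "continuous_on {0..T} (\<lambda>t. integral {0..t} a)"
      using a(1) T by (intro indefinite_integral_continuous_1 set_borel_integral_eq_integral)
    moreover have "\<alpha> t = integral {0..t} a" if "t \<in> {0..T}" for t
      unfolding \<alpha>_def using that by (intro set_borel_integral_eq_integral sub[OF a(1)]) auto
    ultimately show ?thesis by (subst continuous_on_cong[OF refl]) auto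
  qed
  have main: "(1 - \<alpha> T / n) ^ n * g T \<le> v" if n: "real n > \<alpha> T" "n > 0" for n :: nat
  proof -
    have q: "0 \<le> 1 - \<alpha> T / n" "0 \<le> \<alpha> T / n" using n \<alpha>T by (auto simp: field_simps)
    \<comment> \<open>\<open>\<alpha>\<close> is continuous and attains these levels; cutting by
      levels and not by time keeps all steps of \<open>\<alpha>\<close> equally small.\<close>
    have ex: "\<exists>t\<in>{0..T}. \<alpha> t = i * \<alpha> T / n" if "i \<le> n" for i
    proof -
      have "i * \<alpha> T / n \<le> \<alpha> T" using that n \<alpha>T by (simp add: field_simps mult_right_mono)
      moreover have "0 \<le> i * \<alpha> T / n" using \<alpha>T by simp
      ultimately show ?thesis using IVT'[of \<alpha> 0 "i * \<alpha> T / n" T] T cont \<alpha>0 by auto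
    qed
    have key: "(1 - \<alpha> T / n) ^ i * g t \<le> v" if "i \<le> n" "t \<in> {0..T}" "\<alpha> t = i * \<alpha> T / n" for i t
      using that
    proof (induction i arbitrary: t)
      case 0
      then show ?case using step[of 0 t] \<alpha>0 g0 by simp
    next
      case (Suc i)
      obtain r where r: "r \<in> {0..T}" "\<alpha> r = i * \<alpha> T / n" using ex[of i] Suc.prems by auto
      have "(1 - \<alpha> T / n) * g t \<le> g r"
      \<comment> \<open>The levels coincide when \<open>\<alpha> T = 0\<close>; the chosen times may
        then come in the wrong order, and monotonicity of \<open>g\<close> takes over.\<close>
      proof (cases "r \<le> t")
        case True
        have "\<alpha> t - \<alpha> r = \<alpha> T / n" using r Suc.prems by (simp add: field_simps)
        then show ?thesis using step[of r t] True r Suc.prems by (simp add: algebra_simps)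
      next
        case False
        have "(1 - \<alpha> T / n) * g t \<le> 1 * g t" using q g_nonneg[of t] Suc.prems by (intro mult_right_mono) auto
        then show ?thesis using mono[of t r] False r Suc.prems by simp
      qed
      then have "(1 - \<alpha> T / n) ^ i * ((1 - \<alpha> T / n) * g t) \<le> (1 - \<alpha> T / n) ^ i * g r"
        using q by (intro mult_left_mono) auto
      also have "\<dots> \<le> v" using Suc.IH[of r] r Suc.prems by simp
      finally show ?case by (simp add: mult.assoc mult.left_commute)
    qed
    show ?thesis using key[of n T] n T by simp
  qed
  have "(\<lambda>n. (1 + (- \<alpha> T) / real n) ^ n * g T) \<longlonglongrightarrow> exp (- \<alpha> T) * g T"
    by (intro tendsto_intros tendsto_exp_limit_sequentially)
  moreover have "eventually (\<lambda>n. (1 + (- \<alpha> T) / real n) ^ n * g T \<le> v) sequentially"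
  proof -
    obtain n0 where "real n0 > \<alpha> T" using reals_Archimedean2 by blast
    then show ?thesis by (intro eventually_sequentiallyI[of "max 1 n0"]) (use main in auto)
  qed
  ultimately have "exp (- \<alpha> T) * g T \<le> v"
    by (rule tendsto_upperbound) simp
  then have "g T \<le> v * exp (\<alpha> T)" by (simp add: exp_minus field_simps)
  then show ?thesis using f(2)[of T] T by (simp add: g_def \<alpha>_def)
qed

text \<open>A second moment bound upgrades convergence in probability to convergence of means. On
  the event Y > e the inequality Y \<le> d Y^2 + 1 / (4 d) trades a small share of the second moment
  for a multiple of the probability.\<close>

lemma (in prob_space) expectation_tendsto_0:
  fixes Y :: "nat \<Rightarrow> 'a \<Rightarrow> real"
  assumes Y: "\<And>n. Y n \<in> borel_measurable M" "\<And>n w. 0 \<le> Y n w"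
    "\<And>n. integrable M (\<lambda>w. (Y n w)\<^sup>2)" "\<And>n. expectation (\<lambda>w. (Y n w)\<^sup>2) \<le> B"
    and p: "\<And>e. e > 0 \<Longrightarrow> (\<lambda>n. prob {w\<in>space M. Y n w > e}) \<longlonglongrightarrow> 0"
  shows "(\<lambda>n. expectation (Y n)) \<longlonglongrightarrow> 0"
proof (rule LIMSEQ_I)
  fix r :: real assume r: "r > 0"
  have B: "0 \<le> B" by (rule order_trans[OF _ Y(4)[of 0]]) simp
  \<comment> \<open>The terms \<open>e\<close>, \<open>d * B\<close> and, for large n, the
    probability term are each at most r / 4; \<open>B + 1\<close> keeps the denominator of
    \<open>d\<close> positive when \<open>B = 0\<close>.\<close>
  define e where "e = r / 4"
  define d where "d = r / (4 * (B + 1))"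
  have e: "e > 0" and d: "d > 0" "d * B \<le> r / 4" using r B by (auto simp: e_def d_def field_simps)
  have int: "integrable M (Y n)" for n
    by (rule square_integrable_imp_integrable) (use Y in auto)
  have bound: "expectation (Y n) \<le> e + d * B + prob {w\<in>space M. Y n w > e} / (4 * d)" for n
  proof -
    let ?S = "{w\<in>space M. Y n w > e}"
    have S[measurable]: "?S \<in> sets M" using Y(1) by measurable
    have "expectation (Y n) \<le> expectation (\<lambda>w. e + d * (Y n w)\<^sup>2 + indicator ?S w / (4 * d))"
    proof (rule integral_mono[OF int])
      show "integrable M (\<lambda>w. e + d * (Y n w)\<^sup>2 + indicator ?S w / (4 * d))"
        using Y(3)[of n] by (intro Bochner_Integration.integrable_add integrable_mult_right integrable_divide) (auto simp: emeasure_eq_measure)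
      fix w assume "w \<in> space M"
      have "Y n w \<le> d * (Y n w)\<^sup>2 + 1 / (4 * d)"
      proof -
        have "0 \<le> (2 * d * Y n w - 1)\<^sup>2 / (4 * d)" using d by simp
        also have "\<dots> = d * (Y n w)\<^sup>2 - Y n w + 1 / (4 * d)" using d by (simp add: field_simps power2_eq_square)
        finally show ?thesis by simp
      qed
      moreover have "0 \<le> d * (Y n w)\<^sup>2" using d by simp
      ultimately show "Y n w \<le> e + d * (Y n w)\<^sup>2 + indicator ?S w / (4 * d)"
        using e \<open>w \<in> space M\<close> by (auto simp: indicator_def)
    qed
    also have "\<dots> = e + d * expectation (\<lambda>w. (Y n w)\<^sup>2) + prob ?S / (4 * d)"
      using Y(3)[of n] by (simp add: prob_space emeasure_eq_measure)
    also have "\<dots> \<le> e + d * B + prob ?S / (4 * d)" using Y(4)[of n] d by simp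
    finally show ?thesis .
  qed
  have "(\<lambda>n. prob {w\<in>space M. Y n w > e} / (4 * d)) \<longlonglongrightarrow> 0 / (4 * d)"
    by (intro tendsto_intros p e) (use d in auto)
  then have "(\<lambda>n. prob {w\<in>space M. Y n w > e} / (4 * d)) \<longlonglongrightarrow> 0" by simp
  from LIMSEQ_D[OF this, of "r / 4"] r obtain no where
    no: "\<And>n. n \<ge> no \<Longrightarrow> \<bar>prob {w\<in>space M. Y n w > e} / (4 * d)\<bar> < r / 4" by (auto simp: abs_mult)
  show "\<exists>no. \<forall>n\<ge>no. norm (expectation (Y n) - 0) < r"
  proof (intro exI allI impI)
    fix n assume "n \<ge> no"
    from no[OF this] bound[of n] have "expectation (Y n) < r" using d r by (auto simp: e_def)
    moreover have "0 \<le> expectation (Y n)" using Y by simp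
    ultimately show "norm (expectation (Y n) - 0) < r" by simp
  qed
qed

section \<open>Sums over grids for square integrable Levy processes\<close>

lemma borel_measurable_bilinear:
  fixes b :: "'b::euclidean_space \<Rightarrow> 'c::euclidean_space \<Rightarrow> 'd::real_normed_vector"
  assumes b: "bounded_bilinear b"
    and m: "X \<in> borel_measurable N" "Y \<in> borel_measurable N"
  shows "(\<lambda>w. b (X w) (Y w)) \<in> borel_measurable N"
  by (rule borel_measurable_continuous_Pair[OF m])
    (intro bounded_bilinear.continuous_on[OF b] continuous_intros)

locale square_integrable_levy = prob_space P
  for P :: "'a measure" +
  fixes F :: "real \<Rightarrow> 'a measure"
    and M :: "real \<Rightarrow> 'a \<Rightarrow> real^'v::finite"
    and K :: "real^'v^'v"
  assumes filt: "filtered P F"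
    and levy: "levy_process P F M"
    and square_integrable: "\<And>t. t \<ge> 0 \<Longrightarrow> integrable P (\<lambda>w. (norm (M t w))\<^sup>2)"
    and mean_zero: "\<And>t. t \<ge> 0 \<Longrightarrow> (LINT w|P. M t w) = 0"
    and covariance: "\<And>t i j. t \<ge> 0 \<Longrightarrow> (LINT w|P. M t w $ i * M t w $ j) = K $ i $ j * t"
begin

abbreviation incr :: "'v \<Rightarrow> real \<Rightarrow> real \<Rightarrow> 'a \<Rightarrow> real" where
  "incr i s t w \<equiv> M t w $ i - M s w $ i"

abbreviation integral_M where
  "integral_M i \<equiv> simple_integral (\<lambda>s w. M s w $ i)"

abbreviation PT :: "('a \<times> real) measure" where
  "PT \<equiv> P \<Otimes>\<^sub>M lborel"

lemma subalgebra_F: "0 \<le> t \<Longrightarrow> subalgebra P (F t)"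
  using filt by (auto simp: filtered_def)

lemma space_F: "0 \<le> t \<Longrightarrow> space (F t) = space P"
  using subalgebra_F by (auto simp: subalgebra_def)

lemma sets_F: "0 \<le> t \<Longrightarrow> sets (F t) \<subseteq> sets P"
  using subalgebra_F by (auto simp: subalgebra_def)

lemma measurable_F_P: "0 \<le> t \<Longrightarrow> f \<in> measurable (F t) N \<Longrightarrow> f \<in> measurable P N"
  using measurable_from_subalg subalgebra_F by blast

lemma measurable_F_mono: "0 \<le> s \<Longrightarrow> s \<le> t \<Longrightarrow> f \<in> measurable (F s) N \<Longrightarrow> f \<in> measurable (F t) N"
  by (rule measurable_from_subalg[of _ "F s"])
    (use filt space_F[of s] space_F[of t] in \<open>auto simp: subalgebra_def filtered_def\<close>)

lemma levy_measurable_F: "0 \<le> t \<Longrightarrow> M t \<in> borel_measurable (F t)"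
  using levy by (auto simp: levy_process_def adapted_def)

lemma levy_measurable: "0 \<le> t \<Longrightarrow> M t \<in> borel_measurable P"
  using levy_measurable_F measurable_F_P by blast

lemma levy_component_measurable_F: "0 \<le> t \<Longrightarrow> (\<lambda>w. M t w $ i) \<in> borel_measurable (F t)"
  by (rule borel_measurable_continuous_on[OF _ levy_measurable_F]) (auto intro!: continuous_intros)

lemma levy_component_measurable: "0 \<le> t \<Longrightarrow> (\<lambda>w. M t w $ i) \<in> borel_measurable P"
  using levy_component_measurable_F measurable_F_P by blast

text \<open>Stationarity turns every moment of an increment into a moment of
  \<open>M (t - s)\<close>, where the assumptions on mean and covariance apply.\<close>

lemma increment_transfer:
  fixes g :: "real^'v \<Rightarrow> real"
  assumes st: "0 \<le> s" "s \<le> t" and g[measurable]: "g \<in> borel_measurable borel"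
  shows "integrable P (\<lambda>w. g (M t w - M s w)) \<longleftrightarrow> integrable P (\<lambda>w. g (M (t - s) w))"
    and "(LINT w|P. g (M t w - M s w)) = (LINT w|P. g (M (t - s) w))"
proof -
  have [measurable]: "M t \<in> borel_measurable P" "M s \<in> borel_measurable P" "M (t - s) \<in> borel_measurable P"
    using st by (auto intro: levy_measurable)
  have d: "distr P borel (\<lambda>w. M t w - M s w) = distr P borel (M (t - s))"
    using levy st by (auto simp: levy_process_def)
  have "integrable P (\<lambda>w. g (M t w - M s w)) \<longleftrightarrow> integrable (distr P borel (\<lambda>w. M t w - M s w)) g"
    by (subst integrable_distr_eq) auto
  also have "\<dots> \<longleftrightarrow> integrable P (\<lambda>w. g (M (t - s) w))"
    unfolding d by (subst integrable_distr_eq) auto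
  finally show "integrable P (\<lambda>w. g (M t w - M s w)) \<longleftrightarrow> integrable P (\<lambda>w. g (M (t - s) w))" .
  have "(LINT w|P. g (M t w - M s w)) = integral\<^sup>L (distr P borel (\<lambda>w. M t w - M s w)) g"
    by (subst integral_distr) auto
  also have "\<dots> = (LINT w|P. g (M (t - s) w))"
    unfolding d by (subst integral_distr) auto
  finally show "(LINT w|P. g (M t w - M s w)) = (LINT w|P. g (M (t - s) w))" .
qed

lemma increment_norm_square_integrable:
  assumes "0 \<le> s" "s \<le> t"
  shows "integrable P (\<lambda>w. (norm (M t w - M s w))\<^sup>2)"
  by (subst increment_transfer(1)[where g = "\<lambda>v. (norm v)\<^sup>2"]) (use assms square_integrable in auto)

lemma component_measurable: "(\<lambda>v::real^'v. v $ i) \<in> borel_measurable borel"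
  by (intro borel_measurable_continuous_onI continuous_intros)

lemma increment_integrable:
  assumes st: "0 \<le> s" "s \<le> t"
  shows "integrable P (\<lambda>w. incr i s t w)"
proof (rule square_integrable_imp_integrable)
  show m: "(\<lambda>w. incr i s t w) \<in> borel_measurable P"
    using st by (intro borel_measurable_diff levy_component_measurable) auto
  show "integrable P (\<lambda>w. (incr i s t w)\<^sup>2)"
  proof (rule Bochner_Integration.integrable_bound[OF increment_norm_square_integrable[OF st]])
    show "AE w in P. norm ((incr i s t w)\<^sup>2) \<le> norm ((norm (M t w - M s w))\<^sup>2)"
      using component_le_norm_cart[of "M t _ - M s _" i] by (auto simp: abs_le_square_iff[symmetric])
  qed (use m in measurable)
qed

lemma increment_mean:
  assumes st: "0 \<le> s" "s \<le> t"
  shows "(LINT w|P. incr i s t w) = 0"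
proof -
  have "(LINT w|P. incr i s t w) = (LINT w|P. M (t - s) w $ i)"
    using increment_transfer(2)[OF st component_measurable[of i]] by simp
  also have "\<dots> = (LINT w|P. M (t - s) w) $ i"
  proof -
    have "integrable P (M (t - s))"
      by (rule integrable_norm_cancel, rule square_integrable_imp_integrable)
        (use st levy_measurable[of "t - s"] square_integrable in auto)
    then show ?thesis by (rule integral_bounded_linear[OF bounded_linear_vec_nth])
  qed
  finally show ?thesis using mean_zero[of "t - s"] st by simp
qed

lemma increment_product:
  assumes st: "0 \<le> s" "s \<le> t"
  shows "integrable P (\<lambda>w. incr i s t w * incr j s t w)"
    and "(LINT w|P. incr i s t w * incr j s t w) = K $ i $ j * (t - s)"
proof -
  note [measurable] = component_measurable
  have m: "(\<lambda>w. incr i s t w) \<in> borel_measurable P" for i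
    using st by (intro borel_measurable_diff levy_component_measurable) auto
  show "integrable P (\<lambda>w. incr i s t w * incr j s t w)"
  proof (rule Bochner_Integration.integrable_bound[OF increment_norm_square_integrable[OF st]])
    show "AE w in P. norm (incr i s t w * incr j s t w) \<le> norm ((norm (M t w - M s w))\<^sup>2)"
    proof (rule AE_I2)
      fix w
      have "\<bar>(M t w - M s w) $ i\<bar> * \<bar>(M t w - M s w) $ j\<bar> \<le> norm (M t w - M s w) * norm (M t w - M s w)"
        by (intro mult_mono component_le_norm_cart) auto
      then show "norm (incr i s t w * incr j s t w) \<le> norm ((norm (M t w - M s w))\<^sup>2)"
        by (simp add: abs_mult power2_eq_square)
    qed
  qed (use m in \<open>intro borel_measurable_times\<close>)
  have "(\<lambda>v::real^'v. v $ i * v $ j) \<in> borel_measurable borel" by measurable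
  from increment_transfer(2)[OF st this]
  show "(LINT w|P. incr i s t w * incr j s t w) = K $ i $ j * (t - s)"
    using covariance[of "t - s" i j] st by simp
qed

text \<open>Independence of \<open>F s\<close> and the whole increment passes to the smaller
  sigma-algebras of \<open>X\<close> and of a function of the increment, for which expectations
  factor. The function \<open>g\<close> will be a coordinate or a product of two
  coordinates.\<close>

lemma increment_independent:
  fixes X :: "'a \<Rightarrow> real" and g :: "real^'v \<Rightarrow> real"
  assumes st: "0 \<le> s" "s \<le> t"
    and X: "X \<in> borel_measurable (F s)" "integrable P X"
    and g[measurable]: "g \<in> borel_measurable borel" and gi: "integrable P (\<lambda>w. g (M t w - M s w))"
  shows "integrable P (\<lambda>w. g (M t w - M s w) * X w)"
    and "(LINT w|P. g (M t w - M s w) * X w) = (LINT w|P. g (M t w - M s w)) * (LINT w|P. X w)"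
proof -
  let ?I = "\<lambda>w. M t w - M s w"
  let ?V = "vimage_algebra (space P) ?I borel"
  have [measurable]: "M t \<in> borel_measurable P" "M s \<in> borel_measurable P"
    using st by (auto intro: levy_measurable)
  have ind: "indep_set (sets (F s)) (sets ?V)"
    using levy st by (auto simp: levy_process_def)
  have gV: "(\<lambda>w. g (?I w)) \<in> borel_measurable ?V"
    using measurable_vimage_algebra1[of ?I "space P" borel] g
    by (auto intro: measurable_compose)
  have "indep_set (sigma_sets (space P) {(\<lambda>w. g (?I w)) -` A \<inter> space P |A. A \<in> sets borel})
      (sigma_sets (space P) {X -` A \<inter> space P |A. A \<in> sets borel})"
    unfolding indep_set_def
  proof (rule indep_sets_mono_sets)
    \<comment> \<open>\<open>levy_process\<close> lists the past first, whereas the pair of random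
      variables lists the increment first.\<close>
    show "indep_sets (case_bool (sets ?V) (sets (F s))) UNIV"
      using ind unfolding indep_set_def[symmetric] indep_sets2_eq by (metis Int_commute mult.commute)
    fix b :: bool
    have "sigma_sets (space P) {(\<lambda>w. g (?I w)) -` A \<inter> space P |A. A \<in> sets borel} \<subseteq> sets ?V"
      using sets.sigma_sets_subset[of "{(\<lambda>w. g (?I w)) -` A \<inter> space P |A. A \<in> sets borel}" ?V]
        measurable_sets[OF gV] by auto
    moreover have "sigma_sets (space P) {X -` A \<inter> space P |A. A \<in> sets borel} \<subseteq> sets (F s)"
      using sets.sigma_sets_subset[of "{X -` A \<inter> space P |A. A \<in> sets borel}" "F s"] measurable_sets[OF X(1)] st
      by (auto simp: space_F)
    ultimately show "(case b of True \<Rightarrow> sigma_sets (space P) {(\<lambda>w. g (?I w)) -` A \<inter> space P |A. A \<in> sets borel}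
        | False \<Rightarrow> sigma_sets (space P) {X -` A \<inter> space P |A. A \<in> sets borel})
      \<subseteq> (case b of True \<Rightarrow> sets ?V | False \<Rightarrow> sets (F s))"
      by (cases b) auto
  qed
  then have iv: "indep_var borel (\<lambda>w. g (?I w)) borel X"
    unfolding indep_var_eq using gi X by auto
  show "integrable P (\<lambda>w. g (?I w) * X w)"
    and "(LINT w|P. g (?I w) * X w) = (LINT w|P. g (?I w)) * (LINT w|P. X w)"
    using indep_var_integrable[OF iv gi X(2)] indep_var_lebesgue_integral[OF iv gi X(2)] by auto
qed

lemma increment_times:
  assumes st: "0 \<le> s" "s \<le> t" and X: "X \<in> borel_measurable (F s)" "integrable P X"
  shows "integrable P (\<lambda>w. incr i s t w * X w)"
    and "(LINT w|P. incr i s t w * X w) = 0"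
proof -
  show "integrable P (\<lambda>w. incr i s t w * X w)"
    and "(LINT w|P. incr i s t w * X w) = 0"
    using increment_independent[OF st X component_measurable[of i]] increment_integrable[OF st, of i]
      increment_mean[OF st, of i] by auto
qed

lemma increment_product_times:
  assumes st: "0 \<le> s" "s \<le> t" and X: "X \<in> borel_measurable (F s)" "integrable P X"
  shows "integrable P (\<lambda>w. incr i s t w * incr j s t w * X w)"
    and "(LINT w|P. incr i s t w * incr j s t w * X w)
      = K $ i $ j * (t - s) * (LINT w|P. X w)"
proof -
  note [measurable] = component_measurable
  have g: "(\<lambda>v::real^'v. v $ i * v $ j) \<in> borel_measurable borel" by measurable
  show "integrable P (\<lambda>w. incr i s t w * incr j s t w * X w)"
    and "(LINT w|P. incr i s t w * incr j s t w * X w)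
      = K $ i $ j * (t - s) * (LINT w|P. X w)"
    using increment_independent[OF st X g] increment_product[OF st, of i j] by auto
qed

lemma norm_sum_increments_le:
  assumes "\<And>i. norm (\<eta> i) \<le> c"
  shows "norm (\<Sum>i\<in>UNIV. incr i s t w *\<^sub>R (\<eta> i :: 'b::euclidean_space))
    \<le> real CARD('v) * c * norm (M t w - M s w)"
proof -
  have "norm (\<Sum>i\<in>UNIV. incr i s t w *\<^sub>R \<eta> i) \<le> (\<Sum>i\<in>(UNIV::'v set). norm (M t w - M s w) * c)"
  proof (rule sum_norm_le)
    fix i
    have "\<bar>(M t w - M s w) $ i\<bar> * norm (\<eta> i) \<le> norm (M t w - M s w) * c"
      by (intro mult_mono component_le_norm_cart assms) auto
    then show "norm (incr i s t w *\<^sub>R \<eta> i) \<le> norm (M t w - M s w) * c" by simp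
  qed
  then show ?thesis by (simp add: mult_ac)
qed

text \<open>Bounded coefficients reduce each new cell to the square integrable increment of
  \<open>M\<close>. Adaptedness is part of the same induction because the isometry multiplies the
  partial sum by the next, independent increment.\<close>

lemma step_sum_square_integrable:
  fixes \<eta> :: "'v \<Rightarrow> nat \<Rightarrow> 'a \<Rightarrow> 'b::euclidean_space"
  assumes g: "0 \<le> g 0" "\<And>l. l < m \<Longrightarrow> g l \<le> g (Suc l)"
    and \<eta>: "\<And>i l. l < m \<Longrightarrow> \<eta> i l \<in> borel_measurable (F (g l))"
      "\<And>i l. l < m \<Longrightarrow> \<exists>c. \<forall>w\<in>space P. norm (\<eta> i l w) \<le> c"
  shows "0 \<le> g m"
    and "(\<lambda>w. \<Sum>l<m. \<Sum>i\<in>UNIV. incr i (g l) (g (Suc l)) w *\<^sub>R \<eta> i l w) \<in> borel_measurable (F (g m))"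
    and "integrable P (\<lambda>w. (norm (\<Sum>l<m. \<Sum>i\<in>UNIV. incr i (g l) (g (Suc l)) w *\<^sub>R \<eta> i l w))\<^sup>2)"
proof -
  let ?D = "\<lambda>l w. \<Sum>i\<in>UNIV. incr i (g l) (g (Suc l)) w *\<^sub>R \<eta> i l w"
  have "0 \<le> g m \<and> (\<lambda>w. \<Sum>l<m. ?D l w) \<in> borel_measurable (F (g m)) \<and> integrable P (\<lambda>w. (norm (\<Sum>l<m. ?D l w))\<^sup>2)"
    using g(2) \<eta>
  proof (induction m)
    case 0 then show ?case using g(1) by simp
  next
    case (Suc m)
    let ?S = "\<lambda>w. \<Sum>l<m. ?D l w"
    have IH: "0 \<le> g m" "?S \<in> borel_measurable (F (g m))" "integrable P (\<lambda>w. (norm (?S w))\<^sup>2)"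
      using Suc by auto
    have le: "g m \<le> g (Suc m)" using Suc.prems(1)[of m] by simp
    have D: "?D m \<in> borel_measurable (F (g (Suc m)))"
      using IH(1) le Suc.prems(2)[of m]
      by (intro borel_measurable_sum borel_measurable_scaleR borel_measurable_diff)
        (auto intro: levy_component_measurable_F intro: measurable_F_mono[of "g m"])
    have S: "?S \<in> borel_measurable (F (g (Suc m)))" using measurable_F_mono[OF IH(1) le IH(2)] .
    have "\<exists>c. \<forall>i. \<forall>w\<in>space P. norm (\<eta> i m w) \<le> c"
    proof -
      have "\<forall>i. \<exists>c. \<forall>w\<in>space P. norm (\<eta> i m w) \<le> c" using Suc.prems(3) by blast
      then obtain c where c: "\<And>i w. w\<in>space P \<Longrightarrow> norm (\<eta> i m w) \<le> c i" by metis
      have "norm (\<eta> i m w) \<le> Max (range c)" if "w \<in> space P" for i w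
        using c[OF that, of i] by (rule order_trans) auto
      then show ?thesis by blast
    qed
    then obtain c where c: "\<And>i w. w\<in>space P \<Longrightarrow> norm (\<eta> i m w) \<le> c" by blast
    have iD: "integrable P (\<lambda>w. (norm (?D m w))\<^sup>2)"
    proof (rule Bochner_Integration.integrable_bound)
      show "integrable P (\<lambda>w. (real CARD('v) * c)\<^sup>2 * (norm (M (g (Suc m)) w - M (g m) w))\<^sup>2)"
        by (intro integrable_mult_right increment_norm_square_integrable IH le)
      show "(\<lambda>w. (norm (?D m w))\<^sup>2) \<in> borel_measurable P"
        using measurable_F_P[OF _ D] IH(1) le by (intro borel_measurable_power borel_measurable_norm) auto
      show "AE w in P. norm ((norm (?D m w))\<^sup>2) \<le> norm ((real CARD('v) * c)\<^sup>2 * (norm (M (g (Suc m)) w - M (g m) w))\<^sup>2)"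
      proof (rule AE_I2)
        fix w assume "w \<in> space P"
        have "(norm (?D m w))\<^sup>2 \<le> (real CARD('v) * c * norm (M (g (Suc m)) w - M (g m) w))\<^sup>2"
          by (intro power_mono norm_sum_increments_le c \<open>w \<in> space P\<close>) auto
        then show "norm ((norm (?D m w))\<^sup>2) \<le> norm ((real CARD('v) * c)\<^sup>2 * (norm (M (g (Suc m)) w - M (g m) w))\<^sup>2)"
          by (simp add: power_mult_distrib)
      qed
    qed
    have "integrable P (\<lambda>w. (norm (?S w + ?D m w))\<^sup>2)"
    proof (rule Bochner_Integration.integrable_bound)
      show "integrable P (\<lambda>w. 2 * (norm (?S w))\<^sup>2 + 2 * (norm (?D m w))\<^sup>2)"
        using IH iD by (intro Bochner_Integration.integrable_add integrable_mult_right)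
      show "(\<lambda>w. (norm (?S w + ?D m w))\<^sup>2) \<in> borel_measurable P"
        using measurable_F_P[OF _ D] measurable_F_P[OF _ S] IH(1) le
        by (intro borel_measurable_power borel_measurable_norm borel_measurable_add) auto
      show "AE w in P. norm ((norm (?S w + ?D m w))\<^sup>2) \<le> norm (2 * (norm (?S w))\<^sup>2 + 2 * (norm (?D m w))\<^sup>2)"
      proof (rule AE_I2)
        fix w
        have "(norm (?S w + ?D m w))\<^sup>2 \<le> (norm (?S w) + norm (?D m w))\<^sup>2"
          by (intro power_mono norm_triangle_ineq) simp
        also have "\<dots> \<le> 2 * (norm (?S w))\<^sup>2 + 2 * (norm (?D m w))\<^sup>2"
          using zero_le_power2[of "norm (?S w) - norm (?D m w)"] by (simp add: power2_eq_square algebra_simps)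
        finally show "norm ((norm (?S w + ?D m w))\<^sup>2) \<le> norm (2 * (norm (?S w))\<^sup>2 + 2 * (norm (?D m w))\<^sup>2)" by simp
      qed
    qed
    then show ?case using IH le S D by simp
  qed
  then show "0 \<le> g m" "(\<lambda>w. \<Sum>l<m. ?D l w) \<in> borel_measurable (F (g m))" "integrable P (\<lambda>w. (norm (\<Sum>l<m. ?D l w))\<^sup>2)"
    by auto
qed

lemma integrable_bilinear:
  fixes b :: "'b::euclidean_space \<Rightarrow> 'c::euclidean_space \<Rightarrow> real"
  assumes b: "bounded_bilinear b" and m: "X \<in> borel_measurable P" "Y \<in> borel_measurable P"
    and i: "integrable P (\<lambda>w. (norm (X w))\<^sup>2)" "integrable P (\<lambda>w. (norm (Y w))\<^sup>2)"
  shows "integrable P (\<lambda>w. b (X w) (Y w))"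
proof -
  obtain B where B: "0 < B" "\<And>x y. norm (b x y) \<le> norm x * norm y * B"
    using bounded_bilinear.pos_bounded[OF b] by blast
  show ?thesis
  proof (rule Bochner_Integration.integrable_bound)
    show "integrable P (\<lambda>w. B * ((norm (X w))\<^sup>2 + (norm (Y w))\<^sup>2))"
      using i by (intro integrable_mult_right Bochner_Integration.integrable_add)
    show "(\<lambda>w. b (X w) (Y w)) \<in> borel_measurable P"
      by (rule borel_measurable_bilinear[OF b m])
    show "AE w in P. norm (b (X w) (Y w)) \<le> norm (B * ((norm (X w))\<^sup>2 + (norm (Y w))\<^sup>2))"
    proof (rule AE_I2)
      fix w
      have "norm (X w) * norm (Y w) \<le> (norm (X w))\<^sup>2 + (norm (Y w))\<^sup>2"
        using sum_squares_bound[of "norm (X w)" "norm (Y w)"] mult_nonneg_nonneg[OF norm_ge_zero norm_ge_zero, of "X w" "Y w"]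
        by linarith
      then have "norm (X w) * norm (Y w) * B \<le> B * ((norm (X w))\<^sup>2 + (norm (Y w))\<^sup>2)"
        using B(1) by (simp add: mult.commute mult_left_mono)
      then show "norm (b (X w) (Y w)) \<le> norm (B * ((norm (X w))\<^sup>2 + (norm (Y w))\<^sup>2))"
        using B(2)[of "X w" "Y w"] by simp
    qed
  qed
qed

lemma integrable_bounded_norm_square:
  fixes X :: "'a \<Rightarrow> 'b::euclidean_space"
  assumes "X \<in> borel_measurable P" "\<exists>c. \<forall>w\<in>space P. norm (X w) \<le> c"
  shows "integrable P (\<lambda>w. (norm (X w))\<^sup>2)"
proof -
  obtain c where c: "\<And>w. w \<in> space P \<Longrightarrow> norm (X w) \<le> c" using assms(2) by blast
  show ?thesis
    by (rule integrable_const_bound[where B = "c\<^sup>2"])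
      (use assms(1) c in \<open>auto intro!: AE_I2 power_mono\<close>)
qed

text \<open>Increments of \<open>M\<close> after \<open>g l\<close> are independent of the past, so all cross terms vanish.\<close>

lemma step_sum_isometry:
  fixes \<eta> :: "'v \<Rightarrow> nat \<Rightarrow> 'a \<Rightarrow> 'b::euclidean_space"
  assumes b: "bounded_bilinear (b :: 'b \<Rightarrow> 'b \<Rightarrow> real)"
    and g: "0 \<le> g 0" "\<And>l. l < m \<Longrightarrow> g l \<le> g (Suc l)"
    and \<eta>: "\<And>i l. l < m \<Longrightarrow> \<eta> i l \<in> borel_measurable (F (g l))"
      "\<And>i l. l < m \<Longrightarrow> \<exists>c. \<forall>w\<in>space P. norm (\<eta> i l w) \<le> c"
  defines "S \<equiv> \<lambda>m w. \<Sum>l<m. \<Sum>i\<in>UNIV. incr i (g l) (g (Suc l)) w *\<^sub>R \<eta> i l w"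
  shows "(LINT w|P. b (S m w) (S m w))
    = (\<Sum>l<m. (g (Suc l) - g l) * (LINT w|P. (\<Sum>i\<in>UNIV. \<Sum>j\<in>UNIV. K $ i $ j * b (\<eta> i l w) (\<eta> j l w))))"
  using g(2) \<eta>
proof (induction m)
  case 0
  then show ?case by (simp add: S_def bounded_bilinear.zero_left[OF b])
next
  case (Suc m)
  interpret b: bounded_bilinear b by (rule b)
  have gm: "0 \<le> g m" and Sm: "S m \<in> borel_measurable (F (g m))" and iS: "integrable P (\<lambda>w. (norm (S m w))\<^sup>2)"
    unfolding S_def using step_sum_square_integrable[of g m \<eta>] g(1) Suc.prems by auto
  have le: "g m \<le> g (Suc m)" using Suc.prems(1)[of m] by simp
  have em: "\<eta> i m \<in> borel_measurable (F (g m))" for i using Suc.prems(2)[of m] by simp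
  have ie: "integrable P (\<lambda>w. (norm (\<eta> i m w))\<^sup>2)" for i
    by (rule integrable_bounded_norm_square[OF measurable_F_P[OF gm em] Suc.prems(3)]) simp
  have mb: "(\<lambda>w. b (X w) (Y w)) \<in> borel_measurable (F (g m))"
    if "X \<in> borel_measurable (F (g m))" "Y \<in> borel_measurable (F (g m))" for X Y
    by (rule borel_measurable_bilinear[OF b that])
  note PS = measurable_F_P[OF gm Sm] and Pe = measurable_F_P[OF gm em]
  let ?d = "\<lambda>i w. incr i (g m) (g (Suc m)) w"
  have iSS: "integrable P (\<lambda>w. b (S m w) (S m w))" by (rule integrable_bilinear[OF b PS PS iS iS])
  have iSe: "integrable P (\<lambda>w. b (S m w) (\<eta> i m w))" for i by (rule integrable_bilinear[OF b PS Pe iS ie])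
  have ieS: "integrable P (\<lambda>w. b (\<eta> i m w) (S m w))" for i by (rule integrable_bilinear[OF b Pe PS ie iS])
  have iee: "integrable P (\<lambda>w. b (\<eta> i m w) (\<eta> j m w))" for i j by (rule integrable_bilinear[OF b Pe Pe ie ie])
  note c1 = increment_times[OF gm le mb[OF Sm em] iSe]
  note c2 = increment_times[OF gm le mb[OF em Sm] ieS]
  note c3 = increment_product_times[OF gm le mb[OF em em] iee]
  \<comment> \<open>The mixed terms are kept in both orders, since \<open>b\<close> need not be
    symmetric.\<close>
  have exp: "b (S (Suc m) w) (S (Suc m) w) = b (S m w) (S m w)
      + (\<Sum>i\<in>UNIV. ?d i w * b (S m w) (\<eta> i m w)) + (\<Sum>i\<in>UNIV. ?d i w * b (\<eta> i m w) (S m w))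
      + (\<Sum>i\<in>UNIV. \<Sum>j\<in>UNIV. ?d i w * ?d j w * b (\<eta> i m w) (\<eta> j m w))" for w
  proof -
    have "S (Suc m) w = S m w + (\<Sum>i\<in>UNIV. ?d i w *\<^sub>R \<eta> i m w)" by (simp add: S_def)
    moreover have "b (\<Sum>i\<in>UNIV. ?d i w *\<^sub>R \<eta> i m w) (\<Sum>i\<in>UNIV. ?d i w *\<^sub>R \<eta> i m w)
        = (\<Sum>i\<in>UNIV. \<Sum>j\<in>UNIV. ?d i w * ?d j w * b (\<eta> i m w) (\<eta> j m w))"
      by (simp only: b.sum_left b.scaleR_left) (simp add: b.sum_right b.scaleR_right sum_distrib_left mult.assoc)
    moreover have "b (S m w) (\<Sum>i\<in>UNIV. ?d i w *\<^sub>R \<eta> i m w) = (\<Sum>i\<in>UNIV. ?d i w * b (S m w) (\<eta> i m w))"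
      by (simp add: b.sum_right b.scaleR_right)
    moreover have "b (\<Sum>i\<in>UNIV. ?d i w *\<^sub>R \<eta> i m w) (S m w) = (\<Sum>i\<in>UNIV. ?d i w * b (\<eta> i m w) (S m w))"
      by (simp add: b.sum_left b.scaleR_left)
    ultimately show ?thesis by (simp only: b.add_left b.add_right)
  qed
  have "(LINT w|P. b (S (Suc m) w) (S (Suc m) w)) = (LINT w|P. b (S m w) (S m w))
      + (\<Sum>i\<in>UNIV. LINT w|P. ?d i w * b (S m w) (\<eta> i m w)) + (\<Sum>i\<in>UNIV. LINT w|P. ?d i w * b (\<eta> i m w) (S m w))
      + (\<Sum>i\<in>UNIV. \<Sum>j\<in>UNIV. LINT w|P. ?d i w * ?d j w * b (\<eta> i m w) (\<eta> j m w))"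
    unfolding exp
    by (simp add: Bochner_Integration.integral_add Bochner_Integration.integral_sum
        Bochner_Integration.integrable_add Bochner_Integration.integrable_sum iSS c1(1) c2(1) c3(1))
  also have "\<dots> = (LINT w|P. b (S m w) (S m w))
      + (\<Sum>i\<in>UNIV. \<Sum>j\<in>UNIV. K $ i $ j * (g (Suc m) - g m) * (LINT w|P. b (\<eta> i m w) (\<eta> j m w)))"
    by (simp add: c1(2) c2(2) c3(2))
  also have "(\<Sum>i\<in>UNIV. \<Sum>j\<in>UNIV. K $ i $ j * (g (Suc m) - g m) * (LINT w|P. b (\<eta> i m w) (\<eta> j m w)))
      = (g (Suc m) - g m) * (LINT w|P. (\<Sum>i\<in>UNIV. \<Sum>j\<in>UNIV. K $ i $ j * b (\<eta> i m w) (\<eta> j m w)))"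
    by (simp add: Bochner_Integration.integral_sum Bochner_Integration.integrable_sum iee sum_distrib_left mult_ac)
  finally show ?case using Suc by simp
qed

end

section \<open>Refinement of simple processes to a common grid\<close>

lemma strict_grid_exists:
  fixes t :: real
  assumes "finite G" "G \<subseteq> {0..t}" "0 \<le> t"
  obtains m and g :: "nat \<Rightarrow> real" where "g 0 = 0" "g m = t" "\<And>l. l < m \<Longrightarrow> g l < g (Suc l)" "G \<subseteq> g ` {..m}"
proof -
  define xs where "xs = sorted_list_of_set (insert 0 (insert t G))"
  have set: "set xs = insert 0 (insert t G)" and st: "sorted_wrt (<) xs"
    using assms(1) unfolding xs_def by (simp_all del: sorted_list_of_set_insert_remove)
  have len: "length xs > 0" using set by (cases xs) auto
  have inc: "xs ! i < xs ! j" if "i < j" "j < length xs" for i j using sorted_wrt_nth_less[OF st that] .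
  have "xs ! 0 = 0"
  proof -
    obtain i where "i < length xs" "xs ! i = 0" using set by (metis in_set_conv_nth insertI1)
    moreover have "xs ! 0 \<in> {0..t}" using set assms len nth_mem[of 0 xs] by auto
    ultimately show ?thesis using inc[of 0 i] by (cases "i = 0") auto
  qed
  moreover have "xs ! (length xs - 1) = t"
  proof -
    obtain i where i: "i < length xs" "xs ! i = t" using set by (metis in_set_conv_nth insertI1 insertI2)
    moreover have "xs ! (length xs - 1) \<in> {0..t}" using set assms len nth_mem[of "length xs - 1" xs] by auto
    ultimately show ?thesis using inc[of i "length xs - 1"] len by (cases "i < length xs - 1"; cases "i = length xs - 1") auto
  qed
  moreover have "xs ! l < xs ! Suc l" if "l < length xs - 1" for l using inc[of l "Suc l"] that by auto
  moreover have "G \<subseteq> (!) xs ` {..length xs - 1}"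
  proof
    fix s assume "s \<in> G"
    then obtain i where "i < length xs" "xs ! i = s" using set by (metis in_set_conv_nth insertI2)
    then show "s \<in> (!) xs ` {..length xs - 1}" by (intro image_eqI[of _ _ i]) auto
  qed
  ultimately show ?thesis by (rule that)
qed

lemma grid_mono:
  fixes g :: "nat \<Rightarrow> real"
  assumes "\<And>l. l < m \<Longrightarrow> g l \<le> g (Suc l)" "a \<le> b" "b \<le> m"
  shows "g a \<le> g b"
  using assms(2,3)
proof (induction b rule: dec_induct)
  case (step n) then show ?case using assms(1)[of n] by simp
qed simp

lemma strict_grid_mono:
  fixes g :: "nat \<Rightarrow> real"
  assumes "\<And>l. l < m \<Longrightarrow> g l < g (Suc l)" "a \<le> b" "b \<le> m"
  shows "g a \<le> g b"
  using grid_mono[of m g a b] assms by (simp add: less_imp_le)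

lemma strict_grid_dichotomy:
  fixes g :: "nat \<Rightarrow> real"
  assumes g: "\<And>l. l < m \<Longrightarrow> g l < g (Suc l)" "l < m" "p \<in> g ` {..m}"
  shows "p \<le> g l \<or> g (Suc l) \<le> p"
proof -
  obtain a where a: "a \<le> m" "p = g a" using g(3) by auto
  then show ?thesis using strict_grid_mono[of m g a l] strict_grid_mono[of m g "Suc l" a] g(1,2)
    by (cases "a \<le> l") auto
qed

text \<open>Breakpoints beyond \<open>t\<close> are moved to \<open>t\<close>; since a cell ends no
  later than \<open>t\<close>, this does not change how they compare with \<open>s\<close>. The
  first equivalence makes a simple process constant on the cell, the second makes its value there
  known at the left end.\<close>

lemma simple_process_refine_indicator:
  fixes g :: "nat \<Rightarrow> real"
  assumes g: "g m = t" "\<And>l. l < m \<Longrightarrow> g l < g (Suc l)" "l < m"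
    and p: "min t p \<in> g ` {..m}" and s: "g l < s" "s \<le> g (Suc l)"
  shows "p < s \<longleftrightarrow> p < g (Suc l)" "p < s \<longleftrightarrow> p \<le> g l"
  using strict_grid_dichotomy[where g = g and m = m and l = l and p = "min t p"] strict_grid_mono[of m g "Suc l" m] g p s by auto

context square_integrable_levy
begin

lemma simple_integrand_times:
  assumes "simple_integrand P F k \<tau> \<xi>" "j \<le> k"
  shows "0 \<le> \<tau> j"
  using assms(2)
proof (induction j)
  case 0 then show ?case using assms(1) by (simp add: simple_integrand_def)
next
  case (Suc j)
  then have "\<tau> j \<le> \<tau> (Suc j)" using assms(1) by (simp add: simple_integrand_def)
  then show ?case using Suc by simp
qed

text \<open>The right end of a cell represents the whole cell, because the intervals of a simple
  process are open on the left and closed on the right. On a grid containing all breakpoints the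
  integral becomes a step sum with adapted coefficients, so integrands with different partitions can
  be subtracted.\<close>

lemma simple_process_refine:
  fixes \<xi> :: "nat \<Rightarrow> 'a \<Rightarrow> 'b::euclidean_space"
  assumes si: "simple_integrand P F k \<tau> \<xi>"
    and g: "g 0 = 0" "g m = t" "\<And>l. l < m \<Longrightarrow> g l < g (Suc l)"
    and G: "\<And>j. j \<le> k \<Longrightarrow> min t (\<tau> j) \<in> g ` {..m}"
  shows "simple_integral L k \<tau> \<xi> t w
      = (\<Sum>l<m. (L (g (Suc l)) w - L (g l) w) *\<^sub>R simple_process k \<tau> \<xi> (g (Suc l)) w)"
    and "\<And>l s. l < m \<Longrightarrow> g l < s \<Longrightarrow> s \<le> g (Suc l) \<Longrightarrow>
      simple_process k \<tau> \<xi> s w = simple_process k \<tau> \<xi> (g (Suc l)) w"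
    and "\<And>l. l < m \<Longrightarrow> simple_process k \<tau> \<xi> (g (Suc l)) \<in> borel_measurable (F (g l))"
    and "\<And>s. \<exists>c. \<forall>w\<in>space P. norm (simple_process k \<tau> \<xi> s w) \<le> c"
proof -
  note ind = simple_process_refine_indicator[where g = g and m = m, OF g(2,3) _ G]
  have g_pos: "0 \<le> g l" and g_le: "g l \<le> t" if "l \<le> m" for l
    using strict_grid_mono[of m g 0 l] strict_grid_mono[of m g l m] that g by auto
  have \<tau>: "0 \<le> \<tau> j" if "j \<le> k" for j using simple_integrand_times[OF si that] .
  have \<tau>2: "\<tau> j \<le> \<tau> (Suc j)" if "j < k" for j using si that by (simp add: simple_integrand_def)
  show "simple_process k \<tau> \<xi> s w = simple_process k \<tau> \<xi> (g (Suc l)) w"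
    if "l < m" "g l < s" "s \<le> g (Suc l)" for l s
    unfolding simple_process_def
  proof (intro sum.cong refl)
    fix j assume j: "j \<in> {..<k}"
    have "\<tau> j < s \<longleftrightarrow> \<tau> j < g (Suc l)" "\<tau> (Suc j) < s \<longleftrightarrow> \<tau> (Suc j) < g (Suc l)"
      using ind(1)[of l j s] ind(1)[of l "Suc j" s] that j by auto
    then show "indicator {\<tau> j<..\<tau> (Suc j)} s *\<^sub>R \<xi> j w = indicator {\<tau> j<..\<tau> (Suc j)} (g (Suc l)) *\<^sub>R \<xi> j w"
      by (auto simp: indicator_def)
  qed
  show "simple_process k \<tau> \<xi> (g (Suc l)) \<in> borel_measurable (F (g l))" if l: "l < m" for l
    unfolding simple_process_def
  proof (intro borel_measurable_sum)
    fix j assume j: "j \<in> {..<k}"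
    show "(\<lambda>w. indicator {\<tau> j<..\<tau> (Suc j)} (g (Suc l)) *\<^sub>R \<xi> j w) \<in> borel_measurable (F (g l))"
    proof (cases "\<tau> j < g (Suc l)")
      case True
      \<comment> \<open>A coefficient active on the cell starts at a breakpoint strictly before
        \<open>g (Suc l)\<close>, hence no later than \<open>g l\<close>.\<close>
      then have "\<tau> j \<le> g l" using ind(2)[of l j "g (Suc l)"] l j g(3)[of l] by auto
      moreover have "\<xi> j \<in> borel_measurable (F (\<tau> j))" using si j by (simp add: simple_integrand_def)
      ultimately have "\<xi> j \<in> borel_measurable (F (g l))" using j measurable_F_mono[OF \<tau>[of j], of "g l" "\<xi> j" borel] by simp
      then show ?thesis by (intro borel_measurable_scaleR borel_measurable_const)
    qed (simp add: indicator_def)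
  qed
  show "\<exists>c. \<forall>w\<in>space P. norm (simple_process k \<tau> \<xi> s w) \<le> c" for s
  proof -
    have "\<forall>j<k. \<exists>c. \<forall>w\<in>space P. norm (\<xi> j w) \<le> c" using si by (simp add: simple_integrand_def)
    then obtain c where c: "\<And>j w. j < k \<Longrightarrow> w \<in> space P \<Longrightarrow> norm (\<xi> j w) \<le> c j" by metis
    have "norm (simple_process k \<tau> \<xi> s w) \<le> (\<Sum>j<k. c j)" if "w \<in> space P" for w
      unfolding simple_process_def
    proof (rule sum_norm_le)
      fix j assume "j \<in> {..<k}"
      then show "norm (indicator {\<tau> j<..\<tau> (Suc j)} s *\<^sub>R \<xi> j w) \<le> c j"
        using c[of j w] that order_trans[OF norm_ge_zero c[of j w]] by (auto simp: indicator_def)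
    qed
    then show ?thesis by blast
  qed
  have "L (min t (\<tau> (Suc j))) w - L (min t (\<tau> j)) w
      = (\<Sum>l<m. indicator {\<tau> j<..\<tau> (Suc j)} (g (Suc l)) * (L (g (Suc l)) w - L (g l) w))" if j: "j < k" for j
  proof -
    let ?p = "min t (\<tau> j)" and ?q = "min t (\<tau> (Suc j))"
    \<comment> \<open>\<open>c\<close> clamps time to the interval from \<open>?p\<close> to
      \<open>?q\<close>: the telescoping sum of \<open>L\<close> along \<open>c\<close> moves only
      on cells inside that interval, and these are the cells that the indicator selects.\<close>
    define c where "c r = max ?p (min ?q r)" for r
    have t0: "0 \<le> t" using g_pos[of m] g(2) by simp
    have "c (g m) = ?q" "c (g 0) = ?p"
      using \<tau>[of j] \<tau>2[of j] j g(1,2) t0 by (auto simp: c_def min_def max_def)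
    then have "L ?q w - L ?p w = L (c (g m)) w - L (c (g 0)) w" by simp
    also have "\<dots> = (\<Sum>l<m. L (c (g (Suc l))) w - L (c (g l)) w)" by (rule sum_lessThan_telescope[symmetric])
    also have "\<dots> = (\<Sum>l<m. indicator {\<tau> j<..\<tau> (Suc j)} (g (Suc l)) * (L (g (Suc l)) w - L (g l) w))"
    proof (intro sum.cong refl)
      fix l assume l: "l \<in> {..<m}"
      have gl: "g l < g (Suc l)" "g (Suc l) \<le> t" using g(3)[of l] g_le[of "Suc l"] l by auto
      have pq: "?p \<le> ?q" using \<tau>2[OF j] by auto
      consider "g (Suc l) \<le> ?p" | "?p \<le> g l" "g (Suc l) \<le> ?q" | "?p \<le> g l" "?q \<le> g l"
        using strict_grid_dichotomy[where g = g and m = m and l = l and p = ?p]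
          strict_grid_dichotomy[where g = g and m = m and l = l and p = ?q] g(3) G[of j] G[of "Suc j"] l j by auto
      then show "L (c (g (Suc l))) w - L (c (g l)) w = indicator {\<tau> j<..\<tau> (Suc j)} (g (Suc l)) * (L (g (Suc l)) w - L (g l) w)"
      proof cases
        case 1
        then have "c (g l) = ?p" "c (g (Suc l)) = ?p" "\<not> \<tau> j < g (Suc l)" using gl by (auto simp: c_def)
        then show ?thesis by (simp add: indicator_def)
      next
        case 2
        then have "c (g l) = g l" "c (g (Suc l)) = g (Suc l)" "\<tau> j < g (Suc l)" "g (Suc l) \<le> \<tau> (Suc j)"
          using gl by (auto simp: c_def min_def max_def split: if_splits)
        then show ?thesis by (simp add: indicator_def)
      next
        case 3
        then have "c (g l) = ?q" "c (g (Suc l)) = ?q" "\<not> g (Suc l) \<le> \<tau> (Suc j)"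
          using gl pq by (auto simp: c_def min_def max_def split: if_splits)
        then show ?thesis by (simp add: indicator_def)
      qed
    qed
    finally show ?thesis .
  qed
  then have "simple_integral L k \<tau> \<xi> t w
      = (\<Sum>j<k. (\<Sum>l<m. indicator {\<tau> j<..\<tau> (Suc j)} (g (Suc l)) * (L (g (Suc l)) w - L (g l) w)) *\<^sub>R \<xi> j w)"
    unfolding simple_integral_def by (intro sum.cong) auto
  also have "\<dots> = (\<Sum>l<m. (L (g (Suc l)) w - L (g l) w) *\<^sub>R simple_process k \<tau> \<xi> (g (Suc l)) w)"
    unfolding simple_process_def scaleR_sum_left scaleR_sum_right
    by (subst sum.swap) (simp add: mult.commute)
  finally show "simple_integral L k \<tau> \<xi> t w
      = (\<Sum>l<m. (L (g (Suc l)) w - L (g l) w) *\<^sub>R simple_process k \<tau> \<xi> (g (Suc l)) w)" .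
qed

lemma K_diagonal_nonneg: "0 \<le> K $ i $ i"
proof -
  have "0 \<le> (LINT w|P. M 1 w $ i * M 1 w $ i)" by (intro Bochner_Integration.integral_nonneg) auto
  then show ?thesis using covariance[of 1 i i] by simp
qed

text \<open>A Lenglart inequality. Setting the coefficients to zero from the first cell on at which the discrete
  bracket exceeds \<open>\<delta>\<close> keeps them predictable and changes nothing on the event in question.\<close>

lemma step_sum_lenglart:
  fixes \<xi> :: "nat \<Rightarrow> 'a \<Rightarrow> 'b::euclidean_space"
  assumes g: "0 \<le> g 0" "\<And>l. l < m \<Longrightarrow> g l \<le> g (Suc l)"
    and \<xi>: "\<And>l. l < m \<Longrightarrow> \<xi> l \<in> borel_measurable (F (g l))"
      "\<And>l. l < m \<Longrightarrow> \<exists>c. \<forall>w\<in>space P. norm (\<xi> l w) \<le> c"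
    and e: "0 < \<epsilon>" and d: "0 \<le> \<delta>"
  shows "prob {w\<in>space P. norm (\<Sum>l<m. incr i (g l) (g (Suc l)) w *\<^sub>R \<xi> l w) > \<epsilon> \<and>
      (\<Sum>l<m. (g (Suc l) - g l) * (norm (\<xi> l w))\<^sup>2) \<le> \<delta>} \<le> K $ i $ i * \<delta> / \<epsilon>\<^sup>2"
proof -
  define V where "V l w = (\<Sum>r<l. (g (Suc r) - g r) * (norm (\<xi> r w))\<^sup>2)" for l w
  \<comment> \<open>The test uses \<open>V (Suc l)\<close>, which already contains cell
    \<open>l\<close>: its coefficient is known at \<open>g l\<close>, so the truncation stays
    adapted, and the truncated bracket never overshoots \<open>\<delta>\<close>.\<close>
  define \<xi>' where "\<xi>' l w = (if V (Suc l) w \<le> \<delta> then \<xi> l w else 0)" for l w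
  \<comment> \<open>The isometry concerns all components of \<open>M\<close> at once; a single
    component is the case in which the other coefficients vanish.\<close>
  define \<eta> where "\<eta> j l w = (if j = i then \<xi>' l w else 0)" for j l w
  define S where "S w = (\<Sum>l<m. incr i (g l) (g (Suc l)) w *\<^sub>R \<xi>' l w)" for w
  have gmono: "g r \<le> g l" if "r \<le> l" "l \<le> m" for r l using grid_mono[of m g r l] g that by auto
  have gpos: "0 \<le> g l" if "l \<le> m" for l using gmono[of 0 l] g(1) that by simp
  have Vm: "V (Suc l) \<in> borel_measurable (F (g l))" if "l < m" for l
  proof -
    have "\<xi> r \<in> borel_measurable (F (g l))" if "r \<in> {..<Suc l}" for r
      using that \<open>l < m\<close> measurable_F_mono[OF gpos gmono \<xi>(1), of r l] by simp
    then show ?thesis unfolding V_def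
      by (intro borel_measurable_sum borel_measurable_times borel_measurable_power borel_measurable_norm borel_measurable_const) auto
  qed
  have \<xi>'m: "\<xi>' l \<in> borel_measurable (F (g l))" if "l < m" for l
    unfolding \<xi>'_def using Vm[OF that] \<xi>(1)[OF that] by measurable
  have \<xi>'b: "\<exists>c. \<forall>w\<in>space P. norm (\<xi>' l w) \<le> c" if "l < m" for l
  proof -
    obtain c where c: "\<forall>w\<in>space P. norm (\<xi> l w) \<le> c" using \<xi>(2) \<open>l < m\<close> by blast
    then have "\<forall>w\<in>space P. norm (\<xi>' l w) \<le> max c 0" by (auto simp: \<xi>'_def)
    then show ?thesis by blast
  qed
  have \<eta>m: "\<eta> j l \<in> borel_measurable (F (g l))" if "l < m" for j l
    using \<xi>'m[OF that] by (cases "j = i") (auto simp: \<eta>_def[abs_def])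
  have \<eta>b: "\<exists>c. \<forall>w\<in>space P. norm (\<eta> j l w) \<le> c" if "l < m" for j l
    using \<xi>'b[OF that] by (cases "j = i") (auto simp: \<eta>_def)
  have S_eq: "(\<Sum>l<m. \<Sum>j\<in>UNIV. incr j (g l) (g (Suc l)) w *\<^sub>R \<eta> j l w) = S w" for w
    unfolding S_def \<eta>_def by (intro sum.cong refl) (simp add: if_distrib cong: if_cong)
  have iS: "integrable P (\<lambda>w. (norm (S w))\<^sup>2)" and Sm: "S \<in> borel_measurable P"
    using step_sum_square_integrable[of g m \<eta>, OF g \<eta>m \<eta>b] measurable_F_P unfolding S_eq[abs_def] by auto
  have bound: "(\<Sum>l<m'. (g (Suc l) - g l) * (norm (\<xi>' l w))\<^sup>2) \<le> \<delta>" if "m' \<le> m" for m' w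
    using that
  proof (induction m')
    case (Suc m')
    show ?case
    proof (cases "V (Suc m') w \<le> \<delta>")
      case True
      have "(\<Sum>l<Suc m'. (g (Suc l) - g l) * (norm (\<xi>' l w))\<^sup>2) \<le> V (Suc m') w"
        unfolding V_def \<xi>'_def using Suc.prems g(2)
        by (intro sum_mono mult_left_mono) auto
      then show ?thesis using True by simp
    next
      case False
      \<comment> \<open>The new coefficient has been cut off, so the sum does not grow.\<close>
      then show ?thesis using Suc by (simp add: \<xi>'_def)
    qed
  qed (use d in simp)
  have i\<xi>: "integrable P (\<lambda>w. (norm (\<xi>' l w))\<^sup>2)" if "l < m" for l
    by (rule integrable_bounded_norm_square[OF measurable_F_P[OF gpos \<xi>'m] \<xi>'b]) (use that in auto)
  have "(LINT w|P. (norm (S w))\<^sup>2) = (LINT w|P. S w \<bullet> S w)" by (simp add: power2_norm_eq_inner)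
  also have "\<dots> = (\<Sum>l<m. (g (Suc l) - g l) * (LINT w|P. (\<Sum>j\<in>UNIV. \<Sum>j'\<in>UNIV. K $ j $ j' * (\<eta> j l w \<bullet> \<eta> j' l w))))"
    using step_sum_isometry[of "(\<bullet>)" g m \<eta>, OF bounded_bilinear_inner g \<eta>m \<eta>b] unfolding S_eq[abs_def] .
  also have "\<dots> = (\<Sum>l<m. (g (Suc l) - g l) * (LINT w|P. K $ i $ i * (norm (\<xi>' l w))\<^sup>2))"
  proof (intro sum.cong refl)
    fix l
    have "(\<Sum>j\<in>UNIV. \<Sum>j'\<in>UNIV. K $ j $ j' * (\<eta> j l w \<bullet> \<eta> j' l w)) = K $ i $ i * (norm (\<xi>' l w))\<^sup>2" for w
    proof -
      have "(\<Sum>j\<in>UNIV. \<Sum>j'\<in>UNIV. K $ j $ j' * (\<eta> j l w \<bullet> \<eta> j' l w))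
          = (\<Sum>j\<in>UNIV. \<Sum>j'\<in>UNIV. if j = i then (if j' = i then K $ i $ i * (\<xi>' l w \<bullet> \<xi>' l w) else 0) else 0)"
        by (intro sum.cong refl) (auto simp: \<eta>_def)
      also have "\<dots> = (\<Sum>j\<in>UNIV. if j = i then (\<Sum>j'\<in>UNIV. if j' = i then K $ i $ i * (\<xi>' l w \<bullet> \<xi>' l w) else 0) else 0)"
        by (intro sum.cong refl) auto
      finally show ?thesis by (simp add: power2_norm_eq_inner)
    qed
    then show "(g (Suc l) - g l) * (LINT w|P. (\<Sum>j\<in>UNIV. \<Sum>j'\<in>UNIV. K $ j $ j' * (\<eta> j l w \<bullet> \<eta> j' l w)))
        = (g (Suc l) - g l) * (LINT w|P. K $ i $ i * (norm (\<xi>' l w))\<^sup>2)" by simp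
  qed
  also have "\<dots> = K $ i $ i * (LINT w|P. (\<Sum>l<m. (g (Suc l) - g l) * (norm (\<xi>' l w))\<^sup>2))"
    by (simp add: Bochner_Integration.integral_sum i\<xi> sum_distrib_left mult_ac)
  also have "\<dots> \<le> K $ i $ i * (LINT w|P. \<delta>)"
    by (intro mult_left_mono K_diagonal_nonneg integral_mono bound Bochner_Integration.integrable_sum integrable_mult_right i\<xi>) auto
  finally have E: "(LINT w|P. (norm (S w))\<^sup>2) \<le> K $ i $ i * \<delta>" by (simp add: prob_space)
  have "prob {w\<in>space P. norm (\<Sum>l<m. incr i (g l) (g (Suc l)) w *\<^sub>R \<xi> l w) > \<epsilon> \<and>
      (\<Sum>l<m. (g (Suc l) - g l) * (norm (\<xi> l w))\<^sup>2) \<le> \<delta>} \<le> prob {w\<in>space P. (norm (S w))\<^sup>2 \<ge> \<epsilon>\<^sup>2}"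
  proof (rule finite_measure_mono)
    show "{w\<in>space P. (norm (S w))\<^sup>2 \<ge> \<epsilon>\<^sup>2} \<in> events" using Sm by measurable
    show "{w\<in>space P. norm (\<Sum>l<m. incr i (g l) (g (Suc l)) w *\<^sub>R \<xi> l w) > \<epsilon> \<and>
      (\<Sum>l<m. (g (Suc l) - g l) * (norm (\<xi> l w))\<^sup>2) \<le> \<delta>} \<subseteq> {w\<in>space P. (norm (S w))\<^sup>2 \<ge> \<epsilon>\<^sup>2}"
    proof clarify
      fix w assume *: "w \<in> space P" "norm (\<Sum>l<m. incr i (g l) (g (Suc l)) w *\<^sub>R \<xi> l w) > \<epsilon>"
        "(\<Sum>l<m. (g (Suc l) - g l) * (norm (\<xi> l w))\<^sup>2) \<le> \<delta>"
      \<comment> \<open>Partial brackets stay below the final one, so on this event no coefficient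
        is cut off, and Chebyshev's inequality for \<open>S\<close> covers the original sum.\<close>
      have "V (Suc l) w \<le> \<delta>" if "l < m" for l
      proof -
        have "V (Suc l) w \<le> V m w" unfolding V_def
          by (rule sum_mono2) (use that g(2) in auto)
        then show ?thesis using *(3) by (simp add: V_def)
      qed
      then have "S w = (\<Sum>l<m. incr i (g l) (g (Suc l)) w *\<^sub>R \<xi> l w)"
        unfolding S_def by (intro sum.cong refl) (simp add: \<xi>'_def)
      then show "\<epsilon>\<^sup>2 \<le> (norm (S w))\<^sup>2" using *(2) e by (simp add: power_mono)
    qed
  qed
  moreover have "prob {w\<in>space P. (norm (S w))\<^sup>2 \<ge> \<epsilon>\<^sup>2} \<le> (LINT w|P. (norm (S w))\<^sup>2) / \<epsilon>\<^sup>2"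
    by (rule integral_Markov_inequality_measure[OF iS sets.top]) (use e in simp_all)
  moreover have "(LINT w|P. (norm (S w))\<^sup>2) / \<epsilon>\<^sup>2 \<le> K $ i $ i * \<delta> / \<epsilon>\<^sup>2"
    using E by (intro divide_right_mono) simp_all
  ultimately show ?thesis by linarith
qed

end

section \<open>Locality of the stochastic integral\<close>

lemma set_nn_integral_ennreal:
  fixes f :: "'a \<Rightarrow> real"
  assumes "set_integrable N A f" "\<And>x. x \<in> A \<Longrightarrow> 0 \<le> f x"
  shows "(\<integral>\<^sup>+x\<in>A. ennreal (f x) \<partial>N) = ennreal (LINT x:A|N. f x)"
proof -
  have "(\<integral>\<^sup>+x\<in>A. ennreal (f x) \<partial>N) = (\<integral>\<^sup>+x. ennreal (indicator A x *\<^sub>R f x) \<partial>N)"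
    by (intro nn_integral_cong) (auto simp: indicator_def)
  also have "\<dots> = ennreal (LINT x:A|N. f x)"
    unfolding set_lebesgue_integral_def
    using assms by (intro nn_integral_eq_integral) (auto simp: set_integrable_def indicator_def)
  finally show ?thesis .
qed

context square_integrable_levy
begin

lemma simple_integrand_measurable:
  assumes "simple_integrand P F k \<tau> \<xi>" "j < k"
  shows "\<xi> j \<in> borel_measurable P"
  using measurable_F_P[OF simple_integrand_times[OF assms(1), of j]] assms by (auto simp: simple_integrand_def)

lemma simple_process_joint_measurable:
  fixes \<xi> :: "nat \<Rightarrow> 'a \<Rightarrow> 'b::euclidean_space"
  assumes "\<And>j. j < k \<Longrightarrow> \<xi> j \<in> borel_measurable P"
  shows "(\<lambda>(w, s). simple_process k \<tau> \<xi> s w) \<in> borel_measurable PT"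
proof -
  have "(\<lambda>z. indicator {\<tau> j<..\<tau> (Suc j)} (snd z) *\<^sub>R \<xi> j (fst z)) \<in> borel_measurable PT" if "j < k" for j
    by (rule borel_measurable_scaleR[OF _ measurable_compose[OF measurable_fst assms[OF that]]]) measurable
  then show ?thesis unfolding simple_process_def case_prod_unfold by (intro borel_measurable_sum) auto
qed

lemma simple_integral_measurable:
  fixes \<xi> :: "nat \<Rightarrow> 'a \<Rightarrow> 'b::euclidean_space"
  assumes "simple_integrand P F k \<tau> \<xi>" "0 \<le> t"
  shows "integral_M i k \<tau> \<xi> t \<in> borel_measurable P"
  unfolding simple_integral_def
proof (rule borel_measurable_sum)
  fix j assume "j \<in> {..<k}"
  then have "j < k" "0 \<le> min t (\<tau> j)" "0 \<le> min t (\<tau> (Suc j))"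
    using simple_integrand_times[OF assms(1), of j] simple_integrand_times[OF assms(1), of "Suc j"] assms(2) by auto
  then show "(\<lambda>w. (M (min t (\<tau> (Suc j))) w $ i - M (min t (\<tau> j)) w $ i) *\<^sub>R \<xi> j w) \<in> borel_measurable P"
    using levy_component_measurable simple_integrand_measurable[OF assms(1)]
    by (intro borel_measurable_scaleR borel_measurable_diff) blast+
qed

text \<open>The predictable sigma-algebra has time as first coordinate and omits time 0, whereas
  \<open>PT\<close> has time as second coordinate. Swapping turns the generators into rectangles,
  and the indicator extends the function by 0 to nonpositive times.\<close>

lemma predictable_joint_measurable:
  fixes \<Phi> :: "real \<Rightarrow> 'a \<Rightarrow> 'b::euclidean_space"
  assumes "predictable P F \<Phi>"
  shows "(\<lambda>(w, s). indicator {0<..} s *\<^sub>R \<Phi> s w) \<in> borel_measurable PT"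
proof -
  let ?\<Omega> = "space P \<times> {0::real<..}"
  let ?R = "restrict_space PT ?\<Omega>"
  have \<Omega>: "?\<Omega> \<in> sets PT" by (intro pair_measureI) auto
  have spR: "space ?R = ?\<Omega>" by (auto simp: space_restrict_space space_pair_measure)
  have "(\<lambda>(w, s). (s, w)) \<in> measurable ?R (predictable_sigma P F)"
    unfolding predictable_sigma_def
  proof (rule measurable_measure_of)
    show "{{s<..t} \<times> B |s t B. 0 \<le> s \<and> s \<le> t \<and> B \<in> sets (F s)} \<subseteq> Pow ({0<..} \<times> space P)"
      using sets.sets_into_space space_F by fastforce
    show "(\<lambda>(w, s). (s, w)) \<in> space ?R \<rightarrow> {0<..} \<times> space P" unfolding spR by auto
    fix y assume "y \<in> {{s<..t} \<times> B |s t B. 0 \<le> s \<and> s \<le> t \<and> B \<in> sets (F s)}"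
    then obtain s t B where y: "y = {s<..t} \<times> B" "0 \<le> s" "B \<in> sets (F s)" by auto
    have B: "B \<in> sets P" using y sets_F by auto
    have "(\<lambda>(w, s). (s, w)) -` y \<inter> space ?R = B \<times> {s<..t}"
      unfolding spR using y sets.sets_into_space[OF B] by auto
    moreover have "B \<times> {s<..t} \<in> sets ?R"
      using \<Omega> B y sets.sets_into_space[OF B] by (subst sets_restrict_space_iff) auto
    ultimately show "(\<lambda>(w, s). (s, w)) -` y \<inter> space ?R \<in> sets ?R" by simp
  qed
  then have "(\<lambda>z. (\<lambda>(t, w). \<Phi> t w) ((\<lambda>(w, s). (s, w)) z)) \<in> borel_measurable ?R"
    using assms unfolding predictable_def by (rule measurable_compose)
  then have "(\<lambda>z. indicator ?\<Omega> z *\<^sub>R \<Phi> (snd z) (fst z)) \<in> borel_measurable PT"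
    using \<Omega> by (subst (asm) borel_measurable_restrict_space_iff) (auto simp: case_prod_unfold)
  then show ?thesis
    by (subst measurable_cong[where g = "\<lambda>z. indicator ?\<Omega> z *\<^sub>R \<Phi> (snd z) (fst z)"])
      (auto simp: space_pair_measure indicator_def)
qed

text \<open>The integral runs over positive times only, so joint measurability of the cut-off
  function suffices.\<close>

lemma integral_square_measurable:
  fixes f :: "'a \<Rightarrow> real \<Rightarrow> 'b::euclidean_space"
  assumes "(\<lambda>(w, s). indicator {0<..} s *\<^sub>R f w s) \<in> borel_measurable PT"
  shows "(\<lambda>w. \<integral>\<^sup>+s\<in>{0<..t}. ennreal ((norm (f w s))\<^sup>2) \<partial>lborel) \<in> borel_measurable P"
proof -
  have "(\<lambda>(w, s). ennreal ((norm (indicator {0<..} s *\<^sub>R f w s))\<^sup>2) * indicator {0<..t} s) \<in> borel_measurable PT"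
    using assms by measurable
  then have "(\<lambda>w. \<integral>\<^sup>+s. ennreal ((norm (indicator {0<..} s *\<^sub>R f w s))\<^sup>2) * indicator {0<..t} s \<partial>lborel) \<in> borel_measurable P"
    by (rule lborel.borel_measurable_nn_integral)
  moreover have "ennreal ((norm (indicator {0<..} s *\<^sub>R f w s))\<^sup>2) * indicator {0<..t} s = ennreal ((norm (f w s))\<^sup>2) * indicator {0<..t} s"
    for s w by (auto simp: indicator_def)
  ultimately show ?thesis by simp
qed

text \<open>On a common refinement the difference of the integrals is one step sum, and the
  integrated square of the difference of the integrands is its discrete bracket.\<close>

lemma simple_integral_lenglart:
  fixes \<xi> \<xi>' :: "nat \<Rightarrow> 'a \<Rightarrow> 'b::euclidean_space"
  assumes si: "simple_integrand P F k \<tau> \<xi>" "simple_integrand P F k' \<tau>' \<xi>'"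
    and t: "0 \<le> t" and e: "0 < \<epsilon>" and d: "0 \<le> \<delta>"
  shows "prob {w\<in>space P. norm (integral_M i k \<tau> \<xi> t w
          - integral_M i k' \<tau>' \<xi>' t w) > \<epsilon> \<and>
      (\<integral>\<^sup>+s\<in>{0<..t}. ennreal ((norm (simple_process k \<tau> \<xi> s w - simple_process k' \<tau>' \<xi>' s w))\<^sup>2) \<partial>lborel) \<le> ennreal \<delta>}
    \<le> K $ i $ i * \<delta> / \<epsilon>\<^sup>2"
proof -
  let ?G = "(\<lambda>j. min t (\<tau> j)) ` {..k} \<union> (\<lambda>j. min t (\<tau>' j)) ` {..k'}"
  have fin: "finite ?G" by simp
  have sub: "?G \<subseteq> {0..t}"
    using simple_integrand_times[OF si(1)] simple_integrand_times[OF si(2)] t by auto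
  obtain m and g :: "nat \<Rightarrow> real" where g: "g 0 = 0" "g m = t" "\<And>l. l < m \<Longrightarrow> g l < g (Suc l)" and G: "?G \<subseteq> g ` {..m}"
    using strict_grid_exists[OF fin sub t] by metis
  have G1: "min t (\<tau> j) \<in> g ` {..m}" if "j \<le> k" for j using G that by auto
  have G2: "min t (\<tau>' j) \<in> g ` {..m}" if "j \<le> k'" for j using G that by auto
  note r1 = simple_process_refine[where g = g and m = m, OF si(1) g G1]
  note r2 = simple_process_refine[where g = g and m = m, OF si(2) g G2]
  define \<zeta> where "\<zeta> l w = simple_process k \<tau> \<xi> (g (Suc l)) w - simple_process k' \<tau>' \<xi>' (g (Suc l)) w" for l w
  have "\<zeta> l \<in> borel_measurable (F (g l))" if "l < m" for l
    unfolding \<zeta>_def by (intro borel_measurable_diff r1(3) r2(3) that)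
  moreover have "\<exists>c. \<forall>w\<in>space P. norm (\<zeta> l w) \<le> c" for l
  proof -
    obtain c c' where c: "\<forall>w\<in>space P. norm (simple_process k \<tau> \<xi> (g (Suc l)) w) \<le> c"
      "\<forall>w\<in>space P. norm (simple_process k' \<tau>' \<xi>' (g (Suc l)) w) \<le> c'"
      using r1(4)[of "g (Suc l)"] r2(4)[of "g (Suc l)"] by blast
    then have "\<forall>w\<in>space P. norm (\<zeta> l w) \<le> c + c'" unfolding \<zeta>_def
      by (intro ballI order_trans[OF norm_triangle_ineq4] add_mono) auto
    then show ?thesis by blast
  qed
  ultimately have "prob {w\<in>space P. norm (\<Sum>l<m. incr i (g l) (g (Suc l)) w *\<^sub>R \<zeta> l w) > \<epsilon> \<and>
      (\<Sum>l<m. (g (Suc l) - g l) * (norm (\<zeta> l w))\<^sup>2) \<le> \<delta>} \<le> K $ i $ i * \<delta> / \<epsilon>\<^sup>2"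
    by (intro step_sum_lenglart e d) (use g in \<open>auto simp: less_imp_le\<close>)
  moreover have "(\<Sum>l<m. incr i (g l) (g (Suc l)) w *\<^sub>R \<zeta> l w)
      = integral_M i k \<tau> \<xi> t w - integral_M i k' \<tau>' \<xi>' t w" for w
    using r1(1)[of "\<lambda>s w. M s w $ i" w] r2(1)[of "\<lambda>s w. M s w $ i" w] by (simp add: \<zeta>_def scaleR_diff_right sum_subtractf)
  moreover have "(\<integral>\<^sup>+s\<in>{0<..t}. ennreal ((norm (simple_process k \<tau> \<xi> s w - simple_process k' \<tau>' \<xi>' s w))\<^sup>2) \<partial>lborel)
      = ennreal (\<Sum>l<m. (g (Suc l) - g l) * (norm (\<zeta> l w))\<^sup>2)" for w
  proof -
    have c: "(norm (simple_process k \<tau> \<xi> s w - simple_process k' \<tau>' \<xi>' s w))\<^sup>2 = (norm (\<zeta> l w))\<^sup>2"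
      if "l < m" "g l < s" "s \<le> g (Suc l)" for l s
      unfolding \<zeta>_def using r1(2)[OF _ _ that] r2(2)[OF _ _ that] by simp
    have le: "g l \<le> g (Suc l)" if "l < m" for l using g(3)[OF that] by simp
    note st = step_integral[where g = g and m = m and c = "\<lambda>l. (norm (\<zeta> l w))\<^sup>2"
        and f = "\<lambda>s. (norm (simple_process k \<tau> \<xi> s w - simple_process k' \<tau>' \<xi>' s w))\<^sup>2", OF le c]
    show ?thesis using st g by (subst set_nn_integral_ennreal) auto
  qed
  moreover have "0 \<le> (\<Sum>l<m. (g (Suc l) - g l) * (norm (\<zeta> l w))\<^sup>2)" for w
    using g(3) by (intro sum_nonneg mult_nonneg_nonneg) (auto simp: less_imp_le)
  ultimately show ?thesis using d by (simp add: ennreal_le_iff)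
qed

text \<open>The approximations of \<open>J\<close> in its definition and the given ones have close integrands on \<open>B\<close>;
  the Lenglart inequality, unlike the isometry, allows to restrict to \<open>B\<close>.\<close>

lemma stoch_integral_local:
  fixes \<Phi> :: "real \<Rightarrow> 'a \<Rightarrow> 'b::euclidean_space"
  assumes J: "has_stoch_integral P F (\<lambda>s w. M s w $ i) \<Phi> t J" and t: "0 \<le> t"
    and si: "\<And>n. simple_integrand P F (k n) (\<tau> n) (\<xi> n)" and B: "B \<in> events"
    and conv: "\<And>e. e > 0 \<Longrightarrow> (\<lambda>n. prob {w\<in>B. (\<integral>\<^sup>+s\<in>{0<..t}.
        ennreal ((norm (\<Phi> s w - simple_process (k n) (\<tau> n) (\<xi> n) s w))\<^sup>2) \<partial>lborel) > ennreal e}) \<longlonglongrightarrow> 0"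
    and e: "e > 0"
  shows "(\<lambda>n. prob {w\<in>B. norm (J w - integral_M i (k n) (\<tau> n) (\<xi> n) t w) > e}) \<longlonglongrightarrow> 0"
proof -
  obtain k' \<tau>' \<xi>' where si': "\<And>n. simple_integrand P F (k' n) (\<tau>' n) (\<xi>' n)"
    and c1: "tendsto_0_in_prob P (\<lambda>n w.
          \<integral>\<^sup>+s\<in>{0<..t}. ennreal ((norm (\<Phi> s w - simple_process (k' n) (\<tau>' n) (\<xi>' n) s w))\<^sup>2) \<partial>lborel)"
    and c2: "tendsto_0_in_prob P (\<lambda>n w.
          ennreal (norm (integral_M i (k' n) (\<tau>' n) (\<xi>' n) t w - J w)))"
    and pr: "predictable P F \<Phi>" and Jm: "J \<in> borel_measurable P"
    using J unfolding has_stoch_integral_def by auto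
  let ?S = "\<lambda>n s w. simple_process (k n) (\<tau> n) (\<xi> n) s w"
  let ?S' = "\<lambda>n s w. simple_process (k' n) (\<tau>' n) (\<xi>' n) s w"
  let ?I = "\<lambda>n w. integral_M i (k n) (\<tau> n) (\<xi> n) t w"
  let ?I' = "\<lambda>n w. integral_M i (k' n) (\<tau>' n) (\<xi>' n) t w"
  define a where "a n w = (\<integral>\<^sup>+s\<in>{0<..t}. ennreal ((norm (\<Phi> s w - ?S n s w))\<^sup>2) \<partial>lborel)" for n w
  define b where "b n w = (\<integral>\<^sup>+s\<in>{0<..t}. ennreal ((norm (\<Phi> s w - ?S' n s w))\<^sup>2) \<partial>lborel)" for n w
  define c where "c n w = (\<integral>\<^sup>+s\<in>{0<..t}. ennreal ((norm (?S n s w - ?S' n s w))\<^sup>2) \<partial>lborel)" for n w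
  have jS: "(\<lambda>(w, s). ?S n s w) \<in> borel_measurable PT" for n
    by (intro simple_process_joint_measurable simple_integrand_measurable[OF si])
  have jS': "(\<lambda>(w, s). ?S' n s w) \<in> borel_measurable PT" for n
    by (intro simple_process_joint_measurable simple_integrand_measurable[OF si'])
  note j\<Phi> = predictable_joint_measurable[OF pr]
  have jd: "(\<lambda>(w, s). indicator {0<..} s *\<^sub>R (\<Phi> s w - Z s w)) \<in> borel_measurable PT"
    if Z: "(\<lambda>(w, s). Z s w) \<in> borel_measurable PT" for Z
  proof -
    have "(\<lambda>z. (\<lambda>(w, s). indicator {0<..} s *\<^sub>R \<Phi> s w) z - indicator {0<..} (snd z) *\<^sub>R (\<lambda>(w, s). Z s w) z) \<in> borel_measurable PT"
      by (intro borel_measurable_diff j\<Phi> borel_measurable_scaleR Z) measurable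
    then show ?thesis by (simp add: case_prod_unfold scaleR_diff_right)
  qed
  have am: "a n \<in> borel_measurable P" for n
    unfolding a_def using jd[OF jS[of n]] by (intro integral_square_measurable)
  have bm: "b n \<in> borel_measurable P" for n
    unfolding b_def using jd[OF jS'[of n]] by (intro integral_square_measurable)
  have cm: "c n \<in> borel_measurable P" for n
    unfolding c_def
  proof (rule integral_square_measurable)
    have "(\<lambda>z. indicator {0<..} (snd z) *\<^sub>R ((\<lambda>(w, s). ?S n s w) z - (\<lambda>(w, s). ?S' n s w) z)) \<in> borel_measurable PT"
      by (intro borel_measurable_diff jS jS' borel_measurable_scaleR) measurable
    then show "(\<lambda>(w, s). indicator {0<..} s *\<^sub>R (?S n s w - ?S' n s w)) \<in> borel_measurable PT"
      by (simp add: case_prod_unfold)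
  qed
  have abc: "c n w \<le> 2 * a n w + 2 * b n w" if "w \<in> space P" for n w
  proof -
    have m: "(\<lambda>s. ennreal ((norm (\<Phi> s w - Z s w))\<^sup>2) * indicator {0<..t} s) \<in> borel_measurable lborel"
      if Z: "(\<lambda>(w, s). Z s w) \<in> borel_measurable PT" for Z
    proof -
      have "(\<lambda>s. indicator {0<..} s *\<^sub>R (\<Phi> s w - Z s w)) \<in> borel_measurable lborel"
        using measurable_compose[OF measurable_Pair1'[OF \<open>w \<in> space P\<close>] jd[OF Z]] by simp
      then have "(\<lambda>s. ennreal ((norm (indicator {0<..} s *\<^sub>R (\<Phi> s w - Z s w)))\<^sup>2) * indicator {0<..t} s) \<in> borel_measurable lborel"
        by measurable
      moreover have "ennreal ((norm (indicator {0<..} s *\<^sub>R (\<Phi> s w - Z s w)))\<^sup>2) * indicator {0<..t} s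
        = ennreal ((norm (\<Phi> s w - Z s w))\<^sup>2) * indicator {0<..t} s" for s by (auto simp: indicator_def)
      ultimately show ?thesis by simp
    qed
    have "c n w \<le> (\<integral>\<^sup>+s. 2 * (ennreal ((norm (\<Phi> s w - ?S n s w))\<^sup>2) * indicator {0<..t} s)
        + 2 * (ennreal ((norm (\<Phi> s w - ?S' n s w))\<^sup>2) * indicator {0<..t} s) \<partial>lborel)"
      unfolding c_def
    proof (intro nn_integral_mono)
      fix s
      let ?x = "\<Phi> s w - ?S n s w" and ?y = "\<Phi> s w - ?S' n s w"
      have "(norm (?S n s w - ?S' n s w))\<^sup>2 \<le> (norm ?x + norm ?y)\<^sup>2"
        using norm_triangle_ineq4[of ?y ?x] by (intro power_mono) (auto simp: algebra_simps)
      also have "\<dots> \<le> 2 * (norm ?x)\<^sup>2 + 2 * (norm ?y)\<^sup>2"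
        using sum_squares_bound[of "norm ?x" "norm ?y"] by (simp add: power2_sum)
      finally have "ennreal ((norm (?S n s w - ?S' n s w))\<^sup>2) \<le> ennreal (2 * (norm ?x)\<^sup>2 + 2 * (norm ?y)\<^sup>2)"
        by (rule ennreal_leI)
      also have "\<dots> = 2 * ennreal ((norm ?x)\<^sup>2) + 2 * ennreal ((norm ?y)\<^sup>2)" by (simp add: ennreal_mult)
      finally show "ennreal ((norm (?S n s w - ?S' n s w))\<^sup>2) * indicator {0<..t} s
          \<le> 2 * (ennreal ((norm ?x)\<^sup>2) * indicator {0<..t} s) + 2 * (ennreal ((norm ?y)\<^sup>2) * indicator {0<..t} s)"
        by (auto simp: indicator_def)
    qed
    also have "\<dots> = 2 * a n w + 2 * b n w"
      unfolding a_def b_def using m[OF jS] m[OF jS'] by (simp add: nn_integral_add nn_integral_cmult)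
    finally show ?thesis .
  qed
  have Im: "?I n \<in> borel_measurable P" and I'm: "?I' n \<in> borel_measurable P" for n
    using simple_integral_measurable[OF si t] simple_integral_measurable[OF si' t] by auto
  have Bs: "B \<subseteq> space P" using B sets.sets_into_space by auto
  \<comment> \<open>Outside the first two events the two simple integrands differ in integrated
    square by at most twice d / 4 plus twice d / 4, that is, by \<open>d\<close>. The Lenglart
    inequality then keeps the simple integrals within \<open>e / 2\<close> of each other, and the
    last event accounts for the other half of \<open>e\<close>.\<close>
  have bound: "prob {w\<in>B. norm (J w - ?I n w) > e} \<le>
      prob {w\<in>B. a n w > ennreal (d / 4)} + prob {w\<in>space P. b n w > ennreal (d / 4)}
      + K $ i $ i * d / (e / 2)\<^sup>2 + prob {w\<in>space P. ennreal (norm (?I' n w - J w)) > ennreal (e / 2)}"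
    if d: "d > 0" for d n
  proof -
    let ?A = "{w\<in>B. a n w > ennreal (d / 4)}" and ?B = "{w\<in>space P. b n w > ennreal (d / 4)}"
    let ?C = "{w\<in>space P. norm (?I n w - ?I' n w) > e / 2 \<and> c n w \<le> ennreal d}"
    let ?D = "{w\<in>space P. ennreal (norm (?I' n w - J w)) > ennreal (e / 2)}"
    have "?A = B \<inter> {w\<in>space P. a n w > ennreal (d / 4)}" using Bs by auto
    moreover have "{w\<in>space P. a n w > ennreal (d / 4)} \<in> events" using am by measurable
    ultimately have A: "?A \<in> events" using B by auto
    have B': "?B \<in> events" using bm by measurable
    have C: "?C \<in> events" using cm Im I'm by measurable
    have D: "?D \<in> events" using I'm Jm by measurable
    have "{w\<in>B. norm (J w - ?I n w) > e} \<subseteq> ?A \<union> ?B \<union> ?C \<union> ?D"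
    proof (rule subsetI, rule ccontr)
      fix w assume *: "w \<in> {w\<in>B. norm (J w - ?I n w) > e}" "w \<notin> ?A \<union> ?B \<union> ?C \<union> ?D"
      then have wP: "w \<in> space P" "w \<in> B" using Bs by auto
      have "a n w \<le> ennreal (d / 4)" "b n w \<le> ennreal (d / 4)" using * wP by (auto simp: not_less)
      then have "2 * a n w + 2 * b n w \<le> 2 * ennreal (d / 4) + 2 * ennreal (d / 4)"
        by (intro add_mono mult_left_mono) auto
      also have "\<dots> = ennreal d" using ennreal_mult[of 2 "d / 4"] ennreal_plus[of "d / 2" "d / 2"] d by simp
      finally have "c n w \<le> ennreal d" using abc[OF wP(1), of n] by (rule order_trans[rotated])
      then have "norm (?I n w - ?I' n w) \<le> e / 2" using * wP by (auto simp: not_less)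
      moreover have "norm (?I' n w - J w) \<le> e / 2" using * wP e by (auto simp: not_less ennreal_le_iff)
      ultimately have "norm ((?I n w - ?I' n w) + (?I' n w - J w)) \<le> e / 2 + e / 2"
        by (intro norm_triangle_le) auto
      then show False using * by (simp add: norm_minus_commute)
    qed
    then have "prob {w\<in>B. norm (J w - ?I n w) > e} \<le> prob (?A \<union> ?B \<union> ?C \<union> ?D)"
      using A B' C D by (intro finite_measure_mono) auto
    also have "\<dots> \<le> prob ?A + prob ?B + prob ?C + prob ?D"
    proof -
      have "prob (?A \<union> ?B \<union> ?C \<union> ?D) \<le> prob (?A \<union> ?B \<union> ?C) + prob ?D" using A B' C D by (intro measure_Un_le) auto
      moreover have "prob (?A \<union> ?B \<union> ?C) \<le> prob (?A \<union> ?B) + prob ?C" using A B' C by (intro measure_Un_le) auto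
      moreover have "prob (?A \<union> ?B) \<le> prob ?A + prob ?B" using A B' by (intro measure_Un_le) auto
      ultimately show ?thesis by linarith
    qed
    also have "prob ?C \<le> K $ i $ i * d / (e / 2)\<^sup>2"
      unfolding c_def using e d by (intro simple_integral_lenglart si si' t) auto
    finally show ?thesis by simp
  qed
  show ?thesis
  proof (rule LIMSEQ_I)
    fix r :: real assume r: "r > 0"
    \<comment> \<open>Chosen so that the Lenglart term is at most r / 4, like each of the three
      probabilities; the summand 1 covers a vanishing \<open>K $ i $ i\<close>.\<close>
    define d where "d = r * (e / 2)\<^sup>2 / (4 * (K $ i $ i + 1))"
    have d: "d > 0" using r e K_diagonal_nonneg[of i] by (simp add: d_def)
    have dK: "K $ i $ i * d / (e / 2)\<^sup>2 \<le> r / 4"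
    proof -
      have "K $ i $ i * d / (e / 2)\<^sup>2 = K $ i $ i / (K $ i $ i + 1) * (r / 4)"
        using e by (simp add: d_def)
      also have "\<dots> \<le> 1 * (r / 4)" using r K_diagonal_nonneg[of i] by (intro mult_right_mono) auto
      finally show ?thesis by simp
    qed
    have "(\<lambda>n. prob {w\<in>B. a n w > ennreal (d / 4)}) \<longlonglongrightarrow> 0"
      unfolding a_def using conv[of "d / 4"] d by simp
    from LIMSEQ_D[OF this, of "r / 4"] r obtain n1 where n1: "\<And>n. n \<ge> n1 \<Longrightarrow> prob {w\<in>B. a n w > ennreal (d / 4)} < r / 4" by auto
    have "(\<lambda>n. prob {w\<in>space P. b n w > ennreal (d / 4)}) \<longlonglongrightarrow> 0"
      using c1 d unfolding b_def tendsto_0_in_prob_def by simp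
    from LIMSEQ_D[OF this, of "r / 4"] r obtain n2 where n2: "\<And>n. n \<ge> n2 \<Longrightarrow> prob {w\<in>space P. b n w > ennreal (d / 4)} < r / 4" by auto
    have "(\<lambda>n. prob {w\<in>space P. ennreal (norm (?I' n w - J w)) > ennreal (e / 2)}) \<longlonglongrightarrow> 0"
      using c2 e unfolding tendsto_0_in_prob_def by simp
    from LIMSEQ_D[OF this, of "r / 4"] r obtain n3
      where n3: "\<And>n. n \<ge> n3 \<Longrightarrow> prob {w\<in>space P. ennreal (norm (?I' n w - J w)) > ennreal (e / 2)} < r / 4" by auto
    show "\<exists>no. \<forall>n\<ge>no. norm (prob {w\<in>B. norm (J w - ?I n w) > e} - 0) < r"
    proof (intro exI[of _ "max n1 (max n2 n3)"] allI impI)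
      fix n assume "n \<ge> max n1 (max n2 n3)"
      then have "prob {w\<in>B. norm (J w - ?I n w) > e} < r"
        using bound[OF d, of n] dK n1[of n] n2[of n] n3[of n] by linarith
      then show "norm (prob {w\<in>B. norm (J w - ?I n w) > e} - 0) < r" by simp
    qed
  qed
qed

end

section \<open>The energy identity\<close>

text \<open>The product rule \<open>d b(\<Psi>, \<Psi>) = 2 b(\<Psi>', \<Psi>)\<close> for an absolutely continuous \<open>\<Psi>\<close>, obtained from Fubini's
  theorem on the two triangles of a square; no differentiation theorem is needed.\<close>

lemma bilinear_indefinite_integral:
  fixes f :: "real \<Rightarrow> 'b::euclidean_space" and b :: "'b \<Rightarrow> 'b \<Rightarrow> real"
  assumes b: "bounded_bilinear b" and sym: "\<And>x y. b x y = b y x"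
    and f: "set_integrable lborel {0..t} f"
  shows "b (LINT s:{0..t}|lborel. f s) (LINT s:{0..t}|lborel. f s)
    = 2 * (LINT s:{0..t}|lborel. b (f s) (LINT r:{0..s}|lborel. f r))"
proof -
  interpret b: bounded_bilinear b by (rule b)
  \<comment> \<open>Extension by 0 turns integrals over \<open>{0..t}\<close> into integrals over
    the line, to which Fubini's theorem for \<open>lborel\<close> applies.\<close>
  define h where "h s = indicator {0..t} s *\<^sub>R f s" for s
  have h: "integrable lborel h" using f by (simp add: h_def[abs_def] set_integrable_def)
  then have hm[measurable]: "h \<in> borel_measurable borel" by (simp add: borel_measurable_integrable)
  define I where "I = (LINT s|lborel. h s)"
  define G where "G s = (LINT r|lborel. indicator {..s} r *\<^sub>R h r)" for s
  define G' where "G' s = (LINT r|lborel. indicator {..<s} r *\<^sub>R h r)" for s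
  \<comment> \<open>The diagonal can belong to only one of the triangles; its sections are single
    points, so closed and open half-lines give the same integral.\<close>
  have G'_eq: "G' s = G s" for s
    unfolding G_def G'_def
    by (rule integral_cong_AE, measurable, rule eventually_mono[OF AE_lborel_singleton[of s]]) (auto simp: indicator_def)
  have hG: "b (h s) (G s) = indicator {0..t} s *\<^sub>R b (f s) (LINT r:{0..s}|lborel. f r)" for s
  proof (cases "s \<in> {0..t}")
    case True
    have "indicator {..s} r *\<^sub>R h r = indicator {0..s} r *\<^sub>R f r" for r
      using True by (auto simp: h_def indicator_def)
    then have "G s = (LINT r:{0..s}|lborel. f r)" by (simp only: G_def set_lebesgue_integral_def)
    then show ?thesis using True by (simp add: h_def)
  qed (simp add: h_def b.zero_left)
  have cm: "(\<lambda>z. b (X z) (Y z)) \<in> borel_measurable N"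
    if "X \<in> borel_measurable N" "Y \<in> borel_measurable N" for X Y and N :: "'z measure"
    by (rule borel_measurable_bilinear[OF b that])
  obtain B where B: "0 < B" "\<And>x y. norm (b x y) \<le> norm x * norm y * B" using b.pos_bounded by blast
  have hn: "integrable lborel (\<lambda>s. norm (h s))" using h by (rule integrable_norm)
  have prod: "integrable (lborel \<Otimes>\<^sub>M lborel) (\<lambda>(s, r). b (h s) (h r))"
  proof (rule Bochner_Integration.integrable_bound)
    show "integrable (lborel \<Otimes>\<^sub>M lborel) (\<lambda>(s, r). norm (h s) * norm (h r) * B)"
    proof (rule lborel_pair.Fubini_integrable)
      show "(\<lambda>(s, r). norm (h s) * norm (h r) * B) \<in> borel_measurable (lborel \<Otimes>\<^sub>M lborel)" by measurable
    qed (use hn B in \<open>simp_all add: abs_mult mult.assoc\<close>)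
    show "(\<lambda>(s, r). b (h s) (h r)) \<in> borel_measurable (lborel \<Otimes>\<^sub>M lborel)"
      unfolding case_prod_unfold by (rule cm) measurable
    show "AE z in lborel \<Otimes>\<^sub>M lborel. norm (case z of (s, r) \<Rightarrow> b (h s) (h r)) \<le> norm (case z of (s, r) \<Rightarrow> norm (h s) * norm (h r) * B)"
    proof (rule AE_I2)
      fix z :: "real \<times> real"
      show "norm (case z of (s, r) \<Rightarrow> b (h s) (h r)) \<le> norm (case z of (s, r) \<Rightarrow> norm (h s) * norm (h r) * B)"
        using B(2)[of "h (fst z)" "h (snd z)"] B(1) by (simp add: case_prod_unfold abs_mult)
    qed
  qed
  have part: "integrable (lborel \<Otimes>\<^sub>M lborel) (\<lambda>(s, r). indicator S (s, r) *\<^sub>R b (h s) (h r))"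
    if "S \<in> sets (lborel \<Otimes>\<^sub>M lborel)" for S
    using integrable_mult_indicator[OF that prod] by (simp add: case_prod_unfold)
  have S1: "{z. snd z \<le> fst z} \<in> sets (lborel \<Otimes>\<^sub>M (lborel :: real measure))"
    and S2: "{z. fst z < snd z} \<in> sets (lborel \<Otimes>\<^sub>M (lborel :: real measure))"
  proof -
    have "{z \<in> space (lborel \<Otimes>\<^sub>M lborel). snd z \<le> (fst z :: real)} \<in> sets (lborel \<Otimes>\<^sub>M lborel)"
      "{z \<in> space (lborel \<Otimes>\<^sub>M lborel). fst z < (snd z :: real)} \<in> sets (lborel \<Otimes>\<^sub>M lborel)" by measurable
    then show "{z. snd z \<le> fst z} \<in> sets (lborel \<Otimes>\<^sub>M (lborel :: real measure))"
      "{z. fst z < snd z} \<in> sets (lborel \<Otimes>\<^sub>M (lborel :: real measure))" by (simp_all add: space_pair_measure)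
  qed
  have bI: "b I I = (LINT s|lborel. (LINT r|lborel. b (h s) (h r)))"
  proof -
    have "(LINT r|lborel. b (h s) (h r)) = b (h s) I" for s
      unfolding I_def by (rule integral_bounded_linear[OF b.bounded_linear_right h])
    then show ?thesis using integral_bounded_linear[OF b.bounded_linear_left h, of I] by (simp add: I_def)
  qed
  also have "\<dots> = (LINT z|(lborel \<Otimes>\<^sub>M lborel). (\<lambda>(s, r). b (h s) (h r)) z)"
    using lborel_pair.integral_fst'[OF prod] by simp
  also have "\<dots> = (LINT z|(lborel \<Otimes>\<^sub>M lborel). ((\<lambda>(s, r). indicator {z. snd z \<le> fst z} (s, r) *\<^sub>R b (h s) (h r)) z
       + (\<lambda>(s, r). indicator {z. fst z < snd z} (s, r) *\<^sub>R b (h s) (h r)) z))"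
    by (intro Bochner_Integration.integral_cong refl) (auto simp: indicator_def)
  also have "\<dots> = (LINT z|(lborel \<Otimes>\<^sub>M lborel). (\<lambda>(s, r). indicator {z. snd z \<le> fst z} (s, r) *\<^sub>R b (h s) (h r)) z)
       + (LINT z|(lborel \<Otimes>\<^sub>M lborel). (\<lambda>(s, r). indicator {z. fst z < snd z} (s, r) *\<^sub>R b (h s) (h r)) z)"
    by (rule Bochner_Integration.integral_add[OF part[OF S1] part[OF S2]])
  also have "(LINT z|(lborel \<Otimes>\<^sub>M lborel). (\<lambda>(s, r). indicator {z. snd z \<le> fst z} (s, r) *\<^sub>R b (h s) (h r)) z)
      = (LINT s|lborel. (LINT r|lborel. indicator {z. snd z \<le> fst z} (s, r) *\<^sub>R b (h s) (h r)))"
    using lborel_pair.integral_fst'[OF part[OF S1]] by simp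
  also have "\<dots> = (LINT s|lborel. b (h s) (G s))"
  proof (rule Bochner_Integration.integral_cong[OF refl])
    fix s
    have "(LINT r|lborel. indicator {z. snd z \<le> fst z} (s, r) *\<^sub>R b (h s) (h r))
        = (LINT r|lborel. b (h s) (indicator {..s} r *\<^sub>R h r))"
      by (intro Bochner_Integration.integral_cong refl) (auto simp: indicator_def b.zero_right)
    also have "\<dots> = b (h s) (G s)"
      unfolding G_def by (rule integral_bounded_linear[OF b.bounded_linear_right]) (rule integrable_mult_indicator[OF _ h], simp)
    finally show "(LINT r|lborel. indicator {z. snd z \<le> fst z} (s, r) *\<^sub>R b (h s) (h r)) = b (h s) (G s)" .
  qed
  also have "(LINT z|(lborel \<Otimes>\<^sub>M lborel). (\<lambda>(s, r). indicator {z. fst z < snd z} (s, r) *\<^sub>R b (h s) (h r)) z)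
      = (LINT r|lborel. (LINT s|lborel. indicator {z. fst z < snd z} (s, r) *\<^sub>R b (h s) (h r)))"
    using lborel_pair.integral_snd[OF part[OF S2]] by simp
  also have "\<dots> = (LINT r|lborel. b (h r) (G r))"
  proof (rule Bochner_Integration.integral_cong[OF refl])
    fix r
    \<comment> \<open>On the second triangle the outer variable stands in the second argument of
      \<open>b\<close>; symmetry brings it to the first.\<close>
    have "(LINT s|lborel. indicator {z. fst z < snd z} (s, r) *\<^sub>R b (h s) (h r))
        = (LINT s|lborel. b (h r) (indicator {..<r} s *\<^sub>R h s))"
      by (intro Bochner_Integration.integral_cong refl) (auto simp: indicator_def b.zero_left b.zero_right sym)
    also have "\<dots> = b (h r) (G' r)"
      unfolding G'_def by (rule integral_bounded_linear[OF b.bounded_linear_right]) (rule integrable_mult_indicator[OF _ h], simp)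
    finally show "(LINT s|lborel. indicator {z. fst z < snd z} (s, r) *\<^sub>R b (h s) (h r)) = b (h r) (G r)"
      by (simp add: G'_eq)
  qed
  finally have "b I I = 2 * (LINT s|lborel. b (h s) (G s))" by simp
  then show ?thesis unfolding hG by (simp add: I_def h_def set_lebesgue_integral_def)
qed

lemma set_integral_bounded_linear:
  fixes f :: "'a \<Rightarrow> 'b::euclidean_space" and T :: "'b \<Rightarrow> 'c::euclidean_space"
  assumes T: "bounded_linear T" and f: "set_integrable N A f"
  shows "set_integrable N A (\<lambda>x. T (f x))" "T (LINT x:A|N. f x) = (LINT x:A|N. T (f x))"
proof -
  interpret T: bounded_linear T by (rule T)
  show "set_integrable N A (\<lambda>x. T (f x))"
    using integrable_bounded_linear[OF T, of N "\<lambda>x. indicator A x *\<^sub>R f x"] f unfolding set_integrable_def by (simp add: T.scaleR)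
  show "T (LINT x:A|N. f x) = (LINT x:A|N. T (f x))"
    using integral_bounded_linear[OF T, of N "\<lambda>x. indicator A x *\<^sub>R f x"] f unfolding set_integrable_def set_lebesgue_integral_def by (simp add: T.scaleR)
qed

lemma simple_process_eq:
  assumes "\<And>l. l < k \<Longrightarrow> \<tau> l \<le> \<tau> (Suc l)" "j < k" "\<tau> j < s" "s \<le> \<tau> (Suc j)"
  shows "simple_process k \<tau> \<xi> s w = \<xi> j w"
proof -
  have "indicator {\<tau> l<..\<tau> (Suc l)} s *\<^sub>R \<xi> l w = (if l = j then \<xi> j w else 0)" if "l < k" for l
  proof -
    consider "l < j" | "l = j" | "j < l" by linarith
    then show ?thesis
    proof cases
      case 1
      then have "\<tau> (Suc l) \<le> \<tau> j" using grid_mono[of k \<tau> "Suc l" j] assms by auto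
      then show ?thesis using 1 assms by (auto simp: indicator_def)
    next
      case 2 then show ?thesis using assms by (auto simp: indicator_def)
    next
      case 3
      then have "\<tau> (Suc j) \<le> \<tau> l" using grid_mono[of k \<tau> "Suc j" l] assms that by auto
      then show ?thesis using 3 assms by (auto simp: indicator_def)
    qed
  qed
  then have "simple_process k \<tau> \<xi> s w = (\<Sum>l<k. if l = j then \<xi> j w else 0)"
    unfolding simple_process_def by (intro sum.cong) auto
  then show ?thesis using assms(2) by simp
qed

context square_integrable_levy
begin

text \<open>The bound separates time from chance, because the drift is controlled by an integrable
  but possibly unbounded function of time and the noise by a random variable that is integrable but
  possibly unbounded.\<close>

lemma fubini_dominated:
  fixes f :: "'a \<Rightarrow> real \<Rightarrow> real"
  assumes m: "(\<lambda>(w, s). f w s) \<in> borel_measurable PT"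
    and \<beta>: "set_integrable lborel {0..t} \<beta>" and Y: "integrable P Y"
    and bd: "\<And>w s. w \<in> space P \<Longrightarrow> s \<in> {0..t} \<Longrightarrow> \<bar>f w s\<bar> \<le> \<beta> s * Y w"
  shows "integrable P (\<lambda>w. LINT s:{0..t}|lborel. f w s)"
    and "set_integrable lborel {0..t} (\<lambda>s. LINT w|P. f w s)"
    and "(LINT w|P. (LINT s:{0..t}|lborel. f w s)) = (LINT s:{0..t}|lborel. (LINT w|P. f w s))"
proof -
  interpret PL: pair_sigma_finite P lborel ..
  let ?h = "\<lambda>s. indicator {0..t} s * \<beta> s"
  have h: "integrable lborel ?h" using \<beta> by (simp add: set_integrable_def)
  have iY: "integrable PT (\<lambda>(w, s). Y w * ?h s)"
  proof (rule PL.Fubini_integrable)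
    have "(\<lambda>z. Y (fst z) * ?h (snd z)) \<in> borel_measurable PT"
      by (intro borel_measurable_times measurable_compose[OF measurable_fst] measurable_compose[OF measurable_snd]
          borel_measurable_integrable[OF Y] borel_measurable_integrable[OF h])
    then show "(\<lambda>(w, s). Y w * ?h s) \<in> borel_measurable PT" by (simp add: case_prod_unfold)
    show "integrable P (\<lambda>w. LINT s|lborel. norm (case (w, s) of (w, s) \<Rightarrow> Y w * ?h s))"
      using Y by (simp add: abs_mult)
    show "AE w in P. integrable lborel (\<lambda>s. case (w, s) of (w, s) \<Rightarrow> Y w * ?h s)"
      using h by simp
  qed
  have m': "(\<lambda>(w, s). indicator {0..t} s *\<^sub>R f w s) \<in> borel_measurable PT"
  proof -
    have "(\<lambda>z. indicator {0..t} (snd z) *\<^sub>R (\<lambda>(w, s). f w s) z) \<in> borel_measurable PT"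
      by (rule borel_measurable_scaleR[OF _ m]) measurable
    then show ?thesis by (simp add: case_prod_unfold)
  qed
  have i: "integrable PT (\<lambda>(w, s). indicator {0..t} s *\<^sub>R f w s)"
  proof (rule Bochner_Integration.integrable_bound[OF iY m'], rule AE_I2)
    fix z :: "'a \<times> real" assume z: "z \<in> space PT"
    obtain w s where wP: "z = (w, s)" "w \<in> space P" using z by (auto simp: space_pair_measure)
    show "norm (case z of (w, s) \<Rightarrow> indicator {0..t} s *\<^sub>R f w s) \<le> norm (case z of (w, s) \<Rightarrow> Y w * ?h s)"
      using bd[OF wP(2), of s] wP(1) by (cases "s \<in> {0..t}") (auto simp: mult.commute)
  qed
  show "integrable P (\<lambda>w. LINT s:{0..t}|lborel. f w s)"
    using PL.integrable_fst'[OF i] by (simp add: set_lebesgue_integral_def)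
  have eq: "(LINT w|P. indicator {0..t} s *\<^sub>R f w s) = indicator {0..t} s *\<^sub>R (LINT w|P. f w s)" for s
    by (cases "s \<in> {0..t}") auto
  show "set_integrable lborel {0..t} (\<lambda>s. LINT w|P. f w s)"
    using PL.integrable_snd[OF i] unfolding eq set_integrable_def .
  show "(LINT w|P. (LINT s:{0..t}|lborel. f w s)) = (LINT s:{0..t}|lborel. (LINT w|P. f w s))"
    using PL.Fubini_integral[OF i] unfolding eq set_lebesgue_integral_def by simp
qed

section \<open>Simple integrals against all components of the noise\<close>

definition vector_integral ::
  "nat \<Rightarrow> (nat \<Rightarrow> real) \<Rightarrow> ('v \<Rightarrow> nat \<Rightarrow> 'a \<Rightarrow> 'b::euclidean_space) \<Rightarrow> real \<Rightarrow> 'a \<Rightarrow> 'b" where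
  "vector_integral k \<tau> \<eta> t w = (\<Sum>i\<in>UNIV. integral_M i k \<tau> (\<eta> i) t w)"

lemma vector_integral_square:
  fixes \<eta> :: "'v \<Rightarrow> nat \<Rightarrow> 'a \<Rightarrow> 'b::euclidean_space"
  assumes si: "\<And>i. simple_integrand P F k \<tau> (\<eta> i)" and t: "0 \<le> t"
  shows "vector_integral k \<tau> \<eta> t \<in> borel_measurable (F t)"
    and "integrable P (\<lambda>w. (norm (vector_integral k \<tau> \<eta> t w))\<^sup>2)"
    and "bounded_bilinear b \<Longrightarrow> (LINT w|P. b (vector_integral k \<tau> \<eta> t w) (vector_integral k \<tau> \<eta> t w))
      = (\<Sum>j<k. (min t (\<tau> (Suc j)) - min t (\<tau> j)) *
          (LINT w|P. (\<Sum>i\<in>UNIV. \<Sum>i'\<in>UNIV. K $ i $ i' * b (\<eta> i j w) (\<eta> i' j w))))"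
proof -
  define g where "g j = min t (\<tau> j)" for j
  \<comment> \<open>Cells that start at or after \<open>t\<close> contribute nothing, but their
    coefficients are known only at \<open>\<tau> j\<close>; setting them to 0 makes them measurable
    at \<open>min t (\<tau> j)\<close>.\<close>
  define \<eta>' where "\<eta>' i j w = (if \<tau> j < t then \<eta> i j w else 0)" for i j w
  have \<tau>: "0 \<le> \<tau> j" if "j \<le> k" for j using simple_integrand_times[OF si that] .
  have le: "\<tau> j \<le> \<tau> (Suc j)" if "j < k" for j using si that by (simp add: simple_integrand_def)
  have g0: "0 \<le> g 0" using \<tau>[of 0] t by (simp add: g_def)
  have gm: "g j \<le> g (Suc j)" if "j < k" for j using le[OF that] by (auto simp: g_def)
  have \<eta>m: "\<eta>' i j \<in> borel_measurable (F (g j))" if "j < k" for i j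
    using si[of i] that by (cases "\<tau> j < t") (auto simp: \<eta>'_def[abs_def] g_def simple_integrand_def)
  have \<eta>b: "\<exists>c. \<forall>w\<in>space P. norm (\<eta>' i j w) \<le> c" if "j < k" for i j
    using si[of i] that by (cases "\<tau> j < t") (auto simp: \<eta>'_def[abs_def] g_def simple_integrand_def)
  have eq: "(\<Sum>j<k. \<Sum>i\<in>UNIV. incr i (g j) (g (Suc j)) w *\<^sub>R \<eta>' i j w) = vector_integral k \<tau> \<eta> t w" for w
    unfolding vector_integral_def simple_integral_def
  proof (subst sum.swap, intro sum.cong refl)
    fix i j assume "j \<in> {..<k}"
    then show "incr i (g j) (g (Suc j)) w *\<^sub>R \<eta>' i j w
        = (M (min t (\<tau> (Suc j))) w $ i - M (min t (\<tau> j)) w $ i) *\<^sub>R \<eta> i j w"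
      using le[of j] by (auto simp: g_def \<eta>'_def min_def)
  qed
  note sq = step_sum_square_integrable[where g = g and m = k and \<eta> = \<eta>', OF g0 gm \<eta>m \<eta>b, unfolded eq]
  have gk: "g k \<le> t" by (simp add: g_def)
  show "vector_integral k \<tau> \<eta> t \<in> borel_measurable (F t)"
    using measurable_F_mono[OF sq(1) gk sq(2)] by simp
  show "integrable P (\<lambda>w. (norm (vector_integral k \<tau> \<eta> t w))\<^sup>2)" using sq(3) by simp
  assume b: "bounded_bilinear b"
  have "(LINT w|P. b (vector_integral k \<tau> \<eta> t w) (vector_integral k \<tau> \<eta> t w))
      = (\<Sum>j<k. (g (Suc j) - g j) * (LINT w|P. (\<Sum>i\<in>UNIV. \<Sum>i'\<in>UNIV. K $ i $ i' * b (\<eta>' i j w) (\<eta>' i' j w))))"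
    using step_sum_isometry[where g = g and m = k and \<eta> = \<eta>', OF b g0 gm \<eta>m \<eta>b, unfolded eq] by simp
  also have "\<dots> = (\<Sum>j<k. (min t (\<tau> (Suc j)) - min t (\<tau> j)) *
          (LINT w|P. (\<Sum>i\<in>UNIV. \<Sum>i'\<in>UNIV. K $ i $ i' * b (\<eta> i j w) (\<eta> i' j w))))"
  proof (intro sum.cong refl)
    fix j assume "j \<in> {..<k}"
    then show "(g (Suc j) - g j) * (LINT w|P. (\<Sum>i\<in>UNIV. \<Sum>i'\<in>UNIV. K $ i $ i' * b (\<eta>' i j w) (\<eta>' i' j w)))
      = (min t (\<tau> (Suc j)) - min t (\<tau> j)) * (LINT w|P. (\<Sum>i\<in>UNIV. \<Sum>i'\<in>UNIV. K $ i $ i' * b (\<eta> i j w) (\<eta> i' j w)))"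
      using le[of j] by (cases "\<tau> j < t") (simp_all add: g_def \<eta>'_def min_def)
  qed
  finally show "(LINT w|P. b (vector_integral k \<tau> \<eta> t w) (vector_integral k \<tau> \<eta> t w))
      = (\<Sum>j<k. (min t (\<tau> (Suc j)) - min t (\<tau> j)) *
          (LINT w|P. (\<Sum>i\<in>UNIV. \<Sum>i'\<in>UNIV. K $ i $ i' * b (\<eta> i j w) (\<eta> i' j w))))" .
qed

lemma simple_integral_martingale:
  fixes \<xi> :: "nat \<Rightarrow> 'a \<Rightarrow> 'b::euclidean_space" and b :: "'c::euclidean_space \<Rightarrow> 'b \<Rightarrow> real"
  assumes b: "bounded_bilinear b" and si: "simple_integrand P F k \<tau> \<xi>" and st: "0 \<le> s" "s \<le> t"
    and Y: "Y \<in> borel_measurable (F s)" "\<exists>c. \<forall>w\<in>space P. norm (Y w) \<le> c"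
  shows "integrable P (\<lambda>w. b (Y w) (integral_M i k \<tau> \<xi> t w
      - integral_M i k \<tau> \<xi> s w))"
    and "(LINT w|P. b (Y w) (integral_M i k \<tau> \<xi> t w
      - integral_M i k \<tau> \<xi> s w)) = 0"
proof -
  interpret b: bounded_bilinear b by (rule b)
  \<comment> \<open>Clamping to the interval from \<open>s\<close> to \<open>t\<close>: what the
    integral gains in between is a sum over cells that start no earlier than \<open>s\<close>, where
    \<open>Y\<close> is already known.\<close>
  define c where "c j = max s (min t (\<tau> j))" for j
  have le: "\<tau> j \<le> \<tau> (Suc j)" if "j < k" for j using si that by (simp add: simple_integrand_def)
  have inc: "M (min t (\<tau> (Suc j))) w $ i - M (min t (\<tau> j)) w $ i - (M (min s (\<tau> (Suc j))) w $ i - M (min s (\<tau> j)) w $ i)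
      = incr i (c j) (c (Suc j)) w" for j w
  proof -
    have "incr i (min s (\<tau> j)) (min t (\<tau> j)) w = incr i s (c j) w" for j
      using st by (auto simp: c_def min_def max_def)
    from this[of j] this[of "Suc j"] show ?thesis by simp
  qed
  have eq: "b (Y w) (integral_M i k \<tau> \<xi> t w - integral_M i k \<tau> \<xi> s w)
      = (\<Sum>j<k. incr i (c j) (c (Suc j)) w * b (Y w) (\<xi> j w))" for w
    unfolding simple_integral_def sum_subtractf[symmetric] scaleR_diff_left[symmetric] inc
    by (simp add: b.sum_right b.scaleR_right)
  have trm: "integrable P (\<lambda>w. incr i (c j) (c (Suc j)) w * b (Y w) (\<xi> j w)) \<and>
      (LINT w|P. incr i (c j) (c (Suc j)) w * b (Y w) (\<xi> j w)) = 0" if j: "j < k" for j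
  proof (cases "\<tau> j \<le> t")
    case True
    have c: "0 \<le> c j" "c j \<le> c (Suc j)" "s \<le> c j" "\<tau> j \<le> c j" using st le[OF j] True by (auto simp: c_def)
    have \<tau>: "0 \<le> \<tau> j" using simple_integrand_times[OF si, of j] j by simp
    have \<xi>: "\<xi> j \<in> borel_measurable (F (\<tau> j))" "\<exists>c. \<forall>w\<in>space P. norm (\<xi> j w) \<le> c"
      using si j by (auto simp: simple_integrand_def)
    have m: "(\<lambda>w. b (Y w) (\<xi> j w)) \<in> borel_measurable (F (c j))"
      by (rule borel_measurable_bilinear[OF b measurable_F_mono[OF st(1) c(3) Y(1)] measurable_F_mono[OF \<tau> c(4) \<xi>(1)]])
    have "integrable P (\<lambda>w. b (Y w) (\<xi> j w))"
      by (rule integrable_bilinear[OF b measurable_F_P[OF st(1) Y(1)] measurable_F_P[OF \<tau> \<xi>(1)]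
            integrable_bounded_norm_square[OF measurable_F_P[OF st(1) Y(1)] Y(2)]
            integrable_bounded_norm_square[OF measurable_F_P[OF \<tau> \<xi>(1)] \<xi>(2)]])
    then show ?thesis using increment_times[OF c(1,2) m] by blast
  next
    case False
    \<comment> \<open>A coefficient that starts after \<open>t\<close> need not be known at
      \<open>c j = t\<close>, but its clamped cell is empty.\<close>
    then have "c (Suc j) = c j" using le[OF j] st by (auto simp: c_def)
    then show ?thesis by simp
  qed
  show "integrable P (\<lambda>w. b (Y w) (integral_M i k \<tau> \<xi> t w - integral_M i k \<tau> \<xi> s w))"
    unfolding eq using trm by (intro Bochner_Integration.integrable_sum) auto
  show "(LINT w|P. b (Y w) (integral_M i k \<tau> \<xi> t w - integral_M i k \<tau> \<xi> s w)) = 0"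
    unfolding eq using trm by (subst Bochner_Integration.integral_sum) auto
qed

lemma vector_integral_martingale:
  fixes \<eta> :: "'v \<Rightarrow> nat \<Rightarrow> 'a \<Rightarrow> 'b::euclidean_space" and b :: "'c::euclidean_space \<Rightarrow> 'b \<Rightarrow> real"
  assumes b: "bounded_bilinear b" and si: "\<And>i. simple_integrand P F k \<tau> (\<eta> i)" and st: "0 \<le> s" "s \<le> t"
    and Y: "Y \<in> borel_measurable (F s)" "\<exists>c. \<forall>w\<in>space P. norm (Y w) \<le> c"
  shows "integrable P (\<lambda>w. b (Y w) (vector_integral k \<tau> \<eta> t w))"
    and "(LINT w|P. b (Y w) (vector_integral k \<tau> \<eta> t w)) = (LINT w|P. b (Y w) (vector_integral k \<tau> \<eta> s w))"
proof -
  interpret b: bounded_bilinear b by (rule b)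
  have i: "integrable P (\<lambda>w. b (Y w) (vector_integral k \<tau> \<eta> r w))" if r: "0 \<le> r" for r
    by (rule integrable_bilinear[OF b measurable_F_P[OF st(1) Y(1)]
          measurable_F_P[OF r vector_integral_square(1)[OF si r]]
          integrable_bounded_norm_square[OF measurable_F_P[OF st(1) Y(1)] Y(2)] vector_integral_square(2)[OF si r]])
  show it: "integrable P (\<lambda>w. b (Y w) (vector_integral k \<tau> \<eta> t w))" using i st by simp
  note m = simple_integral_martingale[OF b si st Y]
  have "(LINT w|P. b (Y w) (vector_integral k \<tau> \<eta> t w)) - (LINT w|P. b (Y w) (vector_integral k \<tau> \<eta> s w))
      = (LINT w|P. b (Y w) (vector_integral k \<tau> \<eta> t w) - b (Y w) (vector_integral k \<tau> \<eta> s w))"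
    using it i[OF st(1)] by simp
  also have "\<dots> = (LINT w|P. (\<Sum>i\<in>UNIV. b (Y w) (integral_M i k \<tau> (\<eta> i) t w
      - integral_M i k \<tau> (\<eta> i) s w)))"
    by (simp add: vector_integral_def b.diff_right b.sum_right sum_subtractf)
  also have "\<dots> = 0" using m by (subst Bochner_Integration.integral_sum) auto
  finally show "(LINT w|P. b (Y w) (vector_integral k \<tau> \<eta> t w)) = (LINT w|P. b (Y w) (vector_integral k \<tau> \<eta> s w))"
    by simp
qed

lemma vector_integral_0: "(\<And>i. simple_integrand P F k \<tau> (\<eta> i)) \<Longrightarrow> vector_integral k \<tau> \<eta> 0 w = 0"
proof -
  assume si: "\<And>i. simple_integrand P F k \<tau> (\<eta> i)"
  have "min 0 (\<tau> j) = 0" if "j \<le> k" for j using simple_integrand_times[OF si that] by simp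
  then show ?thesis unfolding vector_integral_def simple_integral_def by simp
qed

text \<open>Put Z = x0 + D + I with the drift integral D and the noise I. The term b(D, D) is
  covered by \<open>bilinear_indefinite_integral\<close>, and b(D(t), I(t)) is the integral of
  b(d(s), I(t)), in which the martingale property replaces I(t) by I(s) under the expectation,
  because d(s) is known at time s. These terms collect to the integral of 2 b(d(s), Z(s)), and the
  only further contribution is the mean of b(I(t), I(t)).\<close>

lemma energy_identity:
  fixes d :: "real \<Rightarrow> 'a \<Rightarrow> 'b::euclidean_space" and b :: "'b \<Rightarrow> 'b \<Rightarrow> real" and x0 :: 'b
  assumes b: "bounded_bilinear b" and sym: "\<And>x y. b x y = b y x"
    and si: "\<And>i. simple_integrand P F k \<tau> (\<eta> i)" and t: "0 \<le> t"
    and dj: "(\<lambda>(w, s). d s w) \<in> borel_measurable PT"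
    and dF: "\<And>s. 0 \<le> s \<Longrightarrow> d s \<in> borel_measurable (F s)"
    and \<beta>: "set_integrable lborel {0..t} \<beta>"
    and bd: "\<And>w s. w \<in> space P \<Longrightarrow> s \<in> {0..t} \<Longrightarrow> norm (d s w) \<le> \<beta> s"
  defines "Z \<equiv> \<lambda>s w. x0 + (LINT r:{0..s}|lborel. d r w) + vector_integral k \<tau> \<eta> s w"
  shows "set_integrable lborel {0..t} (\<lambda>s. LINT w|P. b (d s w) (Z s w))"
    and "(LINT w|P. b (Z t w) (Z t w)) = b x0 x0 + 2 * (LINT s:{0..t}|lborel. (LINT w|P. b (d s w) (Z s w)))
      + (LINT w|P. b (vector_integral k \<tau> \<eta> t w) (vector_integral k \<tau> \<eta> t w))"
    and "\<And>w s. w \<in> space P \<Longrightarrow> s \<in> {0..t} \<Longrightarrow> norm (LINT r:{0..s}|lborel. d r w) \<le> (LINT r:{0..t}|lborel. \<beta> r)"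
    and "\<And>s. s \<in> {0..t} \<Longrightarrow> Z s \<in> borel_measurable P"
    and "\<And>s. s \<in> {0..t} \<Longrightarrow> integrable P (\<lambda>w. (norm (Z s w))\<^sup>2)"
proof -
  interpret b: bounded_bilinear b by (rule b)
  obtain B where B: "0 < B" "\<And>x y. norm (b x y) \<le> norm x * norm y * B" using b.pos_bounded by blast
  define D where "D s w = (LINT r:{0..s}|lborel. d r w)" for s w
  define I where "I s w = vector_integral k \<tau> \<eta> s w" for s w
  define c where "c = (LINT r:{0..t}|lborel. \<beta> r)"
  have dm: "(\<lambda>s. d s w) \<in> borel_measurable lborel" if "w \<in> space P" for w
    using measurable_compose[OF measurable_Pair1'[OF that] dj] by simp
  have di: "set_integrable lborel {0..s} (\<lambda>r. d r w)" if "w \<in> space P" "s \<in> {0..t}" for w s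
  proof -
    have "set_integrable lborel {0..s} \<beta>" by (rule set_integrable_subset[OF \<beta>]) (use that in auto)
    then show ?thesis unfolding set_integrable_def
    proof (rule Bochner_Integration.integrable_bound)
      show "(\<lambda>r. indicator {0..s} r *\<^sub>R d r w) \<in> borel_measurable lborel" using dm[OF that(1)] by measurable
      show "AE r in lborel. norm (indicator {0..s} r *\<^sub>R d r w) \<le> norm (indicator {0..s} r *\<^sub>R \<beta> r)"
        using bd[OF that(1)] that(2) by (intro AE_I2) (auto simp: indicator_def intro!: order_trans[OF _ abs_ge_self])
    qed
  qed
  \<comment> \<open>The bound at any one outcome shows that \<open>\<beta>\<close> is nonnegative on
    \<open>{0..t}\<close>.\<close>
  obtain w0 where w0: "w0 \<in> space P" using not_empty by blast
  have \<beta>0: "0 \<le> \<beta> s" if "s \<in> {0..t}" for s using bd[OF w0 that] norm_ge_zero by (rule order_trans[rotated])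
  have Dc: "norm (D s w) \<le> c" if "w \<in> space P" "s \<in> {0..t}" for w s
  proof -
    have "norm (D s w) \<le> (LINT r|lborel. norm (indicator {0..s} r *\<^sub>R d r w))"
      unfolding D_def set_lebesgue_integral_def by (rule integral_norm_bound)
    also have "\<dots> \<le> c"
      unfolding c_def set_lebesgue_integral_def
    proof (rule integral_mono)
      show "integrable lborel (\<lambda>r. norm (indicator {0..s} r *\<^sub>R d r w))"
        using di[OF that] unfolding set_integrable_def by (rule integrable_norm)
      show "integrable lborel (\<lambda>r. indicator {0..t} r *\<^sub>R \<beta> r)" using \<beta> by (simp add: set_integrable_def)
      show "norm (indicator {0..s} r *\<^sub>R d r w) \<le> indicator {0..t} r *\<^sub>R \<beta> r" for r
        using bd[OF that(1), of r] that(2) \<beta>0[of r] by (auto simp: indicator_def)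
    qed
    finally show ?thesis .
  qed
  then show "norm (LINT r:{0..s}|lborel. d r w) \<le> (LINT r:{0..t}|lborel. \<beta> r)" if "w \<in> space P" "s \<in> {0..t}" for w s
    using that unfolding D_def c_def by blast
  \<comment> \<open>\<open>D\<close> is an integral over a third variable \<open>r\<close>; its
    upper limit \<open>s\<close> is moved into the integrand as a conditional factor, which leaves a
    function jointly measurable in outcome, \<open>s\<close> and \<open>r\<close>.\<close>
  have Dj: "(\<lambda>(w, s). D s w) \<in> borel_measurable PT"
  proof -
    have m1: "(\<lambda>z. d (snd z) (fst (fst z))) \<in> borel_measurable (PT \<Otimes>\<^sub>M (lborel :: real measure))"
    proof -
      have "(\<lambda>z. (\<lambda>(w, s). d s w) (fst (fst z), snd z)) \<in> borel_measurable (PT \<Otimes>\<^sub>M (lborel :: real measure))"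
        by (rule measurable_compose[OF _ dj]) measurable
      then show ?thesis by simp
    qed
    have m2: "(\<lambda>z. (if 0 \<le> snd z \<and> snd z \<le> snd (fst z) then 1 else 0 :: real))
        \<in> borel_measurable (PT \<Otimes>\<^sub>M (lborel :: real measure))"
      by measurable
    have "(\<lambda>z. (if 0 \<le> snd z \<and> snd z \<le> snd (fst z) then 1 else 0 :: real) *\<^sub>R d (snd z) (fst (fst z)))
        \<in> borel_measurable (PT \<Otimes>\<^sub>M lborel)"
      by (rule borel_measurable_scaleR[OF m2 m1])
    then have "case_prod (\<lambda>z r. (if 0 \<le> r \<and> r \<le> snd z then 1 else 0 :: real) *\<^sub>R d r (fst z))
        \<in> borel_measurable (PT \<Otimes>\<^sub>M lborel)" by (simp add: case_prod_unfold)
    then have "(\<lambda>z. LINT r|lborel. (if 0 \<le> r \<and> r \<le> snd z then 1 else 0 :: real) *\<^sub>R d r (fst z)) \<in> borel_measurable PT"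
      by (rule lborel.borel_measurable_lebesgue_integral)
    moreover have "(LINT r|lborel. (if 0 \<le> r \<and> r \<le> s then 1 else 0 :: real) *\<^sub>R d r w) = D s w" for s w
      unfolding D_def set_lebesgue_integral_def by (intro Bochner_Integration.integral_cong refl) (auto simp: indicator_def)
    ultimately show ?thesis by (simp add: case_prod_unfold)
  qed
  have DP: "D s \<in> borel_measurable P" for s
    using measurable_compose[OF measurable_Pair2'[of s] Dj] by simp
  have IP: "I s \<in> borel_measurable P" if "0 \<le> s" for s
    unfolding I_def using measurable_F_P[OF that vector_integral_square(1)[OF si that]] .
  have I2: "integrable P (\<lambda>w. (norm (I s w))\<^sup>2)" if "0 \<le> s" for s
    unfolding I_def using vector_integral_square(2)[OF si that] .
  have dP: "d s \<in> borel_measurable P" if "0 \<le> s" for s using measurable_F_P[OF that dF[OF that]] .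
  have W2: "integrable P (\<lambda>w. (norm (x0 + D s w))\<^sup>2)" if "s \<in> {0..t}" for s
  proof (rule integrable_bounded_norm_square)
    show "(\<lambda>w. x0 + D s w) \<in> borel_measurable P" using DP by measurable
    have "\<forall>w\<in>space P. norm (x0 + D s w) \<le> norm x0 + c"
      using Dc that by (intro ballI order_trans[OF norm_triangle_ineq] add_left_mono) auto
    then show "\<exists>c. \<forall>w\<in>space P. norm (x0 + D s w) \<le> c" by blast
  qed
  have WP: "(\<lambda>w. x0 + D s w) \<in> borel_measurable P" for s using DP by measurable
  have Z: "Z s w = (x0 + D s w) + I s w" for s w by (simp add: Z_def D_def I_def)
  show ZP: "Z s \<in> borel_measurable P" if "s \<in> {0..t}" for s
    using borel_measurable_add[OF WP[of s] IP[of s]] that by (simp add: Z[abs_def])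
  show "integrable P (\<lambda>w. (norm (Z s w))\<^sup>2)" if "s \<in> {0..t}" for s
  proof (rule Bochner_Integration.integrable_bound)
    show "integrable P (\<lambda>w. 2 * (norm (x0 + D s w))\<^sup>2 + 2 * (norm (I s w))\<^sup>2)"
      using W2[OF that] I2[of s] that by (intro Bochner_Integration.integrable_add integrable_mult_right) auto
    show "(\<lambda>w. (norm (Z s w))\<^sup>2) \<in> borel_measurable P" using ZP[OF that] by measurable
    show "AE w in P. norm ((norm (Z s w))\<^sup>2) \<le> norm (2 * (norm (x0 + D s w))\<^sup>2 + 2 * (norm (I s w))\<^sup>2)"
    proof (rule AE_I2)
      fix w
      have "(norm (Z s w))\<^sup>2 \<le> (norm (x0 + D s w) + norm (I s w))\<^sup>2"
        unfolding Z by (intro power_mono norm_triangle_ineq) simp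
      also have "\<dots> \<le> 2 * (norm (x0 + D s w))\<^sup>2 + 2 * (norm (I s w))\<^sup>2"
        using sum_squares_bound[of "norm (x0 + D s w)" "norm (I s w)"] by (simp add: power2_sum)
      finally show "norm ((norm (Z s w))\<^sup>2) \<le> norm (2 * (norm (x0 + D s w))\<^sup>2 + 2 * (norm (I s w))\<^sup>2)" by simp
    qed
  qed
  define f1 where "f1 w s = b (d s w) (x0 + D s w)" for w s
  \<comment> \<open>The noise is taken at the final time \<open>t\<close>, as it occurs in the
    pathwise expansion; \<open>E2\<close> moves it back to time \<open>s\<close>.\<close>
  define f2 where "f2 w s = b (d s w) (I t w)" for w s
  have m1: "(\<lambda>(w, s). f1 w s) \<in> borel_measurable PT"
  proof -
    have "(\<lambda>z. b ((\<lambda>(w, s). d s w) z) (x0 + (\<lambda>(w, s). D s w) z)) \<in> borel_measurable PT"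
      by (intro borel_measurable_bilinear[OF b dj] borel_measurable_add borel_measurable_const Dj)
    then show ?thesis by (simp add: f1_def case_prod_unfold)
  qed
  have m2: "(\<lambda>(w, s). f2 w s) \<in> borel_measurable PT"
  proof -
    have "(\<lambda>z. b ((\<lambda>(w, s). d s w) z) (I t (fst z))) \<in> borel_measurable PT"
      by (rule borel_measurable_bilinear[OF b dj measurable_compose[OF measurable_fst IP[OF t]]])
    then show ?thesis by (simp add: f2_def case_prod_unfold)
  qed
  have iI: "integrable P (\<lambda>w. norm (I t w))"
    by (rule square_integrable_imp_integrable) (use IP[OF t] I2[OF t] in auto)
  have bd1: "\<bar>f1 w s\<bar> \<le> \<beta> s * ((norm x0 + c) * B)" if "w \<in> space P" "s \<in> {0..t}" for w s
  proof -
    have "\<bar>f1 w s\<bar> \<le> norm (d s w) * norm (x0 + D s w) * B" using B(2) by (simp add: f1_def)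
    also have "\<dots> \<le> \<beta> s * (norm x0 + c) * B"
      using B(1) bd[OF that] \<beta>0[OF that(2)] Dc[OF that] norm_triangle_ineq[of x0 "D s w"]
      by (intro mult_right_mono mult_mono) auto
    finally show ?thesis by (simp add: mult.assoc)
  qed
  have bd2: "\<bar>f2 w s\<bar> \<le> \<beta> s * (norm (I t w) * B)" if "w \<in> space P" "s \<in> {0..t}" for w s
  proof -
    have "\<bar>f2 w s\<bar> \<le> norm (d s w) * norm (I t w) * B" using B(2) by (simp add: f2_def)
    also have "\<dots> \<le> \<beta> s * norm (I t w) * B"
      using B(1) bd[OF that] by (intro mult_right_mono) auto
    finally show ?thesis by (simp add: mult.assoc)
  qed
  have "integrable P (\<lambda>w. (norm x0 + c) * B)" by simp
  note F1 = fubini_dominated[OF m1 \<beta> this bd1]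
  have "integrable P (\<lambda>w. norm (I t w) * B)" using iI by simp
  note F2 = fubini_dominated[OF m2 \<beta> this bd2]
  have E2: "(LINT w|P. f2 w s) = (LINT w|P. b (d s w) (I s w))" if "s \<in> {0..t}" for s
    unfolding f2_def I_def
    by (rule vector_integral_martingale(2)[OF b si _ _ dF]) (use that bd in auto)
  have sum: "(LINT w|P. b (d s w) (Z s w)) = (LINT w|P. f1 w s) + (LINT w|P. f2 w s)" if s: "s \<in> {0..t}" for s
  proof -
    have s0: "0 \<le> s" using s by simp
    have d2: "integrable P (\<lambda>w. (norm (d s w))\<^sup>2)"
      by (rule integrable_bounded_norm_square[OF dP[OF s0]]) (use bd[OF _ s] in blast)
    have "integrable P (\<lambda>w. f1 w s)" unfolding f1_def
      by (rule integrable_bilinear[OF b dP[OF s0] WP d2 W2[OF s]])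
    moreover have "integrable P (\<lambda>w. b (d s w) (I s w))"
      by (rule integrable_bilinear[OF b dP[OF s0] IP[OF s0] d2 I2[OF s0]])
    ultimately show ?thesis unfolding E2[OF s] Z by (simp add: b.add_right f1_def)
  qed
  have iS: "set_integrable lborel {0..t} (\<lambda>s. (LINT w|P. f1 w s) + (LINT w|P. f2 w s))"
    by (rule set_integral_add(1)[OF F1(2) F2(2)])
  have "(\<lambda>s. indicator {0..t} s *\<^sub>R (LINT w|P. b (d s w) (Z s w)))
      = (\<lambda>s. indicator {0..t} s *\<^sub>R ((LINT w|P. f1 w s) + (LINT w|P. f2 w s)))"
    by (rule ext) (simp add: indicator_def sum)
  then show "set_integrable lborel {0..t} (\<lambda>s. LINT w|P. b (d s w) (Z s w))"
    using iS unfolding set_integrable_def by simp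
  have "(LINT s:{0..t}|lborel. (LINT w|P. b (d s w) (Z s w)))
      = (LINT s:{0..t}|lborel. (LINT w|P. f1 w s) + (LINT w|P. f2 w s))"
    by (rule set_lebesgue_integral_cong) (auto simp: sum)
  also have "\<dots> = (LINT w|P. (LINT s:{0..t}|lborel. f1 w s)) + (LINT w|P. (LINT s:{0..t}|lborel. f2 w s))"
    using set_integral_add(2)[OF F1(2) F2(2)] F1(3) F2(3) by simp
  finally have R: "(LINT s:{0..t}|lborel. (LINT w|P. b (d s w) (Z s w)))
      = (LINT w|P. (LINT s:{0..t}|lborel. f1 w s)) + (LINT w|P. (LINT s:{0..t}|lborel. f2 w s))" .
  have path: "b (Z t w) (Z t w) = b x0 x0 + 2 * (LINT s:{0..t}|lborel. f1 w s) + 2 * (LINT s:{0..t}|lborel. f2 w s)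
      + 2 * b x0 (I t w) + b (I t w) (I t w)" if wP: "w \<in> space P" for w
  proof -
    have tt: "t \<in> {0..t}" using t by simp
    note dit = di[OF wP tt]
    have a1: "b (D t w) (I t w) = (LINT s:{0..t}|lborel. f2 w s)"
      unfolding f2_def D_def by (rule set_integral_bounded_linear(2)[OF b.bounded_linear_left dit])
    have a2: "b (D t w) x0 = (LINT s:{0..t}|lborel. b (d s w) x0)"
      unfolding D_def by (rule set_integral_bounded_linear(2)[OF b.bounded_linear_left dit])
    have a3: "b (D t w) (D t w) = 2 * (LINT s:{0..t}|lborel. b (d s w) (D s w))"
      unfolding D_def by (rule bilinear_indefinite_integral[OF b sym dit])
    have i1: "set_integrable lborel {0..t} (\<lambda>s. b (d s w) x0)"
      by (rule set_integral_bounded_linear(1)[OF b.bounded_linear_left dit])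
    have i2: "set_integrable lborel {0..t} (\<lambda>s. b (d s w) (D s w))"
    proof -
      have "set_integrable lborel {0..t} (\<lambda>s. \<beta> s * (c * B))" using \<beta> by simp
      then show ?thesis unfolding set_integrable_def
      proof (rule Bochner_Integration.integrable_bound)
        have "(\<lambda>s. D s w) \<in> borel_measurable lborel"
          using measurable_compose[OF measurable_Pair1'[OF wP] Dj] by simp
        then have "(\<lambda>s. b (d s w) (D s w)) \<in> borel_measurable lborel"
          by (rule borel_measurable_bilinear[OF b dm[OF wP]])
        then show "(\<lambda>s. indicator {0..t} s *\<^sub>R b (d s w) (D s w)) \<in> borel_measurable lborel" by measurable
        show "AE s in lborel. norm (indicator {0..t} s *\<^sub>R b (d s w) (D s w)) \<le> norm (indicator {0..t} s *\<^sub>R (\<beta> s * (c * B)))"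
        proof (rule AE_I2)
          fix s
          show "norm (indicator {0..t} s *\<^sub>R b (d s w) (D s w)) \<le> norm (indicator {0..t} s *\<^sub>R (\<beta> s * (c * B)))"
          proof (cases "s \<in> {0..t}")
            case True
            have "norm (b (d s w) (D s w)) \<le> norm (d s w) * norm (D s w) * B" by (rule B)
            also have "\<dots> \<le> \<beta> s * c * B"
              using B(1) bd[OF wP True] \<beta>0[OF True] Dc[OF wP True] by (intro mult_right_mono mult_mono) auto
            finally show ?thesis using True by (simp add: mult.assoc)
          qed simp
        qed
      qed
    qed
    have f1: "(LINT s:{0..t}|lborel. f1 w s) = (LINT s:{0..t}|lborel. b (d s w) x0) + (LINT s:{0..t}|lborel. b (d s w) (D s w))"
      unfolding f1_def b.add_right by (rule set_integral_add(2)[OF i1 i2])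
    have "b (Z t w) (Z t w) = b x0 x0 + 2 * b (D t w) x0 + b (D t w) (D t w) + 2 * b (D t w) (I t w)
        + 2 * b x0 (I t w) + b (I t w) (I t w)"
      unfolding Z b.add_left b.add_right
      using sym[of "D t w" x0] sym[of "I t w" x0] sym[of "I t w" "D t w"] by simp
    then show ?thesis using a1 a2 a3 f1 by simp
  qed
  have cst: "(\<lambda>w. x0) \<in> borel_measurable (F 0)" "\<exists>c. \<forall>w\<in>space P. norm x0 \<le> c" by auto
  have i0: "integrable P (\<lambda>w. b x0 (I t w))"
    unfolding I_def by (rule vector_integral_martingale(1)[OF b si order_refl t cst])
  have e0: "(LINT w|P. b x0 (I t w)) = 0"
    unfolding I_def
    using vector_integral_martingale(2)[OF b si order_refl t cst] vector_integral_0[OF si] by (simp add: b.zero_right)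
  have iII: "integrable P (\<lambda>w. b (I t w) (I t w))" by (rule integrable_bilinear[OF b IP[OF t] IP[OF t] I2[OF t] I2[OF t]])
  have "(LINT w|P. b (Z t w) (Z t w)) = (LINT w|P. b x0 x0 + 2 * (LINT s:{0..t}|lborel. f1 w s) + 2 * (LINT s:{0..t}|lborel. f2 w s)
      + 2 * b x0 (I t w) + b (I t w) (I t w))"
    by (intro Bochner_Integration.integral_cong refl path)
  also have "\<dots> = b x0 x0 + 2 * (LINT w|P. (LINT s:{0..t}|lborel. f1 w s)) + 2 * (LINT w|P. (LINT s:{0..t}|lborel. f2 w s))
      + (LINT w|P. b (I t w) (I t w))"
    using F1(1) F2(1) i0 iII e0 by (simp add: prob_space)
  finally show "(LINT w|P. b (Z t w) (Z t w)) = b x0 x0 + 2 * (LINT s:{0..t}|lborel. (LINT w|P. b (d s w) (Z s w)))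
      + (LINT w|P. b (vector_integral k \<tau> \<eta> t w) (vector_integral k \<tau> \<eta> t w))"
    unfolding R by (simp add: I_def)
qed

end

section \<open>The killed solution\<close>

text \<open>Here the control is a Borel function and time integrals are over \<open>lborel\<close>;
  a Lebesgue measurable control is replaced by a Borel version when the theorem is derived. The
  family \<open>J\<close> fixes versions of the stochastic integrals, and the null set outside which
  the equation holds may depend on the time.\<close>

locale bilinear_system = square_integrable_levy P F M K
  for P :: "'a measure"
    and F :: "real \<Rightarrow> 'a measure"
    and M :: "real \<Rightarrow> 'a \<Rightarrow> real^'v::finite"
    and K :: "real^'v^'v" +
  fixes A :: "real^'n^'n"
    and N :: "'m::finite \<Rightarrow> real^'n^'n"
    and H :: "'v \<Rightarrow> real^'n^'n"
    and u :: "real \<Rightarrow> real^'m"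
    and x0 :: "real^'n"
    and x :: "real \<Rightarrow> 'a \<Rightarrow> real^'n"
    and J :: "'v \<Rightarrow> real \<Rightarrow> 'a \<Rightarrow> real^'n"
    and T :: real
  assumes T: "0 < T"
    and u_measurable: "u \<in> borel_measurable borel"
    and u_integrable: "set_integrable lborel {0..T} (\<lambda>s. (norm (u s))\<^sup>2)"
    and x_adapted: "adapted F x"
    and x_cadlag: "\<And>w. w \<in> space P \<Longrightarrow> cadlag (\<lambda>t. x t w)"
    and J: "\<And>i t. 0 \<le> t \<Longrightarrow>
      has_stoch_integral P F (\<lambda>s w. M s w $ i) (\<lambda>s w. H i *v left_lim x s w) t (J i t)"
    and x_equation: "\<And>t. t \<in> {0..T} \<Longrightarrow> AE w in P. x t w = x0
      + (LINT s:{0..t}|lborel. A *v x s w + (\<Sum>k\<in>UNIV. (u s $ k) *\<^sub>R (N k *v x s w))) + (\<Sum>i\<in>UNIV. J i t w)"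
begin

text \<open>Survival up to and including time \<open>s\<close>. The exit time from the closed ball
  is in general a stopping time only for a right-continuous filtration; this event belongs to
  \<open>F s\<close> itself.\<close>

definition stay :: "real \<Rightarrow> real \<Rightarrow> 'a \<Rightarrow> bool" where
  "stay R s w \<longleftrightarrow> 0 \<le> s \<and> (\<forall>r\<in>{0..s}. norm (x r w) \<le> R)"

text \<open>At a jump out of the ball the new value is discarded at once, so the bound
  \<open>R\<close> holds however large the jump is.\<close>

definition killed :: "real \<Rightarrow> real \<Rightarrow> 'a \<Rightarrow> real^'n" where
  "killed R s w = (if stay R s w then x s w else 0)"

abbreviation alive :: "real \<Rightarrow> real \<Rightarrow> 'a set" where
  "alive R t \<equiv> {w\<in>space P. stay R t w}"

lemma norm_killed: "0 \<le> R \<Longrightarrow> norm (killed R s w) \<le> R"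
  by (auto simp: killed_def stay_def)

lemma stay_antimono: "stay R s w \<Longrightarrow> 0 \<le> r \<Longrightarrow> r \<le> s \<Longrightarrow> stay R r w"
  by (auto simp: stay_def)

lemma x_measurable_F: "0 \<le> s \<Longrightarrow> x s \<in> borel_measurable (F s)"
  using x_adapted by (simp add: adapted_def)

lemma x_measurable: "0 \<le> s \<Longrightarrow> x s \<in> borel_measurable P"
  using measurable_F_P[OF _ x_measurable_F] by simp

lemma x_right_continuous:
  assumes "w \<in> space P" "0 \<le> s" "p \<longlonglongrightarrow> s" "\<And>n. s < p n"
  shows "(\<lambda>n. x (p n) w) \<longlonglongrightarrow> x s w"
proof -
  have "((\<lambda>t. x t w) \<longlongrightarrow> x s w) (at_right s)" using x_cadlag[OF assms(1)] assms(2) by (simp add: cadlag_def)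
  moreover have "filterlim p (at_right s) sequentially"
    unfolding filterlim_at using assms(3) assms(4) by (auto intro!: always_eventually simp: less_imp_neq[THEN not_sym])
  ultimately show ?thesis by (rule filterlim_compose)
qed

text \<open>Right continuity recovers each time before \<open>s\<close> from rational times in
  between; the endpoint is listed separately because rational times to its right lie outside the
  interval. What remains are countably many conditions, as measurability requires.\<close>

lemma stay_iff:
  assumes "w \<in> space P"
  shows "stay R s w \<longleftrightarrow> 0 \<le> s \<and> (\<forall>q. 0 \<le> real_of_rat q \<and> real_of_rat q \<le> s \<longrightarrow> norm (x (real_of_rat q) w) \<le> R) \<and> norm (x s w) \<le> R"
proof (intro iffI; (elim conjE)?)
  assume s: "0 \<le> s" and q: "\<forall>q. 0 \<le> real_of_rat q \<and> real_of_rat q \<le> s \<longrightarrow> norm (x (real_of_rat q) w) \<le> R" and xs: "norm (x s w) \<le> R"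
  have "norm (x r w) \<le> R" if r: "0 \<le> r" "r < s" for r
  proof -
    have "\<exists>p\<in>\<rat>. r < p \<and> p < min s (r + 1 / real (Suc n))" for n
      by (rule Rats_dense_in_real) (use r in auto)
    then obtain p where p: "\<And>n. p n \<in> \<rat>" "\<And>n. r < p n" "\<And>n. p n < min s (r + 1 / real (Suc n))" by metis
    have "p \<longlonglongrightarrow> r"
    proof (rule tendsto_sandwich[of "\<lambda>_. r" p sequentially "\<lambda>n. r + 1 / real (Suc n)"])
      show "(\<lambda>n. r + 1 / real (Suc n)) \<longlonglongrightarrow> r"
        using tendsto_add[OF tendsto_const[of r] LIMSEQ_inverse_real_of_nat] by (simp add: inverse_eq_divide)
    qed (use p in \<open>auto intro!: always_eventually less_imp_le\<close>)
    then have "(\<lambda>n. norm (x (p n) w)) \<longlonglongrightarrow> norm (x r w)"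
      by (intro tendsto_norm x_right_continuous[OF assms r(1)] p)
    moreover have "norm (x (p n) w) \<le> R" for n
    proof -
      obtain q' where q': "p n = real_of_rat q'" using p(1)[of n] by (auto elim: Rats_cases)
      have "0 \<le> real_of_rat q'" "real_of_rat q' \<le> s" using q' p(2,3)[of n] r(1) by linarith+
      then show ?thesis using q q' by simp
    qed
    ultimately show ?thesis by (intro LIMSEQ_le_const2) auto
  qed
  then show "stay R s w" using s xs unfolding stay_def by (metis atLeastAtMost_iff order_le_less)
qed (auto simp: stay_def)

lemma stay_measurable_F:
  assumes "0 \<le> s"
  shows "{w\<in>space P. stay R s w} \<in> sets (F s)"
proof -
  have c: "{w\<in>space P. norm (x r w) \<le> R} \<in> sets (F s)" if "0 \<le> r" "r \<le> s" for r
  proof -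
    have "x r \<in> borel_measurable (F s)" by (rule measurable_F_mono[OF that x_measurable_F[OF that(1)]])
    then have "{w\<in>space (F s). norm (x r w) \<le> R} \<in> sets (F s)" by measurable
    then show ?thesis using space_F[OF assms] by simp
  qed
  have eq: "{w\<in>space P. stay R s w} = {w\<in>space (F s). \<forall>q. 0 \<le> real_of_rat q \<and> real_of_rat q \<le> s \<longrightarrow> norm (x (real_of_rat q) w) \<le> R} \<inter> {w\<in>space P. norm (x s w) \<le> R}"
    using assms by (auto simp: stay_iff space_F[OF assms])
  have "{w\<in>space (F s). \<forall>q. 0 \<le> real_of_rat q \<and> real_of_rat q \<le> s \<longrightarrow> norm (x (real_of_rat q) w) \<le> R} \<in> sets (F s)"
  proof (rule sets.sets_Collect_countable_All)
    fix q
    show "{w\<in>space (F s). 0 \<le> real_of_rat q \<and> real_of_rat q \<le> s \<longrightarrow> norm (x (real_of_rat q) w) \<le> R} \<in> sets (F s)"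
    proof (cases "0 \<le> real_of_rat q \<and> real_of_rat q \<le> s")
      case True
      then show ?thesis using c[of "real_of_rat q"] space_F[OF assms] by simp
    next
      case False
      then have "{w\<in>space (F s). 0 \<le> real_of_rat q \<and> real_of_rat q \<le> s \<longrightarrow> norm (x (real_of_rat q) w) \<le> R} = space (F s)" by auto
      then show ?thesis by (simp only: sets.top)
    qed
  qed
  then show ?thesis unfolding eq by (rule sets.Int[OF _ c[OF assms order_refl]])
qed

lemma killed_measurable_F:
  assumes "0 \<le> s"
  shows "killed R s \<in> borel_measurable (F s)"
proof -
  have "{w\<in>space (F s). stay R s w} \<in> sets (F s)" using stay_measurable_F[OF assms] space_F[OF assms] by simp
  then show ?thesis unfolding killed_def
    using x_measurable_F[OF assms] by (intro measurable_If) auto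
qed

lemma killed_measurable: "0 \<le> s \<Longrightarrow> killed R s \<in> borel_measurable P"
  using measurable_F_P[OF _ killed_measurable_F] by simp

text \<open>Times are rounded to a grid of mesh 1 / (n + 1), strictly to the right, so that right
  continuity gives convergence; each rounding takes countably many values. The maximum with 0 keeps
  all sampled times where \<open>x\<close> is measurable.\<close>

lemma x_joint_measurable:
  "(\<lambda>z. if 0 \<le> snd z then x (snd z) (fst z) else 0) \<in> borel_measurable PT"
proof -
  let ?p = "\<lambda>n s. max 0 ((real_of_int \<lfloor>real (Suc n) * s\<rfloor> + 1) / real (Suc n))"
  let ?f = "\<lambda>n z. if 0 \<le> snd z then x (?p n (snd z)) (fst z) else 0"
  show ?thesis
  proof (rule borel_measurable_LIMSEQ_metric[where f = ?f])
  show "?f n \<in> borel_measurable PT" for n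
  proof -
    have pr: "{z \<in> space PT. 0 \<le> snd z} \<in> sets PT" by measurable
    have "(\<lambda>z. x (?p n (snd z)) (fst z)) \<in> borel_measurable PT"
    proof (rule measurable_compose_countable[where f = "\<lambda>i z. x (max 0 ((real_of_int i + 1) / real (Suc n))) (fst z)"
          and g = "\<lambda>z. \<lfloor>real (Suc n) * snd z\<rfloor>"])
      show "(\<lambda>z. x (max 0 ((real_of_int i + 1) / real (Suc n))) (fst z)) \<in> borel_measurable PT" for i
        by (rule measurable_compose[OF measurable_fst x_measurable]) simp
      show "(\<lambda>z. \<lfloor>real (Suc n) * snd z\<rfloor>) \<in> measurable PT (count_space UNIV)" by measurable
    qed
    then show ?thesis by (rule measurable_If[OF _ borel_measurable_const pr])
  qed
  fix z assume "z \<in> space PT"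
  then have wP: "fst z \<in> space P" by (auto simp: space_pair_measure)
  show "(\<lambda>n. ?f n z) \<longlonglongrightarrow> (if 0 \<le> snd z then x (snd z) (fst z) else 0)"
  proof (cases "0 \<le> snd z")
    case True
    define s where "s = snd z"
    have b: "s < ?p n s \<and> ?p n s \<le> s + 1 / real (Suc n)" for n
    proof -
      have "real (Suc n) * s < real_of_int \<lfloor>real (Suc n) * s\<rfloor> + 1" by linarith
      moreover have "real_of_int \<lfloor>real (Suc n) * s\<rfloor> \<le> real (Suc n) * s" by linarith
      ultimately have "s < (real_of_int \<lfloor>real (Suc n) * s\<rfloor> + 1) / real (Suc n)"
        "(real_of_int \<lfloor>real (Suc n) * s\<rfloor> + 1) / real (Suc n) \<le> s + 1 / real (Suc n)"
        by (auto simp: field_simps simp del: of_nat_Suc)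
      then show ?thesis using True by (auto simp: s_def)
    qed
    have "(\<lambda>n. ?p n s) \<longlonglongrightarrow> s"
    proof (rule tendsto_sandwich[of "\<lambda>_. s" _ sequentially "\<lambda>n. s + 1 / real (Suc n)"])
      show "(\<lambda>n. s + 1 / real (Suc n)) \<longlonglongrightarrow> s"
        using tendsto_add[OF tendsto_const[of s] LIMSEQ_inverse_real_of_nat] by (simp add: inverse_eq_divide)
    qed (use b in \<open>auto intro!: always_eventually intro: less_imp_le\<close>)
    then have "(\<lambda>n. x (?p n s) (fst z)) \<longlonglongrightarrow> x s (fst z)"
      using b True wP by (intro x_right_continuous) (auto simp: s_def)
    then show ?thesis using True by (simp add: s_def)
  qed simp
  qed
qed

text \<open>By \<open>stay_iff\<close>, survival is a countable intersection of sets measurable in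
  the pair of outcome and time.\<close>

lemma killed_joint_measurable: "(\<lambda>(w, s). killed R s w) \<in> borel_measurable PT"
proof -
  let ?x = "\<lambda>z. if 0 \<le> snd z then x (snd z) (fst z) else 0"
  let ?S = "{z \<in> space PT. \<forall>q. 0 \<le> real_of_rat q \<and> real_of_rat q \<le> snd z \<longrightarrow> norm (x (real_of_rat q) (fst z)) \<le> R}"
  have S: "?S \<in> sets PT"
  proof (rule sets.sets_Collect_countable_All)
    fix q :: rat
    show "{z \<in> space PT. 0 \<le> real_of_rat q \<and> real_of_rat q \<le> snd z \<longrightarrow> norm (x (real_of_rat q) (fst z)) \<le> R} \<in> sets PT"
    proof (cases "0 \<le> real_of_rat q")
      case True
      have "(\<lambda>z. x (real_of_rat q) (fst z)) \<in> borel_measurable PT"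
        by (rule measurable_compose[OF measurable_fst x_measurable[OF True]])
      then have "{z \<in> space PT. real_of_rat q \<le> snd z \<longrightarrow> norm (x (real_of_rat q) (fst z)) \<le> R} \<in> sets PT"
        by measurable
      then show ?thesis using True by simp
    next
      case False
      then have "{z \<in> space PT. 0 \<le> real_of_rat q \<and> real_of_rat q \<le> snd z \<longrightarrow> norm (x (real_of_rat q) (fst z)) \<le> R}
          = space PT" by simp
      then show ?thesis by (simp only: sets.top)
    qed
  qed
  have S2: "{z \<in> space PT. 0 \<le> snd z \<and> norm (?x z) \<le> R} \<in> sets PT"
    using x_joint_measurable by measurable
  have SS: "?S \<inter> {z \<in> space PT. 0 \<le> snd z \<and> norm (?x z) \<le> R} \<inter> space PT \<in> sets PT"
    by (rule sets.Int[OF sets.Int[OF S S2] sets.top])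
  have "(\<lambda>z. if z \<in> ?S \<inter> {z \<in> space PT. 0 \<le> snd z \<and> norm (?x z) \<le> R} then ?x z else 0)
      \<in> borel_measurable PT"
    by (rule measurable_If_set[OF x_joint_measurable borel_measurable_const SS])
  then show ?thesis
  proof (rule measurable_cong[THEN iffD1, rotated])
    fix z assume z: "z \<in> space PT"
    then have "fst z \<in> space P" by (auto simp: space_pair_measure)
    then show "(if z \<in> ?S \<inter> {z \<in> space PT. 0 \<le> snd z \<and> norm (?x z) \<le> R} then ?x z else 0)
        = (case z of (w, s) \<Rightarrow> killed R s w)"
      using z by (auto simp: killed_def stay_iff split: prod.splits)
  qed
qed

section \<open>Sampling the killed solution on a grid\<close>

definition grid :: "nat \<Rightarrow> nat \<Rightarrow> real" where
  "grid n j = real j * T / real (Suc n)"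

text \<open>Each cell carries the value at its left end, which is what makes the sampled process
  predictable.\<close>

definition approx :: "real \<Rightarrow> nat \<Rightarrow> real \<Rightarrow> 'a \<Rightarrow> real^'n" where
  "approx R n = simple_process (Suc n) (grid n) (\<lambda>j. killed R (grid n j))"

lemma grid_simps: "grid n 0 = 0" "grid n (Suc n) = T" "0 \<le> grid n j" "grid n j \<le> grid n (Suc j)"
  using T by (auto simp: grid_def field_simps)

lemma grid_simple_integrand:
  assumes "0 \<le> R"
  shows "simple_integrand P F (Suc n) (grid n) (\<lambda>j w. B *v killed R (grid n j) w)"
proof -
  obtain c where c: "\<And>y. norm (B *v y) \<le> norm y * c" "c > 0"
    using bounded_linear.pos_bounded[OF matrix_vector_mul_bounded_linear[of B]] by blast
  have "norm (B *v killed R s w) \<le> R * c" for s w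
    using c(1)[of "killed R s w"] norm_killed[OF assms, of s w] c(2)
    by (meson mult_right_mono less_imp_le order_trans)
  moreover have "(\<lambda>w. B *v killed R s w) \<in> borel_measurable (F s)" if "0 \<le> s" for s
    by (rule borel_measurable_continuous_on[OF _ killed_measurable_F[OF that]])
      (intro linear_continuous_on matrix_vector_mul_bounded_linear)
  ultimately show ?thesis unfolding simple_integrand_def using grid_simps by blast
qed

lemma grid_cell:
  assumes "0 < s" "s \<le> T"
  obtains j where "j < Suc n" "grid n j < s" "s \<le> grid n (Suc j)"
proof -
  \<comment> \<open>Cells are closed on the right, hence the ceiling minus one: a positive grid
    point belongs to the cell that ends there.\<close>
  define j where "j = nat (\<lceil>s * real (Suc n) / T\<rceil> - 1)"
  have pos: "0 < s * real (Suc n) / T" using assms T by simp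
  then have c: "1 \<le> \<lceil>s * real (Suc n) / T\<rceil>" by linarith
  then have j: "real j = real_of_int \<lceil>s * real (Suc n) / T\<rceil> - 1" by (simp add: j_def)
  have le: "real j < s * real (Suc n) / T" "s * real (Suc n) / T \<le> real j + 1" unfolding j by linarith+
  have "s * real (Suc n) / T \<le> real (Suc n)" using assms T mult_right_mono[of s T "real (Suc n)"] by (simp add: divide_le_eq mult.commute del: of_nat_Suc)
  then have "real j < real (Suc n)" using le(1) by linarith
  then have "j < Suc n" by simp
  moreover have "grid n j < s" using le(1) T by (simp add: grid_def field_simps del: of_nat_Suc)
  moreover have "s \<le> grid n (Suc j)" using le(2) T by (simp add: grid_def field_simps)
  ultimately show ?thesis by (rule that)
qed

lemma approx_eq:
  assumes "j < Suc n" "grid n j < s" "s \<le> grid n (Suc j)"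
  shows "approx R n s w = killed R (grid n j) w"
  unfolding approx_def using assms by (intro simple_process_eq grid_simps)

lemma approx_cell:
  assumes "0 < s" "s \<le> T"
  obtains r where "0 \<le> r" "r < s" "s \<le> r + T / real (Suc n)" "\<And>R w. approx R n s w = killed R r w"
proof -
  obtain j where j: "j < Suc n" "grid n j < s" "s \<le> grid n (Suc j)" using grid_cell[OF assms] .
  have "grid n (Suc j) = grid n j + T / real (Suc n)"
    unfolding grid_def by (simp add: add_divide_distrib[symmetric] distrib_right del: of_nat_Suc) (simp add: algebra_simps)
  then show ?thesis using that[of "grid n j"] j grid_simps approx_eq[OF j] by auto
qed

lemma norm_approx: "0 \<le> R \<Longrightarrow> s \<in> {0<..T} \<Longrightarrow> norm (approx R n s w) \<le> R"
  using approx_cell[of s n] norm_killed by (metis greaterThanAtMost_iff)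

lemma approx_joint_measurable: "(\<lambda>(w, s). approx R n s w) \<in> borel_measurable PT"
  unfolding approx_def by (intro simple_process_joint_measurable killed_measurable grid_simps)

lemma simple_process_matrix:
  fixes B :: "real^'n^'n"
  shows "simple_process k \<tau> (\<lambda>j w. B *v \<xi> j w) s w = B *v simple_process k \<tau> \<xi> s w"
proof -
  interpret B: bounded_linear "(*v) B" by (rule matrix_vector_mul_bounded_linear)
  show ?thesis unfolding simple_process_def by (simp add: B.sum B.scaleR)
qed

text \<open>The exceptional times are the countably many jumps and the one time at which survival
  first fails after holding at all earlier times. At any other time either the path is alive and
  continuous, or it has been dead since an earlier time, so that all late samples vanish.\<close>

lemma AE_approx_tendsto:
  assumes wP: "w \<in> space P"
  shows "AE s in lborel. s \<in> {0<..T} \<longrightarrow> left_lim x s w = x s w \<and> (\<lambda>n. approx R n s w) \<longlonglongrightarrow> killed R s w"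
proof -
  let ?D = "{s. 0 < s \<and> \<not> isCont (\<lambda>t. x t w) s}"
  let ?E = "{s. 0 \<le> s \<and> \<not> stay R s w \<and> (\<forall>r. 0 \<le> r \<and> r < s \<longrightarrow> stay R r w)}"
  have "countable ?D" by (rule cadlag_countable_discontinuities[OF x_cadlag[OF wP]])
  moreover have "\<exists>e. ?E \<subseteq> {e}"
  proof (cases "?E = {}")
    case False
    then obtain e where e: "e \<in> ?E" by auto
    \<comment> \<open>Of two such times the smaller one would have to be alive because of the larger
      one.\<close>
    have "s = e" if "s \<in> ?E" for s using e that by (cases s e rule: linorder_cases) auto
    then show ?thesis by blast
  next
    case True
    show ?thesis unfolding True by simp
  qed
  then have "countable ?E" by (meson countable_empty countable_insert countable_subset)
  ultimately have "countable (?D \<union> ?E)" by simp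
  then have "AE s in lborel. s \<notin> ?D \<union> ?E" by (intro AE_not_in countable_imp_null_set_lborel)
  then show ?thesis
  proof (rule eventually_mono, intro impI)
    fix s assume s: "s \<notin> ?D \<union> ?E" "s \<in> {0<..T}"
    then have s0: "0 < s" "s \<le> T" and cont: "isCont (\<lambda>t. x t w) s" by auto
    have "((\<lambda>t. x t w) \<longlongrightarrow> x s w) (at_left s)"
      using cont unfolding isCont_def by (rule filterlim_mono) (auto intro: at_le)
    then have l: "left_lim x s w = x s w" unfolding left_lim_def by (intro tendsto_Lim) auto
    have "\<exists>r. 0 \<le> r \<and> r < s \<and> s \<le> r + T / real (Suc n) \<and> approx R n s w = killed R r w" for n
      using approx_cell[OF s0, of n] by metis
    then obtain r where r: "\<And>n. 0 \<le> r n" "\<And>n. r n < s" "\<And>n. s \<le> r n + T / real (Suc n)"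
      "\<And>n. approx R n s w = killed R (r n) w" by metis
    have lim: "r \<longlonglongrightarrow> s"
    proof (rule tendsto_sandwich[of "\<lambda>n. s - T * (1 / real (Suc n))" r sequentially "\<lambda>_. s"])
      show "(\<lambda>n. s - T * (1 / real (Suc n))) \<longlonglongrightarrow> s"
        using tendsto_diff[OF tendsto_const[of s] tendsto_mult[OF tendsto_const[of T] LIMSEQ_inverse_real_of_nat]]
        by (simp add: inverse_eq_divide)
      show "\<forall>\<^sub>F n in sequentially. s - T * (1 / real (Suc n)) \<le> r n" using r(3) by (auto simp: algebra_simps)
    qed (use r(2) in \<open>auto intro!: always_eventually intro: less_imp_le\<close>)
    have "(\<lambda>n. killed R (r n) w) \<longlonglongrightarrow> killed R s w"
    proof (cases "stay R s w")
      case True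
      then have "killed R (r n) w = x (r n) w" for n
        using stay_antimono[OF True r(1)[of n]] r(2)[of n] by (auto simp: killed_def)
      moreover have "(\<lambda>n. x (r n) w) \<longlonglongrightarrow> x s w" by (rule isCont_tendsto_compose[OF cont lim])
      ultimately show ?thesis using True by (simp add: killed_def)
    next
      case False
      then obtain e where e: "0 \<le> e" "e < s" "\<not> stay R e w" using s s0 by auto
      have "eventually (\<lambda>n. e < r n) sequentially" using order_tendstoD(1)[OF lim e(2)] .
      then have "eventually (\<lambda>n. killed R (r n) w = 0) sequentially"
        by (rule eventually_mono) (use e stay_antimono in \<open>auto simp: killed_def dest: less_imp_le\<close>)
      then show ?thesis using False by (simp add: killed_def tendsto_eventually)
    qed
    then show "left_lim x s w = x s w \<and> (\<lambda>n. approx R n s w) \<longlonglongrightarrow> killed R s w" using l r(4) by simp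
  qed
qed

end

section \<open>Convergence of the sampled process and of its stochastic integrals\<close>

context square_integrable_levy
begin

lemma bounded_time_integral:
  fixes f :: "'a \<Rightarrow> real \<Rightarrow> real"
  assumes m: "(\<lambda>(w, s). f w s) \<in> borel_measurable PT" and t: "0 \<le> t"
    and bd: "\<forall>w\<in>space P. \<forall>s\<in>{0<..t}. \<bar>f w s\<bar> \<le> c"
  shows "(\<lambda>w. LINT s:{0<..t}|lborel. f w s) \<in> borel_measurable P"
    and "\<And>w. w \<in> space P \<Longrightarrow> set_integrable lborel {0<..t} (f w)"
    and "\<And>w. w \<in> space P \<Longrightarrow> \<bar>LINT s:{0<..t}|lborel. f w s\<bar> \<le> t * c"
    and "integrable P (\<lambda>w. LINT s:{0<..t}|lborel. f w s)"
proof -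
  have "(\<lambda>z. indicator {0<..t} (snd z) *\<^sub>R (\<lambda>(w, s). f w s) z) \<in> borel_measurable PT"
    by (rule borel_measurable_scaleR[OF _ m]) measurable
  then have "case_prod (\<lambda>w s. indicator {0<..t} s *\<^sub>R f w s) \<in> borel_measurable PT"
    by (simp add: case_prod_unfold)
  then show mI: "(\<lambda>w. LINT s:{0<..t}|lborel. f w s) \<in> borel_measurable P"
    unfolding set_lebesgue_integral_def by (rule lborel.borel_measurable_lebesgue_integral)
  have i1: "set_integrable lborel {0<..t} (\<lambda>_. c)"
    unfolding set_integrable_def using t by (intro integrable_scaleR_left) (auto intro!: integrable_real_indicator)
  show si: "set_integrable lborel {0<..t} (f w)" if wP: "w \<in> space P" for w
    using i1 unfolding set_integrable_def
  proof (rule Bochner_Integration.integrable_bound)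
    have "(\<lambda>s. f w s) \<in> borel_measurable lborel"
      using measurable_compose[OF measurable_Pair1'[OF wP] m] by simp
    then show "(\<lambda>s. indicator {0<..t} s *\<^sub>R f w s) \<in> borel_measurable lborel" by measurable
    show "AE s in lborel. norm (indicator {0<..t} s *\<^sub>R f w s) \<le> norm (indicator {0<..t} s *\<^sub>R c)"
      using bd[rule_format, OF wP] by (intro AE_I2) (auto simp: indicator_def intro: order_trans[OF _ abs_ge_self])
  qed
  show ab: "\<bar>LINT s:{0<..t}|lborel. f w s\<bar> \<le> t * c" if wP: "w \<in> space P" for w
  proof -
    have "norm (LINT s:{0<..t}|lborel. f w s) \<le> (LINT s|lborel. norm (indicator {0<..t} s *\<^sub>R f w s))"
      unfolding set_lebesgue_integral_def by (rule integral_norm_bound)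
    also have "\<dots> \<le> (LINT s|lborel. indicator {0<..t} s *\<^sub>R c)"
    proof (rule integral_mono)
      show "integrable lborel (\<lambda>s. norm (indicator {0<..t} s *\<^sub>R f w s))"
        using si[OF wP] unfolding set_integrable_def by (rule integrable_norm)
      show "integrable lborel (\<lambda>s. indicator {0<..t} s *\<^sub>R c)" using i1 by (simp add: set_integrable_def)
      show "norm (indicator {0<..t} s *\<^sub>R f w s) \<le> indicator {0<..t} s *\<^sub>R c" for s
        using bd[rule_format, OF wP, of s] by (auto simp: indicator_def)
    qed
    also have "\<dots> = t * c" using t by simp
    finally show ?thesis by simp
  qed
  show "integrable P (\<lambda>w. LINT s:{0<..t}|lborel. f w s)"
    by (rule integrable_const_bound[where B = "t * c"]) (use ab mI in auto)
qed

end

lemma continuous_bounded_on_balls: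
  fixes \<phi> :: "'b::euclidean_space \<times> 'b \<Rightarrow> real"
  assumes "continuous_on UNIV \<phi>"
  obtains c where "0 \<le> c" "\<And>y z. norm y \<le> R \<Longrightarrow> norm z \<le> R \<Longrightarrow> \<bar>\<phi> (y, z)\<bar> \<le> c"
proof -
  have "compact (\<phi> ` (cball 0 R \<times> cball 0 R))"
    by (intro compact_continuous_image compact_Times compact_cball continuous_on_subset[OF assms]) auto
  then obtain c where c: "\<And>v. v \<in> \<phi> ` (cball 0 R \<times> cball 0 R) \<Longrightarrow> norm v \<le> c"
    using compact_imp_bounded bounded_iff by metis
  have "\<bar>\<phi> (y, z)\<bar> \<le> max 0 c" if "norm y \<le> R" "norm z \<le> R" for y z
    using c[of "\<phi> (y, z)"] that by (auto simp: max.coboundedI2)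
  then show ?thesis using that[of "max 0 c"] by simp
qed

context bilinear_system
begin

lemma approx_killed_joint_measurable:
  fixes \<phi> :: "(real^'n) \<times> (real^'n) \<Rightarrow> real"
  assumes "continuous_on UNIV \<phi>"
  shows "(\<lambda>(w, s). \<phi> (approx R n s w, killed R s w)) \<in> borel_measurable PT"
    and "(\<lambda>(w, s). \<phi> (killed R s w, killed R s w)) \<in> borel_measurable PT"
proof -
  have \<phi>: "\<phi> \<in> borel_measurable borel" by (rule borel_measurable_continuous_onI[OF assms])
  have "(\<lambda>z. \<phi> ((\<lambda>(w, s). approx R n s w) z, (\<lambda>(w, s). killed R s w) z)) \<in> borel_measurable PT"
    by (rule measurable_compose[OF borel_measurable_Pair[OF approx_joint_measurable killed_joint_measurable] \<phi>])
  then show "(\<lambda>(w, s). \<phi> (approx R n s w, killed R s w)) \<in> borel_measurable PT"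
    by (simp add: case_prod_unfold)
  have "(\<lambda>z. \<phi> ((\<lambda>(w, s). killed R s w) z, (\<lambda>(w, s). killed R s w) z)) \<in> borel_measurable PT"
    by (rule measurable_compose[OF borel_measurable_Pair[OF killed_joint_measurable killed_joint_measurable] \<phi>])
  then show "(\<lambda>(w, s). \<phi> (killed R s w, killed R s w)) \<in> borel_measurable PT"
    by (simp add: case_prod_unfold)
qed

text \<open>Functions of the pair serve two purposes: the squared error of the sampled integrand
  and, ignoring the second entry, the diffusion term. Everything is bounded by a constant, so
  dominated convergence applies first in time and then in expectation.\<close>

lemma approx_integral_tendsto:
  fixes \<phi> :: "(real^'n) \<times> (real^'n) \<Rightarrow> real"
  assumes \<phi>: "continuous_on UNIV \<phi>" and R: "0 \<le> R" and t: "0 \<le> t" "t \<le> T"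
  shows "(\<lambda>n. LINT w|P. (LINT s:{0<..t}|lborel. \<phi> (approx R n s w, killed R s w)))
    \<longlonglongrightarrow> (LINT w|P. (LINT s:{0<..t}|lborel. \<phi> (killed R s w, killed R s w)))"
proof -
  obtain c where c: "0 \<le> c" "\<And>y z. norm y \<le> R \<Longrightarrow> norm z \<le> R \<Longrightarrow> \<bar>\<phi> (y, z)\<bar> \<le> c"
    using continuous_bounded_on_balls[OF \<phi>, where R = R] by blast
  have b1: "\<forall>w\<in>space P. \<forall>s\<in>{0<..t}. \<bar>\<phi> (approx R n s w, killed R s w)\<bar> \<le> c" for n
    using t by (intro ballI c(2) norm_approx norm_killed R) auto
  have b2: "\<forall>w\<in>space P. \<forall>s\<in>{0<..t}. \<bar>\<phi> (killed R s w, killed R s w)\<bar> \<le> c"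
    by (intro ballI c(2) norm_killed R)
  note B1 = bounded_time_integral[OF approx_killed_joint_measurable(1)[OF \<phi>] t(1) b1]
  note B2 = bounded_time_integral[OF approx_killed_joint_measurable(2)[OF \<phi>] t(1) b2]
  have path: "(\<lambda>n. LINT s:{0<..t}|lborel. \<phi> (approx R n s w, killed R s w))
      \<longlonglongrightarrow> (LINT s:{0<..t}|lborel. \<phi> (killed R s w, killed R s w))" if wP: "w \<in> space P" for w
    unfolding set_lebesgue_integral_def
  proof (rule integral_dominated_convergence[where w = "\<lambda>s. indicator {0<..t} s *\<^sub>R c"])
    show "(\<lambda>s. indicator {0<..t} s *\<^sub>R \<phi> (killed R s w, killed R s w)) \<in> borel_measurable lborel"
      using B2(2)[OF wP] unfolding set_integrable_def by (rule borel_measurable_integrable)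
    show "(\<lambda>s. indicator {0<..t} s *\<^sub>R \<phi> (approx R n s w, killed R s w)) \<in> borel_measurable lborel" for n
      using B1(2)[OF wP] unfolding set_integrable_def by (rule borel_measurable_integrable)
    show "integrable lborel (\<lambda>s. indicator {0<..t} s *\<^sub>R c)"
      using t by (intro integrable_scaleR_left) (auto intro!: integrable_real_indicator)
    show "AE s in lborel. norm (indicator {0<..t} s *\<^sub>R \<phi> (approx R n s w, killed R s w)) \<le> indicator {0<..t} s *\<^sub>R c" for n
      using b1 wP by (intro AE_I2) (auto simp: indicator_def)
    show "AE s in lborel. (\<lambda>n. indicator {0<..t} s *\<^sub>R \<phi> (approx R n s w, killed R s w))
        \<longlonglongrightarrow> indicator {0<..t} s *\<^sub>R \<phi> (killed R s w, killed R s w)"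
      using AE_approx_tendsto[OF wP, of R]
    proof (rule eventually_mono)
      fix s assume s: "s \<in> {0<..T} \<longrightarrow> left_lim x s w = x s w \<and> (\<lambda>n. approx R n s w) \<longlonglongrightarrow> killed R s w"
      show "(\<lambda>n. indicator {0<..t} s *\<^sub>R \<phi> (approx R n s w, killed R s w))
        \<longlonglongrightarrow> indicator {0<..t} s *\<^sub>R \<phi> (killed R s w, killed R s w)"
      proof (cases "s \<in> {0<..t}")
        case True
        then have "(\<lambda>n. approx R n s w) \<longlonglongrightarrow> killed R s w" using s t by auto
        then have "(\<lambda>n. \<phi> (approx R n s w, killed R s w)) \<longlonglongrightarrow> \<phi> (killed R s w, killed R s w)"
          by (intro continuous_on_tendsto_compose[OF \<phi>] tendsto_Pair) auto
        then show ?thesis by (intro tendsto_scaleR) auto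
      qed simp
    qed
  qed
  show ?thesis
  proof (rule integral_dominated_convergence[where w = "\<lambda>_. t * c"])
    show "AE w in P. (\<lambda>n. LINT s:{0<..t}|lborel. \<phi> (approx R n s w, killed R s w))
      \<longlonglongrightarrow> (LINT s:{0<..t}|lborel. \<phi> (killed R s w, killed R s w))" by (intro AE_I2 path)
    show "AE w in P. norm (LINT s:{0<..t}|lborel. \<phi> (approx R n s w, killed R s w)) \<le> t * c" for n
      using B1(3) by (intro AE_I2) simp
  qed (use B1(1) B2(1) in auto)
qed

abbreviation integral_approx :: "real \<Rightarrow> nat \<Rightarrow> 'v \<Rightarrow> real \<Rightarrow> 'a \<Rightarrow> real^'n" where
  "integral_approx R n i \<equiv> integral_M i (Suc n) (grid n) (\<lambda>j w. H i *v killed R (grid n j) w)"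

lemma stay_event: "0 \<le> t \<Longrightarrow> alive R t \<in> events"
  using stay_measurable_F sets_F by blast

text \<open>On paths alive up to \<open>t\<close> the left limit equals the killed solution at
  almost every time, so the integrated squared distance to the sampled integrand is a bounded
  functional of the killed process. Its mean tends to 0, and Markov's inequality gives the condition
  of \<open>stoch_integral_local\<close>.\<close>

lemma integral_approx_tendsto:
  assumes R: "0 \<le> R" and t: "0 \<le> t" "t \<le> T" and e: "0 < e"
  shows "(\<lambda>n. prob {w\<in>alive R t. norm (J i t w - integral_approx R n i t w) > e}) \<longlonglongrightarrow> 0"
proof (rule stoch_integral_local[OF J[OF t(1)] t(1) grid_simple_integrand[OF R] stay_event[OF t(1)] _ e])
  fix e :: real assume e: "e > 0"
  define \<phi> where "\<phi> p = (norm (H i *v (snd p - fst p)))\<^sup>2" for p :: "(real^'n) \<times> (real^'n)"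
  have \<phi>: "continuous_on UNIV \<phi>"
  proof -
    have "continuous_on UNIV (\<lambda>p. H i *v (snd p - fst p))"
      by (rule bounded_linear.continuous_on[OF matrix_vector_mul_bounded_linear]) (intro continuous_intros)
    then show ?thesis unfolding \<phi>_def by (intro continuous_on_power continuous_on_norm)
  qed
  obtain c where c: "0 \<le> c" "\<And>y z. norm y \<le> R \<Longrightarrow> norm z \<le> R \<Longrightarrow> \<bar>\<phi> (y, z)\<bar> \<le> c"
    using continuous_bounded_on_balls[OF \<phi>, where R = R] by blast
  have b1: "\<forall>w\<in>space P. \<forall>s\<in>{0<..t}. \<bar>\<phi> (approx R n s w, killed R s w)\<bar> \<le> c" for n
    using t by (intro ballI c(2) norm_approx norm_killed R) auto
  note B = bounded_time_integral[OF approx_killed_joint_measurable(1)[OF \<phi>] t(1) b1]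
  define v where "v n w = (LINT s:{0<..t}|lborel. \<phi> (approx R n s w, killed R s w))" for n w
  let ?S = "\<lambda>n. simple_process (Suc n) (grid n) (\<lambda>j w. H i *v killed R (grid n j) w)"
  \<comment> \<open>Survival up to \<open>t\<close> is essential here: off this event the integrand
    built from \<open>x\<close> is not controlled, which is why locality of the stochastic integral
    is invoked.\<close>
  have nn: "(\<integral>\<^sup>+s\<in>{0<..t}. ennreal ((norm (H i *v left_lim x s w - ?S n s w))\<^sup>2) \<partial>lborel) = ennreal (v n w)"
    if wP: "w \<in> space P" "stay R t w" for n w
  proof -
    have "(\<integral>\<^sup>+s\<in>{0<..t}. ennreal ((norm (H i *v left_lim x s w - ?S n s w))\<^sup>2) \<partial>lborel)
        = (\<integral>\<^sup>+s\<in>{0<..t}. ennreal (\<phi> (approx R n s w, killed R s w)) \<partial>lborel)"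
    proof (rule nn_integral_cong_AE, rule eventually_mono[OF AE_approx_tendsto[OF wP(1), of R]])
      fix s assume s: "s \<in> {0<..T} \<longrightarrow> left_lim x s w = x s w \<and> (\<lambda>n. approx R n s w) \<longlonglongrightarrow> killed R s w"
      show "ennreal ((norm (H i *v left_lim x s w - ?S n s w))\<^sup>2) * indicator {0<..t} s
          = ennreal (\<phi> (approx R n s w, killed R s w)) * indicator {0<..t} s"
      proof (cases "s \<in> {0<..t}")
        case True
        then have "left_lim x s w = killed R s w"
          using s t stay_antimono[OF wP(2), of s] by (auto simp: killed_def)
        moreover have "?S n s w = H i *v approx R n s w" unfolding approx_def by (rule simple_process_matrix)
        ultimately show ?thesis by (simp add: \<phi>_def matrix_vector_mult_diff_distrib)
      qed simp
    qed
    also have "\<dots> = ennreal (v n w)"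
      unfolding v_def by (rule set_nn_integral_ennreal[OF B(2)[OF wP(1)]]) (simp add: \<phi>_def)
    finally show ?thesis .
  qed
  have v0: "0 \<le> v n w" for n w
    unfolding v_def set_lebesgue_integral_def by (intro Bochner_Integration.integral_nonneg) (simp add: \<phi>_def)
  have lim: "(\<lambda>n. (LINT w|P. v n w) / e) \<longlonglongrightarrow> 0"
  proof -
    have "(\<lambda>n. LINT w|P. v n w) \<longlonglongrightarrow> 0"
      using approx_integral_tendsto[OF \<phi> R t] unfolding v_def
      by (simp add: \<phi>_def set_lebesgue_integral_def matrix_vector_mult_0_right)
    then have "(\<lambda>n. (LINT w|P. v n w) / e) \<longlonglongrightarrow> 0 / e" by (intro tendsto_divide tendsto_const) (use e in auto)
    then show ?thesis by simp
  qed
  show "(\<lambda>n. prob {w\<in>alive R t. (\<integral>\<^sup>+s\<in>{0<..t}.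
        ennreal ((norm (H i *v left_lim x s w - ?S n s w))\<^sup>2) \<partial>lborel) > ennreal e}) \<longlonglongrightarrow> 0"
  proof (rule tendsto_sandwich[OF _ _ tendsto_const lim])
    show "\<forall>\<^sub>F n in sequentially. 0 \<le> prob {w\<in>alive R t. (\<integral>\<^sup>+s\<in>{0<..t}.
        ennreal ((norm (H i *v left_lim x s w - ?S n s w))\<^sup>2) \<partial>lborel) > ennreal e}" by simp
    show "\<forall>\<^sub>F n in sequentially. prob {w\<in>alive R t. (\<integral>\<^sup>+s\<in>{0<..t}.
        ennreal ((norm (H i *v left_lim x s w - ?S n s w))\<^sup>2) \<partial>lborel) > ennreal e} \<le> (LINT w|P. v n w) / e"
    proof (intro always_eventually allI)
      fix n
      have vi: "integrable P (v n)" unfolding v_def by (rule B(4))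
      have "prob {w\<in>alive R t. (\<integral>\<^sup>+s\<in>{0<..t}.
        ennreal ((norm (H i *v left_lim x s w - ?S n s w))\<^sup>2) \<partial>lborel) > ennreal e} \<le> prob {w\<in>space P. v n w \<ge> e}"
      proof (rule finite_measure_mono)
        show "{w\<in>space P. v n w \<ge> e} \<in> events" using borel_measurable_integrable[OF vi] by measurable
        show "{w\<in>alive R t. (\<integral>\<^sup>+s\<in>{0<..t}.
          ennreal ((norm (H i *v left_lim x s w - ?S n s w))\<^sup>2) \<partial>lborel) > ennreal e} \<subseteq> {w\<in>space P. v n w \<ge> e}"
        proof clarify
          fix w assume "w \<in> space P" "stay R t w" "ennreal e < (\<integral>\<^sup>+s\<in>{0<..t}.
            ennreal ((norm (H i *v left_lim x s w - ?S n s w))\<^sup>2) \<partial>lborel)"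
          then have "ennreal e < ennreal (v n w)" by (simp only: nn)
          then show "e \<le> v n w" using e v0[of n w] by (simp add: ennreal_less_iff)
        qed
      qed
      also have "\<dots> \<le> (LINT w|P. v n w) / e"
        by (rule integral_Markov_inequality_measure[OF vi sets.top]) (use v0 e in auto)
      finally show "prob {w\<in>alive R t. (\<integral>\<^sup>+s\<in>{0<..t}.
        ennreal ((norm (H i *v left_lim x s w - ?S n s w))\<^sup>2) \<partial>lborel) > ennreal e} \<le> (LINT w|P. v n w) / e" .
    qed
  qed
qed

section \<open>Drift and noise built from the killed solution\<close>

definition drift :: "real \<Rightarrow> real \<Rightarrow> 'a \<Rightarrow> real^'n" where
  "drift R s w = A *v killed R s w + (\<Sum>k\<in>UNIV. (u s $ k) *\<^sub>R (N k *v killed R s w))"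

lemma matrix_measurable:
  fixes B :: "real^'n^'n"
  shows "f \<in> borel_measurable L \<Longrightarrow> (\<lambda>z. B *v f z) \<in> borel_measurable L"
  by (rule borel_measurable_continuous_on) (intro linear_continuous_on matrix_vector_mul_bounded_linear)

lemma u_component_measurable: "(\<lambda>s. u s $ k) \<in> borel_measurable borel"
  by (rule borel_measurable_continuous_on[OF _ u_measurable]) (intro continuous_intros)

lemma drift_joint_measurable: "(\<lambda>(w, s). drift R s w) \<in> borel_measurable PT"
proof -
  have us: "(\<lambda>z. u (snd z) $ k) \<in> borel_measurable PT" for k
    by (rule measurable_compose[OF _ u_component_measurable]) measurable
  have "(\<lambda>z. A *v (\<lambda>(w, s). killed R s w) z + (\<Sum>k\<in>UNIV. (u (snd z) $ k) *\<^sub>R (N k *v (\<lambda>(w, s). killed R s w) z)))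
      \<in> borel_measurable PT"
    by (intro borel_measurable_add borel_measurable_sum borel_measurable_scaleR us
        matrix_measurable[OF killed_joint_measurable])
  then show ?thesis by (simp add: drift_def case_prod_unfold)
qed

lemma drift_measurable_F: "0 \<le> s \<Longrightarrow> drift R s \<in> borel_measurable (F s)"
  unfolding drift_def
  by (intro borel_measurable_add borel_measurable_sum borel_measurable_scaleR borel_measurable_const
      matrix_measurable[OF killed_measurable_F]) auto

text \<open>The weight 1 + |u|^2 dominates every |u_k| and is integrable over \<open>{0..T}\<close>,
  so the drift has a deterministic integrable bound although the control may be unbounded.\<close>

lemma drift_bound:
  assumes R: "0 \<le> R"
  obtains \<kappa> where "0 \<le> \<kappa>" "\<And>s w. norm (drift R s w) \<le> \<kappa> * (1 + (norm (u s))\<^sup>2)"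
proof -
  have ex: "\<exists>c. 0 \<le> c \<and> (\<forall>y. norm (B *v y) \<le> norm y * c)" for B :: "real^'n^'n"
    using bounded_linear.pos_bounded[OF matrix_vector_mul_bounded_linear[of B]] less_imp_le by blast
  obtain cA where cA: "0 \<le> cA" "\<And>y. norm (A *v y) \<le> norm y * cA" using ex[of A] by blast
  obtain cN where cN: "\<And>k. 0 \<le> cN k" "\<And>k y. norm (N k *v y) \<le> norm y * cN k"
    using ex[of "N _"] by metis
  let ?\<kappa> = "R * cA + (\<Sum>k\<in>UNIV. R * cN k)"
  have "norm (drift R s w) \<le> ?\<kappa> * (1 + (norm (u s))\<^sup>2)" for s w
  proof -
    let ?w = "1 + (norm (u s))\<^sup>2"
    have wP: "1 \<le> ?w" by simp
    have uw: "\<bar>u s $ k\<bar> \<le> ?w" for k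
    proof -
      have "\<bar>u s $ k\<bar> \<le> norm (u s)" by (rule component_le_norm_cart)
      \<comment> \<open>From 2 |u| \<le> |u|^2 + 1.\<close>
      also have "\<dots> \<le> ?w" using sum_squares_bound[of "norm (u s)" 1] norm_ge_zero[of "u s"] unfolding one_power2 by linarith
      finally show ?thesis .
    qed
    have X: "norm (killed R s w) \<le> R" by (rule norm_killed[OF R])
    have "norm (drift R s w) \<le> norm (A *v killed R s w) + (\<Sum>k\<in>UNIV. norm ((u s $ k) *\<^sub>R (N k *v killed R s w)))"
      unfolding drift_def by (intro order_trans[OF norm_triangle_ineq] add_left_mono norm_sum)
    also have "\<dots> \<le> R * cA * ?w + (\<Sum>k\<in>UNIV. ?w * (R * cN k))"
    proof (intro add_mono sum_mono)
      have "norm (A *v killed R s w) \<le> R * cA"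
        using cA(2)[of "killed R s w"] mult_right_mono[OF X cA(1)] by linarith
      also have "\<dots> \<le> R * cA * ?w" using mult_left_mono[OF wP, of "R * cA"] R cA by simp
      finally show "norm (A *v killed R s w) \<le> R * cA * ?w" .
      fix k
      have "norm (N k *v killed R s w) \<le> R * cN k"
        using cN(2)[of k "killed R s w"] mult_right_mono[OF X cN(1)[of k]] by linarith
      then show "norm ((u s $ k) *\<^sub>R (N k *v killed R s w)) \<le> ?w * (R * cN k)"
        using uw[of k] wP by (auto intro!: mult_mono)
    qed
    also have "\<dots> = ?\<kappa> * ?w"
      by (subst distrib_right, subst sum_distrib_right) (simp only: mult.commute)
    finally show ?thesis .
  qed
  moreover have "0 \<le> ?\<kappa>" using R cA cN by (intro add_nonneg_nonneg sum_nonneg mult_nonneg_nonneg) auto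
  ultimately show ?thesis using that by blast
qed

lemma u_weight_integrable:
  assumes "t \<le> T"
  shows "set_integrable lborel {0..t} (\<lambda>s. \<kappa> * (1 + (norm (u s))\<^sup>2))"
proof -
  have "set_integrable lborel {0..T} (\<lambda>s. 1 + (norm (u s))\<^sup>2)"
    using T by (intro set_integral_add u_integrable) (auto simp: set_integrable_def intro!: integrable_real_indicator)
  then have "set_integrable lborel {0..T} (\<lambda>s. \<kappa> * (1 + (norm (u s))\<^sup>2))" by simp
  then show ?thesis by (rule set_integrable_subset) (use assms in auto)
qed

abbreviation noise :: "real \<Rightarrow> nat \<Rightarrow> real \<Rightarrow> 'a \<Rightarrow> real^'n" where
  "noise R n \<equiv> vector_integral (Suc n) (grid n) (\<lambda>i j w. H i *v killed R (grid n j) w)"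

definition solution_approx :: "real \<Rightarrow> nat \<Rightarrow> real \<Rightarrow> 'a \<Rightarrow> real^'n" where
  "solution_approx R n t w = x0 + (LINT r:{0..t}|lborel. drift R r w) + noise R n t w"

text \<open>The rate at which the noise feeds the energy \<open>b\<close>, that is, the Ito
  correction of the quadratic form.\<close>

definition diffusion :: "(real^'n \<Rightarrow> real^'n \<Rightarrow> real) \<Rightarrow> real^'n \<Rightarrow> real" where
  "diffusion b y = (\<Sum>i\<in>UNIV. \<Sum>j\<in>UNIV. K $ i $ j * b (H i *v y) (H j *v y))"

lemma continuous_diffusion:
  assumes "bounded_bilinear b"
  shows "continuous_on UNIV (\<lambda>p. diffusion b (fst p))"
  unfolding diffusion_def
  by (intro continuous_on_sum continuous_on_mult continuous_on_const bounded_bilinear.continuous_on[OF assms]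
      bounded_linear.continuous_on[OF matrix_vector_mul_bounded_linear] continuous_on_fst continuous_on_id)

text \<open>The isometry yields a sum over cells, and the sampled process is constant on cells;
  hence the sum is a time integral exactly and not only in the limit.\<close>

lemma noise_isometry:
  assumes b: "bounded_bilinear b" and R: "0 \<le> R" and t: "0 \<le> t" "t \<le> T"
  shows "(LINT w|P. b (noise R n t w) (noise R n t w)) = (LINT w|P. (LINT s:{0<..t}|lborel. diffusion b (approx R n s w)))"
proof -
  have iq: "integrable P (\<lambda>w. diffusion b (killed R (grid n j) w))" for j
  proof -
    have m: "(\<lambda>w. H i *v killed R (grid n j) w) \<in> borel_measurable P" for i
      by (intro matrix_measurable killed_measurable grid_simps)
    have "\<exists>c. \<forall>w\<in>space P. norm (H i *v killed R (grid n j) w) \<le> c" for i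
    proof -
      obtain c where c: "\<And>y. norm (H i *v y) \<le> norm y * c" "c > 0"
        using bounded_linear.pos_bounded[OF matrix_vector_mul_bounded_linear[of "H i"]] by blast
      have "norm (H i *v killed R (grid n j) w) \<le> R * c" for w
        using c(1)[of "killed R (grid n j) w"] mult_right_mono[OF norm_killed[OF R, of "grid n j" w], of c] c(2) by linarith
      then show ?thesis by blast
    qed
    note i2 = integrable_bounded_norm_square[OF m this]
    show ?thesis unfolding diffusion_def
      by (intro Bochner_Integration.integrable_sum integrable_mult_right integrable_bilinear[OF b m m i2 i2])
  qed
  have "(LINT w|P. b (noise R n t w) (noise R n t w))
      = (\<Sum>j<Suc n. (min t (grid n (Suc j)) - min t (grid n j)) * (LINT w|P. diffusion b (killed R (grid n j) w)))"
    using vector_integral_square(3)[OF grid_simple_integrand[OF R] t(1) b, of n H] by (simp only: diffusion_def)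
  also have "\<dots> = (LINT w|P. (\<Sum>j<Suc n. (min t (grid n (Suc j)) - min t (grid n j)) * diffusion b (killed R (grid n j) w)))"
    by (subst Bochner_Integration.integral_sum) (use iq in auto)
  also have "\<dots> = (LINT w|P. (LINT s:{0<..t}|lborel. diffusion b (approx R n s w)))"
  proof (rule Bochner_Integration.integral_cong[OF refl])
    fix w
    \<comment> \<open>Cells beyond \<open>t\<close> become empty under this truncation.\<close>
    let ?g = "\<lambda>j. min t (grid n j)"
    have "(LINT s:{?g 0<..?g (Suc n)}|lborel. diffusion b (approx R n s w))
        = (\<Sum>j<Suc n. (?g (Suc j) - ?g j) * diffusion b (killed R (grid n j) w))"
    proof (rule step_integral(2))
      show "?g j \<le> ?g (Suc j)" for j using grid_simps(4)[of n j] by auto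
      fix j s assume "j < Suc n" "?g j < s" "s \<le> ?g (Suc j)"
      then show "diffusion b (approx R n s w) = diffusion b (killed R (grid n j) w)"
        using approx_eq[of j n s R w] by auto
    qed
    moreover have "?g 0 = 0" "?g (Suc n) = t" using t grid_simps(1,2)[of n] by auto
    ultimately show "(\<Sum>j<Suc n. (min t (grid n (Suc j)) - min t (grid n j)) * diffusion b (killed R (grid n j) w))
        = (LINT s:{0<..t}|lborel. diffusion b (approx R n s w))" by simp
  qed
  finally show ?thesis .
qed

text \<open>The bound is uniform in \<open>n\<close>, because the sampled process never exceeds
  \<open>R\<close>.\<close>

lemma noise_second_moment:
  assumes R: "0 \<le> R"
  obtains c where "\<And>n t. 0 \<le> t \<Longrightarrow> t \<le> T \<Longrightarrow> (LINT w|P. (norm (noise R n t w))\<^sup>2) \<le> c" "0 \<le> c"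
proof -
  note \<phi> = continuous_diffusion[OF bounded_bilinear_inner]
  obtain c where c: "0 \<le> c" "\<And>y z. norm y \<le> R \<Longrightarrow> norm (z::real^'n) \<le> R \<Longrightarrow> \<bar>diffusion (\<bullet>) (fst (y, z))\<bar> \<le> c"
    using continuous_bounded_on_balls[OF \<phi>, where R = R] by blast
  have "(LINT w|P. (norm (noise R n t w))\<^sup>2) \<le> T * c" if t: "0 \<le> t" "t \<le> T" for n t
  proof -
    have b1: "\<forall>w\<in>space P. \<forall>s\<in>{0<..t}. \<bar>diffusion (\<bullet>) (approx R n s w)\<bar> \<le> c"
    proof (intro ballI)
      fix w s assume "s \<in> {0<..t}"
      then show "\<bar>diffusion (\<bullet>) (approx R n s w)\<bar> \<le> c"
        using c(2)[of "approx R n s w" 0] norm_approx[OF R, of s n w] t R by auto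
    qed
    have m: "(\<lambda>(w, s). diffusion (\<bullet>) (approx R n s w)) \<in> borel_measurable PT"
      using approx_killed_joint_measurable(1)[OF \<phi>, of R n] by simp
    note B = bounded_time_integral[OF m t(1) b1]
    have "(LINT w|P. (norm (noise R n t w))\<^sup>2) = (LINT w|P. noise R n t w \<bullet> noise R n t w)"
      by (simp add: power2_norm_eq_inner)
    also have "\<dots> = (LINT w|P. (LINT s:{0<..t}|lborel. diffusion (\<bullet>) (approx R n s w)))"
      by (rule noise_isometry[OF bounded_bilinear_inner R t])
    also have "\<dots> \<le> (LINT w|P. t * c)"
      using B(4) B(3) by (intro integral_mono) (auto dest: abs_le_D1)
    also have "\<dots> \<le> T * c" using t c(1) by (simp add: prob_space mult_right_mono)
    finally show ?thesis .
  qed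
  then show ?thesis using that[of "T * c"] c(1) T by simp
qed

end

section \<open>Passage to the limit\<close>

lemma power2_norm_add_le: "(norm (y + z))\<^sup>2 \<le> 2 * (norm y)\<^sup>2 + 2 * (norm z)\<^sup>2"
  for y z :: "'b::real_normed_vector"
proof -
  have "(norm (y + z))\<^sup>2 \<le> (norm y + norm z)\<^sup>2" by (intro power_mono norm_triangle_ineq) simp
  also have "\<dots> \<le> 2 * (norm y)\<^sup>2 + 2 * (norm z)\<^sup>2"
    using sum_squares_bound[of "norm y" "norm z"] by (simp add: power2_sum)
  finally show ?thesis .
qed

context bilinear_system
begin

lemma solution_approx_energy:
  assumes b: "bounded_bilinear (b :: real^'n \<Rightarrow> real^'n \<Rightarrow> real)" and sym: "\<And>y z. b y z = b z y"
    and R: "0 \<le> R" and t: "0 \<le> t" "t \<le> T"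
  shows "set_integrable lborel {0..t} (\<lambda>s. LINT w|P. b (drift R s w) (solution_approx R n s w))"
    and "(LINT w|P. b (solution_approx R n t w) (solution_approx R n t w)) = b x0 x0
      + 2 * (LINT s:{0..t}|lborel. (LINT w|P. b (drift R s w) (solution_approx R n s w)))
      + (LINT w|P. (LINT s:{0<..t}|lborel. diffusion b (approx R n s w)))"
proof -
  obtain \<kappa> where \<kappa>: "0 \<le> \<kappa>" "\<And>s w. norm (drift R s w) \<le> \<kappa> * (1 + (norm (u s))\<^sup>2)" using drift_bound[OF R] by blast
  show "set_integrable lborel {0..t} (\<lambda>s. LINT w|P. b (drift R s w) (solution_approx R n s w))"
    unfolding solution_approx_def
    by (rule energy_identity(1)[OF b sym grid_simple_integrand[OF R] t(1) drift_joint_measurable drift_measurable_F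
      u_weight_integrable[OF t(2)] \<kappa>(2)])
  show "(LINT w|P. b (solution_approx R n t w) (solution_approx R n t w)) = b x0 x0
      + 2 * (LINT s:{0..t}|lborel. (LINT w|P. b (drift R s w) (solution_approx R n s w)))
      + (LINT w|P. (LINT s:{0<..t}|lborel. diffusion b (approx R n s w)))"
    unfolding solution_approx_def noise_isometry[OF b R t, symmetric]
    by (rule energy_identity(2)[OF b sym grid_simple_integrand[OF R] t(1) drift_joint_measurable drift_measurable_F
      u_weight_integrable[OF t(2)] \<kappa>(2)])
qed

lemma solution_approx_measurable:
  assumes R: "0 \<le> R" and t: "0 \<le> t" "t \<le> T"
  shows "solution_approx R n t \<in> borel_measurable P"
    and "integrable P (\<lambda>w. (norm (solution_approx R n t w))\<^sup>2)"
proof -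
  obtain \<kappa> where \<kappa>: "0 \<le> \<kappa>" "\<And>s w. norm (drift R s w) \<le> \<kappa> * (1 + (norm (u s))\<^sup>2)" using drift_bound[OF R] by blast
  have tt: "t \<in> {0..t}" using t by simp
  show "solution_approx R n t \<in> borel_measurable P"
    unfolding solution_approx_def
    by (rule energy_identity(4)[OF bounded_bilinear_inner inner_commute grid_simple_integrand[OF R] t(1)
      drift_joint_measurable drift_measurable_F u_weight_integrable[OF t(2)] \<kappa>(2) tt])
  show "integrable P (\<lambda>w. (norm (solution_approx R n t w))\<^sup>2)"
    unfolding solution_approx_def
    by (rule energy_identity(5)[OF bounded_bilinear_inner inner_commute grid_simple_integrand[OF R] t(1)
      drift_joint_measurable drift_measurable_F u_weight_integrable[OF t(2)] \<kappa>(2) tt])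
qed

text \<open>Uniformity in \<open>n\<close> and \<open>t\<close> is the point: it feeds both the
  convergence of means and the dominating function for the time integral.\<close>

lemma solution_approx_second_moment:
  assumes R: "0 \<le> R"
  obtains c where "0 \<le> c"
    "\<And>n t. 0 \<le> t \<Longrightarrow> t \<le> T \<Longrightarrow> (LINT w|P. (norm (solution_approx R n t w))\<^sup>2) \<le> c"
proof -
  obtain \<kappa> where \<kappa>: "0 \<le> \<kappa>" "\<And>s w. norm (drift R s w) \<le> \<kappa> * (1 + (norm (u s))\<^sup>2)" using drift_bound[OF R] by blast
  obtain c where c: "\<And>n t. 0 \<le> t \<Longrightarrow> t \<le> T \<Longrightarrow> (LINT w|P. (norm (noise R n t w))\<^sup>2) \<le> c" "0 \<le> c"
    using noise_second_moment[OF R] by blast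
  let ?d = "LINT r:{0..T}|lborel. \<kappa> * (1 + (norm (u r))\<^sup>2)"
  have D: "norm (LINT r:{0..t}|lborel. drift R r w) \<le> ?d" if "w \<in> space P" "0 \<le> t" "t \<le> T" for t w
    by (rule energy_identity(3)[OF bounded_bilinear_inner inner_commute grid_simple_integrand[OF R] less_imp_le[OF T]
      drift_joint_measurable drift_measurable_F u_weight_integrable[OF order_refl] \<kappa>(2) that(1)]) (use that in auto)
  have "(LINT w|P. (norm (solution_approx R n t w))\<^sup>2) \<le> 2 * (norm x0 + ?d)\<^sup>2 + 2 * c" if t: "0 \<le> t" "t \<le> T" for n t
  proof -
    have i: "integrable P (\<lambda>w. (norm (noise R n t w))\<^sup>2)"
      by (rule vector_integral_square(2)[OF grid_simple_integrand[OF R] t(1)])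
    have "(LINT w|P. (norm (solution_approx R n t w))\<^sup>2) \<le> (LINT w|P. 2 * (norm x0 + ?d)\<^sup>2 + 2 * (norm (noise R n t w))\<^sup>2)"
    proof (rule integral_mono[OF solution_approx_measurable(2)[OF R t]])
      show "integrable P (\<lambda>w. 2 * (norm x0 + ?d)\<^sup>2 + 2 * (norm (noise R n t w))\<^sup>2)" using i by simp
      fix w assume wP: "w \<in> space P"
      have "norm (x0 + (LINT r:{0..t}|lborel. drift R r w)) \<le> norm x0 + ?d"
        using D[OF wP t] norm_triangle_ineq[of x0 "LINT r:{0..t}|lborel. drift R r w"] by linarith
      then have "(norm (x0 + (LINT r:{0..t}|lborel. drift R r w)))\<^sup>2 \<le> (norm x0 + ?d)\<^sup>2" by (intro power_mono) auto
      then show "(norm (solution_approx R n t w))\<^sup>2 \<le> 2 * (norm x0 + ?d)\<^sup>2 + 2 * (norm (noise R n t w))\<^sup>2"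
        unfolding solution_approx_def
        using power2_norm_add_le[of "x0 + (LINT r:{0..t}|lborel. drift R r w)" "noise R n t w"] by linarith
    qed
    also have "\<dots> = 2 * (norm x0 + ?d)\<^sup>2 + 2 * (LINT w|P. (norm (noise R n t w))\<^sup>2)"
      using i by (simp add: prob_space)
    also have "\<dots> \<le> 2 * (norm x0 + ?d)\<^sup>2 + 2 * c" using c(1)[OF t, of n] by simp
    finally show ?thesis .
  qed
  then show ?thesis using that[of "2 * (norm x0 + ?d)\<^sup>2 + 2 * c"] c(2) by simp
qed

text \<open>Killed paths are not counted: after the exit the approximation has lost the drift and
  noise that still move \<open>x\<close>, and no closeness is to be expected.\<close>

definition deviation :: "real \<Rightarrow> nat \<Rightarrow> real \<Rightarrow> 'a \<Rightarrow> real" where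
  "deviation R n t w = (if stay R t w then norm (x t w - solution_approx R n t w) else 0)"

lemma deviation_measurable:
  assumes R: "0 \<le> R" and t: "0 \<le> t" "t \<le> T"
  shows "deviation R n t \<in> borel_measurable P"
    and "integrable P (\<lambda>w. (deviation R n t w)\<^sup>2)"
    and "integrable P (deviation R n t)"
    and "(deviation R n t w)\<^sup>2 \<le> 2 * R\<^sup>2 + 2 * (norm (solution_approx R n t w))\<^sup>2"
proof -
  note Z = solution_approx_measurable[OF R t, of n]
  have "(\<lambda>w. norm (x t w - solution_approx R n t w)) \<in> borel_measurable P"
    using x_measurable[OF t(1)] Z(1) by measurable
  then show m: "deviation R n t \<in> borel_measurable P"
    unfolding deviation_def by (rule measurable_If[OF _ borel_measurable_const stay_event[OF t(1)]])
  show bd: "(deviation R n t w)\<^sup>2 \<le> 2 * R\<^sup>2 + 2 * (norm (solution_approx R n t w))\<^sup>2" for w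
  proof (cases "stay R t w")
    case True
    then have "norm (x t w) \<le> R" using t by (auto simp: stay_def)
    then have "(norm (x t w))\<^sup>2 \<le> R\<^sup>2" by (intro power_mono) auto
    then show ?thesis using True power2_norm_add_le[of "x t w" "- solution_approx R n t w"] by (simp add: deviation_def)
  qed (simp add: deviation_def)
  show i2: "integrable P (\<lambda>w. (deviation R n t w)\<^sup>2)"
  proof (rule Bochner_Integration.integrable_bound)
    show "integrable P (\<lambda>w. 2 * R\<^sup>2 + 2 * (norm (solution_approx R n t w))\<^sup>2)" using Z(2) by simp
    show "(\<lambda>w. (deviation R n t w)\<^sup>2) \<in> borel_measurable P" using m by measurable
    show "AE w in P. norm ((deviation R n t w)\<^sup>2) \<le> norm (2 * R\<^sup>2 + 2 * (norm (solution_approx R n t w))\<^sup>2)"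
      using bd by (intro AE_I2) (auto intro: order_trans[OF _ abs_ge_self])
  qed
  show "integrable P (deviation R n t)" by (rule square_integrable_imp_integrable[OF m i2])
qed

text \<open>As long as the path is alive, its drift is that of the killed solution, so initial
  values and drift integrals cancel.\<close>

lemma deviation_AE:
  assumes t: "0 \<le> t" "t \<le> T"
  shows "AE w in P. deviation R n t w = (if stay R t w then norm (\<Sum>i\<in>UNIV. J i t w - integral_approx R n i t w) else 0)"
proof -
  have "t \<in> {0..T}" using t by simp
  from x_equation[OF this] show ?thesis
  proof (rule eventually_mono)
    fix w assume eq: "x t w = x0 + (LINT s:{0..t}|lborel. A *v x s w + (\<Sum>k\<in>UNIV. (u s $ k) *\<^sub>R (N k *v x s w))) + (\<Sum>i\<in>UNIV. J i t w)"
    show "deviation R n t w = (if stay R t w then norm (\<Sum>i\<in>UNIV. J i t w - integral_approx R n i t w) else 0)"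
    proof (cases "stay R t w")
      case True
      have "(LINT s:{0..t}|lborel. A *v x s w + (\<Sum>k\<in>UNIV. (u s $ k) *\<^sub>R (N k *v x s w))) = (LINT s:{0..t}|lborel. drift R s w)"
      proof (rule set_lebesgue_integral_cong)
        show "\<forall>s. s \<in> {0..t} \<longrightarrow> A *v x s w + (\<Sum>k\<in>UNIV. (u s $ k) *\<^sub>R (N k *v x s w)) = drift R s w"
          using stay_antimono[OF True] by (auto simp: drift_def killed_def)
      qed simp
      then have "x t w - solution_approx R n t w = (\<Sum>i\<in>UNIV. J i t w - integral_approx R n i t w)"
        using eq by (simp add: solution_approx_def vector_integral_def sum_subtractf)
      then show ?thesis using True by (simp add: deviation_def)
    qed (simp add: deviation_def)
  qed
qed

text \<open>Convergence in probability comes from the stochastic integrals, and the uniform second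
  moment bound carries it to the means; on surviving paths \<open>x\<close> contributes at most
  \<open>R\<close>.\<close>

lemma deviation_tendsto:
  assumes R: "0 \<le> R" and t: "0 \<le> t" "t \<le> T"
  shows "(\<lambda>n. LINT w|P. deviation R n t w) \<longlonglongrightarrow> 0"
proof -
  obtain c where c: "0 \<le> c" "\<And>n t. 0 \<le> t \<Longrightarrow> t \<le> T \<Longrightarrow> (LINT w|P. (norm (solution_approx R n t w))\<^sup>2) \<le> c"
    using solution_approx_second_moment[OF R] by blast
  note dm = deviation_measurable[OF R t]
  show ?thesis
  proof (rule expectation_tendsto_0[OF dm(1) _ dm(2)])
    show "0 \<le> deviation R n t w" for n w by (simp add: deviation_def)
    show "(LINT w|P. (deviation R n t w)\<^sup>2) \<le> 2 * R\<^sup>2 + 2 * c" for n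
    proof -
      have "(LINT w|P. (deviation R n t w)\<^sup>2) \<le> (LINT w|P. 2 * R\<^sup>2 + 2 * (norm (solution_approx R n t w))\<^sup>2)"
        using solution_approx_measurable(2)[OF R t] by (intro integral_mono dm) auto
      also have "\<dots> = 2 * R\<^sup>2 + 2 * (LINT w|P. (norm (solution_approx R n t w))\<^sup>2)"
        using solution_approx_measurable(2)[OF R t] by (simp add: prob_space)
      also have "\<dots> \<le> 2 * R\<^sup>2 + 2 * c" using c(2)[OF t, of n] by simp
      finally show ?thesis .
    qed
    fix e :: real assume e: "e > 0"
    \<comment> \<open>The tolerance \<open>e\<close> is shared equally among the components of the
      noise.\<close>
    define V where "V = real CARD('v)"
    have V: "V > 0" by (simp add: V_def)
    let ?A = "\<lambda>n i. {w\<in>alive R t. norm (J i t w - integral_approx R n i t w) > e / V}"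
    have A: "?A n i \<in> events" for n i
    proof -
      have "J i t \<in> borel_measurable P" using J[OF t(1), of i] by (simp add: has_stoch_integral_def)
      moreover have "integral_approx R n i t \<in> borel_measurable P"
        by (rule simple_integral_measurable[OF grid_simple_integrand[OF R] t(1)])
      ultimately have "{w\<in>space P. norm (J i t w - integral_approx R n i t w) > e / V} \<in> events" by measurable
      from sets.Int[OF stay_event[OF t(1), of R] this]
      show ?thesis by (rule back_subst[of "\<lambda>S. S \<in> events"]) auto
    qed
    have le: "prob {w\<in>space P. deviation R n t w > e} \<le> (\<Sum>i\<in>UNIV. prob (?A n i))" for n
    proof -
      have "prob {w\<in>space P. deviation R n t w > e} \<le> prob (\<Union>i\<in>UNIV. ?A n i)"
      proof (rule finite_measure_mono_AE)
        show "(\<Union>i\<in>UNIV. ?A n i) \<in> events" using A by (intro sets.finite_UN) auto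
        show "AE w in P. w \<in> {w\<in>space P. deviation R n t w > e} \<longrightarrow> w \<in> (\<Union>i\<in>UNIV. ?A n i)"
        proof (rule eventually_mono[OF deviation_AE[OF t, of R n]], intro impI)
          fix w assume d: "deviation R n t w = (if stay R t w then norm (\<Sum>i\<in>UNIV. J i t w - integral_approx R n i t w) else 0)"
            and wP: "w \<in> {w\<in>space P. deviation R n t w > e}"
          have st: "stay R t w" using d wP e by (auto split: if_splits)
          show "w \<in> (\<Union>i\<in>UNIV. ?A n i)"
          proof (rule ccontr)
            assume n: "w \<notin> (\<Union>i\<in>UNIV. ?A n i)"
            have "norm (\<Sum>i\<in>UNIV. J i t w - integral_approx R n i t w) \<le> (\<Sum>i\<in>(UNIV::'v set). e / V)"
              by (rule sum_norm_le) (use n wP st in \<open>auto simp: not_less\<close>)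
            also have "\<dots> = e" using V by (simp add: V_def)
            finally show False using d wP st by simp
          qed
        qed
      qed
      also have "\<dots> \<le> (\<Sum>i\<in>UNIV. prob (?A n i))"
        using A by (intro finite_measure_subadditive_finite) auto
      finally show ?thesis .
    qed
    have "(\<lambda>n. \<Sum>i\<in>UNIV. prob (?A n i)) \<longlonglongrightarrow> (\<Sum>i\<in>(UNIV::'v set). 0)"
      using e V by (intro tendsto_sum integral_approx_tendsto[OF R t]) simp
    then have lim: "(\<lambda>n. \<Sum>i\<in>UNIV. prob (?A n i)) \<longlonglongrightarrow> 0" by simp
    show "(\<lambda>n. prob {w\<in>space P. deviation R n t w > e}) \<longlonglongrightarrow> 0"
      by (rule tendsto_sandwich[OF _ _ tendsto_const lim]) (use le in auto)
  qed
qed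

lemma killed_square_integrable:
  assumes R: "0 \<le> R" and t: "0 \<le> t"
  shows "integrable P (\<lambda>w. (norm (killed R t w))\<^sup>2)"
  by (rule integrable_bounded_norm_square[OF killed_measurable[OF t]]) (use norm_killed[OF R] in blast)

lemma drift_killed_fubini:
  assumes b: "bounded_bilinear (b :: real^'n \<Rightarrow> real^'n \<Rightarrow> real)" and R: "0 \<le> R" and t: "t \<le> T"
  shows "set_integrable lborel {0..t} (\<lambda>s. LINT w|P. b (drift R s w) (killed R s w))"
proof -
  obtain \<kappa> where \<kappa>: "0 \<le> \<kappa>" "\<And>s w. norm (drift R s w) \<le> \<kappa> * (1 + (norm (u s))\<^sup>2)" using drift_bound[OF R] by blast
  obtain B where B: "0 < B" "\<And>y z. norm (b y z) \<le> norm y * norm z * B" using bounded_bilinear.pos_bounded[OF b] by blast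
  have "(\<lambda>z. b ((\<lambda>(w, s). drift R s w) z) ((\<lambda>(w, s). killed R s w) z)) \<in> borel_measurable PT"
    by (rule borel_measurable_bilinear[OF b drift_joint_measurable killed_joint_measurable])
  then have m: "(\<lambda>(w, s). b (drift R s w) (killed R s w)) \<in> borel_measurable PT"
    by (simp add: case_prod_unfold)
  show ?thesis
  proof (rule fubini_dominated(2)[OF m u_weight_integrable[OF t, of \<kappa>], where Y = "\<lambda>_. R * B"])
    fix w s
    have "\<bar>b (drift R s w) (killed R s w)\<bar> \<le> norm (drift R s w) * norm (killed R s w) * B" using B(2) by simp
    also have "\<dots> \<le> \<kappa> * (1 + (norm (u s))\<^sup>2) * R * B"
      using B(1) \<kappa> norm_killed[OF R, of s w] by (intro mult_right_mono mult_mono) auto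
    finally show "\<bar>b (drift R s w) (killed R s w)\<bar> \<le> \<kappa> * (1 + (norm (u s))\<^sup>2) * (R * B)" by (simp add: mult.assoc)
  qed simp
qed

text \<open>The drift vanishes on killed paths, so the error at time \<open>s\<close> is at most a
  multiple of the mean deviation. The multiple depends on the control at time \<open>s\<close> and
  may be unbounded, whence dominated convergence in time.\<close>

lemma drift_solution_approx_tendsto:
  assumes b: "bounded_bilinear (b :: real^'n \<Rightarrow> real^'n \<Rightarrow> real)" and sym: "\<And>y z. b y z = b z y"
    and R: "0 \<le> R" and t: "0 \<le> t" "t \<le> T"
  shows "(\<lambda>n. LINT s:{0..t}|lborel. (LINT w|P. b (drift R s w) (solution_approx R n s w)))
    \<longlonglongrightarrow> (LINT s:{0..t}|lborel. (LINT w|P. b (drift R s w) (killed R s w)))"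
proof -
  interpret b: bounded_bilinear b by (rule b)
  obtain \<kappa> where \<kappa>: "0 \<le> \<kappa>" "\<And>s w. norm (drift R s w) \<le> \<kappa> * (1 + (norm (u s))\<^sup>2)" using drift_bound[OF R] by blast
  obtain B where B: "0 < B" "\<And>y z. norm (b y z) \<le> norm y * norm z * B" using b.pos_bounded by blast
  obtain c where c: "0 \<le> c" "\<And>n t. 0 \<le> t \<Longrightarrow> t \<le> T \<Longrightarrow> (LINT w|P. (norm (solution_approx R n t w))\<^sup>2) \<le> c"
    using solution_approx_second_moment[OF R] by blast
  let ?\<beta> = "\<lambda>s. \<kappa> * (1 + (norm (u s))\<^sup>2)"
  have iZ: "integrable P (\<lambda>w. norm (solution_approx R n s w))" if "s \<in> {0..t}" for n s
    by (rule square_integrable_imp_integrable)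
      (use solution_approx_measurable[OF R, of s n] that t in auto)
  \<comment> \<open>The crude inequality y \<le> 1 + y^2 replaces a Cauchy-Schwarz bound.\<close>
  have EZ: "(LINT w|P. norm (solution_approx R n s w)) \<le> 1 + c" if s: "s \<in> {0..t}" for n s
  proof -
    have st: "0 \<le> s" "s \<le> T" using s t by auto
    have "(LINT w|P. norm (solution_approx R n s w)) \<le> (LINT w|P. 1 + (norm (solution_approx R n s w))\<^sup>2)"
    proof (rule integral_mono[OF iZ[OF s]])
      show "integrable P (\<lambda>w. 1 + (norm (solution_approx R n s w))\<^sup>2)" using solution_approx_measurable(2)[OF R st] by simp
      show "norm (solution_approx R n s w) \<le> 1 + (norm (solution_approx R n s w))\<^sup>2" for w
        using sum_squares_bound[of "norm (solution_approx R n s w)" 1] norm_ge_zero[of "solution_approx R n s w"]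
        unfolding one_power2 by linarith
    qed
    also have "\<dots> \<le> 1 + c" using c(2)[OF st, of n] solution_approx_measurable(2)[OF R st] by (simp add: prob_space)
    finally show ?thesis .
  qed
  have ib: "integrable P (\<lambda>w. b (drift R s w) (Y w))"
    if s: "s \<in> {0..t}" and Y: "Y \<in> borel_measurable P" "integrable P (\<lambda>w. (norm (Y w))\<^sup>2)" for s Y
  proof -
    have s0: "0 \<le> s" using s by simp
    note m = measurable_F_P[OF s0 drift_measurable_F[OF s0]]
    show ?thesis
      by (rule integrable_bilinear[OF b m Y(1) integrable_bounded_norm_square[OF m] Y(2)]) (use \<kappa>(2) in blast)
  qed
  show ?thesis
    unfolding set_lebesgue_integral_def
  proof (rule integral_dominated_convergence[where w = "\<lambda>s. indicator {0..t} s *\<^sub>R (?\<beta> s * (B * (1 + c)))"])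
    show "(\<lambda>s. indicator {0..t} s *\<^sub>R (LINT w|P. b (drift R s w) (killed R s w))) \<in> borel_measurable lborel"
      using drift_killed_fubini[OF b R t(2)] unfolding set_integrable_def by (rule borel_measurable_integrable)
    show "(\<lambda>s. indicator {0..t} s *\<^sub>R (LINT w|P. b (drift R s w) (solution_approx R n s w))) \<in> borel_measurable lborel" for n
      using solution_approx_energy(1)[OF b sym R t, of n] unfolding set_integrable_def by (rule borel_measurable_integrable)
    show "integrable lborel (\<lambda>s. indicator {0..t} s *\<^sub>R (?\<beta> s * (B * (1 + c))))"
      using set_integrable_mult_left[OF u_weight_integrable[OF t(2), of \<kappa>], of "B * (1 + c)"] unfolding set_integrable_def by simp
    show "AE s in lborel. norm (indicator {0..t} s *\<^sub>R (LINT w|P. b (drift R s w) (solution_approx R n s w)))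
        \<le> indicator {0..t} s *\<^sub>R (?\<beta> s * (B * (1 + c)))" for n
    proof (rule AE_I2)
      fix s
      show "norm (indicator {0..t} s *\<^sub>R (LINT w|P. b (drift R s w) (solution_approx R n s w)))
        \<le> indicator {0..t} s *\<^sub>R (?\<beta> s * (B * (1 + c)))"
      proof (cases "s \<in> {0..t}")
        case True
        then have st: "0 \<le> s" "s \<le> T" using t by auto
        have "norm (LINT w|P. b (drift R s w) (solution_approx R n s w)) \<le> (LINT w|P. norm (b (drift R s w) (solution_approx R n s w)))"
          by (rule integral_norm_bound)
        also have "\<dots> \<le> (LINT w|P. ?\<beta> s * B * norm (solution_approx R n s w))"
        proof (rule integral_mono)
          show "integrable P (\<lambda>w. norm (b (drift R s w) (solution_approx R n s w)))"
            by (intro integrable_norm ib[OF True] solution_approx_measurable R st)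
          show "integrable P (\<lambda>w. ?\<beta> s * B * norm (solution_approx R n s w))" using iZ[OF True] by simp
          fix w
          have "norm (b (drift R s w) (solution_approx R n s w)) \<le> norm (drift R s w) * norm (solution_approx R n s w) * B" by (rule B)
          also have "\<dots> \<le> ?\<beta> s * norm (solution_approx R n s w) * B"
            using \<kappa>(2)[of s w] B(1) by (intro mult_right_mono) auto
          finally show "norm (b (drift R s w) (solution_approx R n s w)) \<le> ?\<beta> s * B * norm (solution_approx R n s w)" by (simp add: mult_ac)
        qed
        also have "\<dots> = ?\<beta> s * B * (LINT w|P. norm (solution_approx R n s w))" by simp
        also have "\<dots> \<le> ?\<beta> s * B * (1 + c)" using EZ[OF True, of n] \<kappa>(1) B(1) by (intro mult_left_mono mult_nonneg_nonneg) auto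
        finally show ?thesis using True by (simp add: mult.assoc)
      qed simp
    qed
    show "AE s in lborel. (\<lambda>n. indicator {0..t} s *\<^sub>R (LINT w|P. b (drift R s w) (solution_approx R n s w)))
        \<longlonglongrightarrow> indicator {0..t} s *\<^sub>R (LINT w|P. b (drift R s w) (killed R s w))"
    proof (rule AE_I2)
      fix s
      show "(\<lambda>n. indicator {0..t} s *\<^sub>R (LINT w|P. b (drift R s w) (solution_approx R n s w)))
        \<longlonglongrightarrow> indicator {0..t} s *\<^sub>R (LINT w|P. b (drift R s w) (killed R s w))"
      proof (cases "s \<in> {0..t}")
        case True
        then have st: "0 \<le> s" "s \<le> T" using t by auto
        have ibZ: "integrable P (\<lambda>w. b (drift R s w) (solution_approx R n s w))" for n
          by (intro ib[OF True] solution_approx_measurable R st)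
        have ibX: "integrable P (\<lambda>w. b (drift R s w) (killed R s w))"
          by (intro ib[OF True] killed_measurable killed_square_integrable R st)
        have le: "norm ((LINT w|P. b (drift R s w) (solution_approx R n s w)) - (LINT w|P. b (drift R s w) (killed R s w)))
            \<le> ?\<beta> s * B * (LINT w|P. deviation R n s w)" for n
        proof -
          have eq: "(LINT w|P. b (drift R s w) (solution_approx R n s w)) - (LINT w|P. b (drift R s w) (killed R s w))
              = (LINT w|P. b (drift R s w) (solution_approx R n s w) - b (drift R s w) (killed R s w))"
            using ibZ ibX by simp
          have "norm ((LINT w|P. b (drift R s w) (solution_approx R n s w)) - (LINT w|P. b (drift R s w) (killed R s w)))
              \<le> (LINT w|P. norm (b (drift R s w) (solution_approx R n s w) - b (drift R s w) (killed R s w)))"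
            unfolding eq by (rule integral_norm_bound)
          also have "\<dots> \<le> (LINT w|P. ?\<beta> s * B * deviation R n s w)"
          proof (rule integral_mono)
            show "integrable P (\<lambda>w. norm (b (drift R s w) (solution_approx R n s w) - b (drift R s w) (killed R s w)))"
              by (rule integrable_norm[OF Bochner_Integration.integrable_diff[OF ibZ ibX]])
            show "integrable P (\<lambda>w. ?\<beta> s * B * deviation R n s w)" using deviation_measurable(3)[OF R st] by simp
            fix w
            show "norm (b (drift R s w) (solution_approx R n s w) - b (drift R s w) (killed R s w)) \<le> ?\<beta> s * B * deviation R n s w"
            proof (cases "stay R s w")
              case True
              have "norm (b (drift R s w) (solution_approx R n s w) - b (drift R s w) (killed R s w))
                  = norm (b (drift R s w) (solution_approx R n s w - x s w))"
                using True by (simp add: b.diff_right killed_def)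
              also have "\<dots> \<le> norm (drift R s w) * norm (solution_approx R n s w - x s w) * B" by (rule B)
              also have "\<dots> \<le> ?\<beta> s * norm (solution_approx R n s w - x s w) * B"
                using \<kappa>(2)[of s w] B(1) by (intro mult_right_mono) auto
              finally show ?thesis using True by (simp add: deviation_def norm_minus_commute mult_ac)
            \<comment> \<open>On a killed path the drift is 0, so both sides vanish.\<close>
            qed (simp add: drift_def killed_def deviation_def b.zero_left)
          qed
          finally show ?thesis by simp
        qed
        have "(\<lambda>n. ?\<beta> s * B * (LINT w|P. deviation R n s w)) \<longlonglongrightarrow> ?\<beta> s * B * 0"
          by (intro tendsto_mult tendsto_const deviation_tendsto[OF R st])
        then have "(\<lambda>n. ?\<beta> s * B * (LINT w|P. deviation R n s w)) \<longlonglongrightarrow> 0" by simp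
        then have "(\<lambda>n. (LINT w|P. b (drift R s w) (solution_approx R n s w)) - (LINT w|P. b (drift R s w) (killed R s w))) \<longlonglongrightarrow> 0"
          by (rule Lim_null_comparison[rotated]) (use le in auto)
        then have "(\<lambda>n. LINT w|P. b (drift R s w) (solution_approx R n s w)) \<longlonglongrightarrow> (LINT w|P. b (drift R s w) (killed R s w))"
          by (rule LIM_zero_cancel)
        then show ?thesis using True by simp
      qed simp
    qed
  qed
qed

text \<open>The Ito formula for \<open>b(x, x)\<close>, with the inequality that convexity of \<open>b(y, y)\<close> leaves when the
  solution is killed at level \<open>R\<close>.\<close>

lemma killed_energy_inequality:
  assumes b: "bounded_bilinear (b :: real^'n \<Rightarrow> real^'n \<Rightarrow> real)" and sym: "\<And>y z. b y z = b z y"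
    and pos: "\<And>y. 0 \<le> b y y"
    and R: "0 \<le> R" and t: "0 \<le> t" "t \<le> T"
  shows "(LINT w|P. b (killed R t w) (killed R t w)) \<le> b x0 x0
      + 2 * (LINT s:{0..t}|lborel. (LINT w|P. b (drift R s w) (killed R s w)))
      + (LINT w|P. (LINT s:{0<..t}|lborel. diffusion b (killed R s w)))"
proof -
  interpret b: bounded_bilinear b by (rule b)
  obtain B where B: "0 < B" "\<And>y z. norm (b y z) \<le> norm y * norm z * B" using b.pos_bounded by blast
  let ?Z = "solution_approx R"
  let ?W = "LINT w|P. b (killed R t w) (killed R t w)"
  let ?E = "\<lambda>n. LINT w|P. b (?Z n t w) (?Z n t w)"
  have iX: "integrable P (\<lambda>w. b (killed R t w) (killed R t w))"
    by (rule integrable_bilinear[OF b killed_measurable[OF t(1)] killed_measurable[OF t(1)]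
          killed_square_integrable[OF R t(1)] killed_square_integrable[OF R t(1)]])
  \<comment> \<open>Dropping b(h, h) for h = Z_n - x leaves an error linear in the deviation: the
    factor 2 comes from expanding the form, \<open>R\<close> bounds \<open>x\<close> on surviving
    paths and \<open>B\<close> bounds the form.\<close>
  have le: "?W - 2 * R * B * (LINT w|P. deviation R n t w) \<le> ?E n" for n
  proof -
    note Zm = solution_approx_measurable[OF R t, of n]
    have "(LINT w|P. b (killed R t w) (killed R t w) - 2 * R * B * deviation R n t w) \<le> ?E n"
    proof (rule integral_mono)
      show "integrable P (\<lambda>w. b (killed R t w) (killed R t w) - 2 * R * B * deviation R n t w)"
        using iX deviation_measurable(3)[OF R t] by simp
      show "integrable P (\<lambda>w. b (?Z n t w) (?Z n t w))" by (rule integrable_bilinear[OF b Zm(1) Zm(1) Zm(2) Zm(2)])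
      fix w
      show "b (killed R t w) (killed R t w) - 2 * R * B * deviation R n t w \<le> b (?Z n t w) (?Z n t w)"
      proof (cases "stay R t w")
        case True
        let ?h = "?Z n t w - x t w"
        have "b (?Z n t w) (?Z n t w) = b (x t w + ?h) (x t w + ?h)" by simp
        also have "\<dots> = b (x t w) (x t w) + 2 * b (x t w) ?h + b ?h ?h"
          unfolding b.add_left b.add_right using sym[of ?h "x t w"] by simp
        finally have eq: "b (?Z n t w) (?Z n t w) = b (x t w) (x t w) + 2 * b (x t w) ?h + b ?h ?h" .
        have "\<bar>b (x t w) ?h\<bar> \<le> norm (x t w) * norm ?h * B" using B(2)[of "x t w" ?h] by simp
        also have "\<dots> \<le> R * norm ?h * B"
          using True t B(1) by (intro mult_right_mono) (auto simp: stay_def)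
        finally have "- (R * B * norm ?h) \<le> b (x t w) ?h" by (simp add: mult_ac)
        then show ?thesis using eq pos[of ?h] True by (simp add: killed_def deviation_def norm_minus_commute)
      next
        case False
        \<comment> \<open>On a killed path the left side is 0, and nonnegativity of the form at Z_n
          is all that is left.\<close>
        then show ?thesis using pos by (simp add: killed_def deviation_def b.zero_left)
      qed
    qed
    then show ?thesis using iX deviation_measurable(3)[OF R t] by simp
  qed
  have l1: "(\<lambda>n. ?W - 2 * R * B * (LINT w|P. deviation R n t w)) \<longlonglongrightarrow> ?W"
    using tendsto_diff[OF tendsto_const tendsto_mult[OF tendsto_const deviation_tendsto[OF R t]], of ?W "2 * R * B"] by simp
  have "?E \<longlonglongrightarrow> b x0 x0 + 2 * (LINT s:{0..t}|lborel. (LINT w|P. b (drift R s w) (killed R s w)))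
      + (LINT w|P. (LINT s:{0<..t}|lborel. diffusion b (killed R s w)))"
    unfolding solution_approx_energy(2)[OF b sym R t]
    using approx_integral_tendsto[OF continuous_diffusion[OF b] R t]
    by (intro tendsto_add tendsto_mult tendsto_const drift_solution_approx_tendsto[OF b sym R t]) simp
  from LIMSEQ_le[OF l1 this] show ?thesis using le by blast
qed

end

section \<open>Gramian and output bound\<close>

lemma sum_matrix_vector_mult: "(\<Sum>k\<in>S. f k) *v y = (\<Sum>k\<in>S. f k *v y)"
  for f :: "'k \<Rightarrow> real^'n^'n"
proof (induction S rule: infinite_finite_induct)
  case (insert k S)
  then show ?case by (simp add: matrix_vector_mult_add_rdistrib)
qed (simp_all add: vec_eq_iff matrix_vector_mult_def)

lemma inner_transpose: "y \<bullet> (transpose B *v wP) = (B *v y) \<bullet> wP"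
  for B :: "real^'n^'p"
  by (subst (1 2) inner_commute) (simp add: dot_lmul_matrix)

lemma inner_congruence: "y \<bullet> ((transpose B ** Q ** B') *v y) = (B *v y) \<bullet> (Q *v (B' *v y))"
  for B B' Q :: "real^'n^'n"
proof -
  have "y \<bullet> ((transpose B ** Q ** B') *v y) = y \<bullet> (transpose B *v (Q *v (B' *v y)))"
    by (simp only: matrix_vector_mul_assoc matrix_mul_assoc)
  also have "\<dots> = (B *v y) \<bullet> (Q *v (B' *v y))"
    by (rule inner_transpose)
  finally show ?thesis .
qed

text \<open>The Gramian equation is tested with \<open>y\<close>; the two terms with
  \<open>A\<close> agree by symmetry of \<open>Q\<close>.\<close>

lemma gramian_quadratic_form:
  fixes A Q :: "real^'n^'n" and C :: "real^'n^'p"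
  assumes "is_observability_gramian A N H C K Q"
  shows "2 * ((A *v y) \<bullet> (Q *v y)) + (\<Sum>k\<in>UNIV. (N k *v y) \<bullet> (Q *v (N k *v y)))
    + (\<Sum>i\<in>UNIV. \<Sum>j\<in>UNIV. K $ i $ j * ((H i *v y) \<bullet> (Q *v (H j *v y)))) = - (norm (C *v y))\<^sup>2"
proof -
  have Q: "transpose Q = Q" and eq: "transpose A ** Q + Q ** A + (\<Sum>k\<in>UNIV. transpose (N k) ** Q ** N k)
     + (\<Sum>i\<in>UNIV. \<Sum>j\<in>UNIV. (K $ i $ j) *\<^sub>R (transpose (H i) ** Q ** H j)) = - (transpose C ** C)"
    using assms by (auto simp: is_observability_gramian_def)
  have t1: "y \<bullet> ((transpose A ** Q) *v y) = (A *v y) \<bullet> (Q *v y)"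
    using inner_congruence[of y A Q "mat 1"] by simp
  have t2: "y \<bullet> ((Q ** A) *v y) = (A *v y) \<bullet> (Q *v y)"
  proof -
    have "y \<bullet> ((Q ** A) *v y) = y \<bullet> (transpose Q *v (A *v y))" unfolding Q by (simp only: matrix_vector_mul_assoc)
    also have "\<dots> = (A *v y) \<bullet> (Q *v y)" unfolding inner_transpose by (rule inner_commute)
    finally show ?thesis .
  qed
  have tc: "y \<bullet> (- (transpose C ** C) *v y) = - (norm (C *v y))\<^sup>2"
  proof -
    have "y \<bullet> (- (transpose C ** C) *v y) = - (y \<bullet> (transpose C *v (C *v y)))"
    proof -
      have "- B *v y = - (B *v y)" for B :: "real^'n^'n" by (simp add: vec_eq_iff matrix_vector_mult_def sum_negf)
      then show ?thesis by (simp only: matrix_vector_mul_assoc inner_minus_right)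
    qed
    also have "y \<bullet> (transpose C *v (C *v y)) = (C *v y) \<bullet> (C *v y)"
      by (rule inner_transpose)
    finally show ?thesis by (simp add: power2_norm_eq_inner)
  qed
  have "y \<bullet> ((transpose A ** Q + Q ** A + (\<Sum>k\<in>UNIV. transpose (N k) ** Q ** N k)
     + (\<Sum>i\<in>UNIV. \<Sum>j\<in>UNIV. (K $ i $ j) *\<^sub>R (transpose (H i) ** Q ** H j))) *v y)
    = 2 * ((A *v y) \<bullet> (Q *v y)) + (\<Sum>k\<in>UNIV. (N k *v y) \<bullet> (Q *v (N k *v y)))
    + (\<Sum>i\<in>UNIV. \<Sum>j\<in>UNIV. K $ i $ j * ((H i *v y) \<bullet> (Q *v (H j *v y))))"
    unfolding matrix_vector_mult_add_rdistrib sum_matrix_vector_mult scaleR_matrix_vector_assoc[symmetric]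
      inner_add_right inner_sum_right inner_scaleR_right t1 t2 inner_congruence by simp
  then show ?thesis unfolding eq tc by simp
qed

lemma set_integral_Ioc_Icc:
  fixes f :: "real \<Rightarrow> real"
  assumes "f \<in> borel_measurable lborel"
  shows "(LINT s:{a<..b}|lborel. f s) = (LINT s:{a..b}|lborel. f s)"
  unfolding set_lebesgue_integral_def
proof (rule integral_cong_AE)
  show "AE s in lborel. indicator {a<..b} s *\<^sub>R f s = indicator {a..b} s *\<^sub>R f s"
    by (rule eventually_mono[OF AE_lborel_singleton[of a]]) (auto simp: indicator_def)
qed (use assms in measurable)

context bilinear_system
begin

lemma killed_function_fubini:
  fixes \<phi> :: "real^'n \<Rightarrow> real"
  assumes \<phi>: "continuous_on UNIV \<phi>" and R: "0 \<le> R" and t: "0 \<le> t" "t \<le> T"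
  shows "(\<lambda>(w, s). \<phi> (killed R s w)) \<in> borel_measurable PT"
    and "\<And>s. integrable P (\<lambda>w. \<phi> (killed R s w))"
    and "set_integrable lborel {0..t} (\<lambda>s. LINT w|P. \<phi> (killed R s w))"
    and "integrable P (\<lambda>w. LINT s:{0..t}|lborel. \<phi> (killed R s w))"
    and "(LINT w|P. (LINT s:{0..t}|lborel. \<phi> (killed R s w))) = (LINT s:{0..t}|lborel. (LINT w|P. \<phi> (killed R s w)))"
    and "set_integrable lborel {0..t} (\<lambda>s. (norm (u s))\<^sup>2 * (LINT w|P. \<phi> (killed R s w)))"
proof -
  have \<phi>': "continuous_on UNIV (\<lambda>p :: (real^'n) \<times> (real^'n). \<phi> (fst p))"
    by (rule continuous_on_compose2[OF \<phi>]) (auto intro: continuous_intros)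
  show m: "(\<lambda>(w, s). \<phi> (killed R s w)) \<in> borel_measurable PT"
    using approx_killed_joint_measurable(2)[OF \<phi>'] by simp
  obtain c where c: "0 \<le> c" "\<And>y z. norm y \<le> R \<Longrightarrow> norm (z :: real^'n) \<le> R \<Longrightarrow> \<bar>\<phi> (fst (y, z))\<bar> \<le> c"
    using continuous_bounded_on_balls[OF \<phi>', where R = R] by blast
  have bd: "\<bar>\<phi> (killed R s w)\<bar> \<le> c" for s w
    using c(2)[of "killed R s w" "killed R s w"] norm_killed[OF R] by simp
  have cc: "set_integrable lborel {0..t} (\<lambda>_. c)"
    unfolding set_integrable_def using t by (intro integrable_scaleR_left) (auto intro!: integrable_real_indicator)
  have "\<bar>\<phi> (killed R s w)\<bar> \<le> c * 1" for s w using bd[of s w] by simp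
  note fub = fubini_dominated[OF m cc, of "\<lambda>_. 1", OF _ this]
  show "set_integrable lborel {0..t} (\<lambda>s. LINT w|P. \<phi> (killed R s w))"
    "integrable P (\<lambda>w. LINT s:{0..t}|lborel. \<phi> (killed R s w))"
    "(LINT w|P. (LINT s:{0..t}|lborel. \<phi> (killed R s w))) = (LINT s:{0..t}|lborel. (LINT w|P. \<phi> (killed R s w)))"
    using fub by simp_all
  show "integrable P (\<lambda>w. \<phi> (killed R s w))" for s
  proof (rule integrable_const_bound[where B = c])
    show "(\<lambda>w. \<phi> (killed R s w)) \<in> borel_measurable P"
      using measurable_compose[OF measurable_Pair2'[of s] m] by simp
  qed (use bd in auto)
  have "(\<lambda>z. u (snd z)) \<in> borel_measurable PT"
    by (rule measurable_compose[OF measurable_snd]) (use u_measurable in simp)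
  then have um: "(\<lambda>z. (norm (u (snd z)))\<^sup>2) \<in> borel_measurable PT" by measurable
  have "(\<lambda>z. (norm (u (snd z)))\<^sup>2 * (\<lambda>(w, s). \<phi> (killed R s w)) z) \<in> borel_measurable PT"
    by (rule borel_measurable_times[OF um m])
  then have m2: "(\<lambda>(w, s). (norm (u s))\<^sup>2 * \<phi> (killed R s w)) \<in> borel_measurable PT"
    by (simp add: case_prod_unfold)
  have ut: "set_integrable lborel {0..t} (\<lambda>s. (norm (u s))\<^sup>2)"
    by (rule set_integrable_subset[OF u_integrable]) (use t in auto)
  have "\<bar>(norm (u s))\<^sup>2 * \<phi> (killed R s w)\<bar> \<le> (norm (u s))\<^sup>2 * c" for s w
    using bd[of s w] by (simp add: abs_mult mult_left_mono)
  note fub2 = fubini_dominated(2)[OF m2 ut, of "\<lambda>_. c", OF _ this]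
  show "set_integrable lborel {0..t} (\<lambda>s. (norm (u s))\<^sup>2 * (LINT w|P. \<phi> (killed R s w)))"
    using fub2 by simp
qed

lemma killed_output_bound:
  fixes C :: "real^'n^'p" and Q :: "real^'n^'n"
  assumes gram: "is_observability_gramian A N H C K Q" and pos: "\<And>y. 0 \<le> y \<bullet> (Q *v y)" and R: "0 \<le> R"
  shows "(LINT s:{0..T}|lborel. (LINT w|P. (norm (C *v killed R s w))\<^sup>2))
    \<le> (x0 \<bullet> (Q *v x0)) * exp (LINT s:{0..T}|lborel. (norm (u s))\<^sup>2)"
proof -
  define b where "b y z = y \<bullet> (Q *v z)" for y z
  have b: "bounded_bilinear b"
    unfolding b_def using bounded_bilinear.comp[OF bounded_bilinear_inner bounded_linear_ident matrix_vector_mul_bounded_linear[of Q]] .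
  interpret b: bounded_bilinear b by (rule b)
  have "transpose Q = Q" using gram by (simp add: is_observability_gramian_def)
  then have sym: "b y z = b z y" for y z
    using inner_transpose[of y Q z] unfolding b_def by (metis inner_commute)
  have bpos: "0 \<le> b y y" for y using pos by (simp add: b_def)
  let ?v = "b x0 x0"
  define W where "W s = (LINT w|P. b (killed R s w) (killed R s w))" for s
  define c where "c s = (LINT w|P. (norm (C *v killed R s w))\<^sup>2)" for s
  define a where "a s = (norm (u s))\<^sup>2" for s
  have cW: "continuous_on UNIV (\<lambda>y. b y y)" by (intro b.continuous_on continuous_on_id)
  have cC: "continuous_on UNIV (\<lambda>y. (norm (C *v y))\<^sup>2)"
    by (intro continuous_on_power continuous_on_norm linear_continuous_on matrix_vector_mul_bounded_linear)
  have cD: "continuous_on UNIV (\<lambda>y. diffusion b y)"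
    unfolding diffusion_def
    by (intro continuous_on_sum continuous_on_mult continuous_on_const b.continuous_on
        linear_continuous_on matrix_vector_mul_bounded_linear)
  have point: "2 * b (drift R s w) (killed R s w) + diffusion b (killed R s w)
      \<le> a s * b (killed R s w) (killed R s w) - (norm (C *v killed R s w))\<^sup>2" for s w
  proof -
    let ?X = "killed R s w"
    have "b (drift R s w) ?X = b (A *v ?X) ?X + (\<Sum>k\<in>UNIV. (u s $ k) * b (N k *v ?X) ?X)"
      by (simp add: drift_def b.add_left b.sum_left b.scaleR_left)
    then have e1: "2 * b (drift R s w) ?X = 2 * b (A *v ?X) ?X + (\<Sum>k\<in>UNIV. 2 * (u s $ k) * b (N k *v ?X) ?X)"
      by (simp add: sum_distrib_left mult.assoc)
    have e2: "(\<Sum>k\<in>UNIV. 2 * (u s $ k) * b (N k *v ?X) ?X) \<le> (\<Sum>k\<in>UNIV. b (N k *v ?X) (N k *v ?X) + (u s $ k)\<^sup>2 * b ?X ?X)"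
    proof (rule sum_mono)
      fix k
      \<comment> \<open>The form is nonnegative at N_k X - u_k X. The square of N_k X enters with
        coefficient 1, exactly as in the Gramian equation, and this fixes the constant 1 in front of
        |u|^2 in the exponent.\<close>
      have "0 \<le> b (N k *v ?X - (u s $ k) *\<^sub>R ?X) (N k *v ?X - (u s $ k) *\<^sub>R ?X)" by (rule bpos)
      also have "\<dots> = b (N k *v ?X) (N k *v ?X) - 2 * (u s $ k) * b (N k *v ?X) ?X + (u s $ k)\<^sup>2 * b ?X ?X"
        unfolding b.diff_left b.diff_right b.scaleR_left b.scaleR_right
        using sym[of ?X "N k *v ?X"] by (simp add: power2_eq_square algebra_simps)
      finally show "2 * (u s $ k) * b (N k *v ?X) ?X \<le> b (N k *v ?X) (N k *v ?X) + (u s $ k)\<^sup>2 * b ?X ?X" by simp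
    qed
    have e3: "(\<Sum>k\<in>UNIV. b (N k *v ?X) (N k *v ?X) + (u s $ k)\<^sup>2 * b ?X ?X)
        = (\<Sum>k\<in>UNIV. b (N k *v ?X) (N k *v ?X)) + a s * b ?X ?X"
    proof -
      have as: "a s = (\<Sum>k\<in>UNIV. (u s $ k)\<^sup>2)"
      proof -
        have "a s = u s \<bullet> u s" by (simp only: a_def power2_norm_eq_inner)
        then show ?thesis by (simp only: inner_vec_def inner_real_def power2_eq_square)
      qed
      show ?thesis unfolding as sum.distrib sum_distrib_right ..
    qed
    have "2 * b (A *v ?X) ?X + (\<Sum>k\<in>UNIV. b (N k *v ?X) (N k *v ?X)) + diffusion b ?X = - (norm (C *v ?X))\<^sup>2"
      using gramian_quadratic_form[OF gram, of ?X] by (simp only: b_def diffusion_def)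
    then show ?thesis using e1 e2 e3 by linarith
  qed
  have Wt: "W t + (LINT s:{0..t}|lborel. c s) \<le> ?v + (LINT s:{0..t}|lborel. a s * W s)" if t: "0 \<le> t" "t \<le> T" for t
  proof -
    note FW = killed_function_fubini[OF cW R t] and FC = killed_function_fubini[OF cC R t] and FD = killed_function_fubini[OF cD R t]
    let ?e = "\<lambda>s. LINT w|P. diffusion b (killed R s w)" and ?d = "\<lambda>s. LINT w|P. b (drift R s w) (killed R s w)"
    have id: "integrable P (\<lambda>w. b (drift R s w) (killed R s w))" if s: "0 \<le> s" for s
    proof -
      obtain \<kappa> where \<kappa>: "0 \<le> \<kappa>" "\<And>s w. norm (drift R s w) \<le> \<kappa> * (1 + (norm (u s))\<^sup>2)" using drift_bound[OF R] by blast
      note m = measurable_F_P[OF s drift_measurable_F[OF s]]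
      show ?thesis
        by (rule integrable_bilinear[OF b m killed_measurable[OF s] integrable_bounded_norm_square[OF m] killed_square_integrable[OF R s]])
          (use \<kappa>(2) in blast)
    qed
    have le: "2 * ?d s \<le> a s * W s - c s - ?e s" if s: "s \<in> {0..t}" for s
    proof -
      have "2 * ?d s = (LINT w|P. 2 * b (drift R s w) (killed R s w))" by simp
      also have "\<dots> \<le> (LINT w|P. a s * b (killed R s w) (killed R s w) - (norm (C *v killed R s w))\<^sup>2 - diffusion b (killed R s w))"
      proof (rule integral_mono)
        show "integrable P (\<lambda>w. 2 * b (drift R s w) (killed R s w))" using id s by simp
        show "integrable P (\<lambda>w. a s * b (killed R s w) (killed R s w) - (norm (C *v killed R s w))\<^sup>2 - diffusion b (killed R s w))"
          using FW(2) FC(2) FD(2) by simp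
        show "2 * b (drift R s w) (killed R s w) \<le> a s * b (killed R s w) (killed R s w) - (norm (C *v killed R s w))\<^sup>2 - diffusion b (killed R s w)" for w
          using point[of s w] by simp
      qed
      also have "\<dots> = a s * W s - c s - ?e s" using FW(2) FC(2) FD(2) by (simp add: W_def c_def)
      finally show ?thesis .
    qed
    have i1: "set_integrable lborel {0..t} (\<lambda>s. a s * W s)" using FW(6) by (simp add: a_def W_def)
    have i2: "set_integrable lborel {0..t} c" using FC(3) by (simp add: c_def[abs_def])
    have i3: "set_integrable lborel {0..t} ?e" by (rule FD(3))
    have "2 * (LINT s:{0..t}|lborel. ?d s) = (LINT s:{0..t}|lborel. 2 * ?d s)" by simp
    also have "\<dots> \<le> (LINT s:{0..t}|lborel. a s * W s - c s - ?e s)"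
      by (rule set_integral_mono) (use le drift_killed_fubini[OF b R t(2)] i1 i2 i3 in \<open>auto intro!: set_integral_diff(1)\<close>)
    also have "\<dots> = (LINT s:{0..t}|lborel. a s * W s) - (LINT s:{0..t}|lborel. c s) - (LINT s:{0..t}|lborel. ?e s)"
      using set_integral_diff(2)[OF set_integral_diff(1)[OF i1 i2] i3] set_integral_diff(2)[OF i1 i2] by simp
    finally have A1: "2 * (LINT s:{0..t}|lborel. ?d s) \<le> (LINT s:{0..t}|lborel. a s * W s) - (LINT s:{0..t}|lborel. c s) - (LINT s:{0..t}|lborel. ?e s)" .
    \<comment> \<open>The energy inequality inherits \<open>{0<..t}\<close> from the stochastic
      integral, whereas Gronwall's inequality is stated with closed intervals.\<close>
    have "(LINT w|P. (LINT s:{0<..t}|lborel. diffusion b (killed R s w))) = (LINT w|P. (LINT s:{0..t}|lborel. diffusion b (killed R s w)))"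
    proof (rule Bochner_Integration.integral_cong[OF refl])
      fix w assume wP: "w \<in> space P"
      show "(LINT s:{0<..t}|lborel. diffusion b (killed R s w)) = (LINT s:{0..t}|lborel. diffusion b (killed R s w))"
        by (rule set_integral_Ioc_Icc) (use measurable_compose[OF measurable_Pair1'[OF wP] FD(1)] in simp)
    qed
    also have "\<dots> = (LINT s:{0..t}|lborel. ?e s)" by (rule FD(5))
    finally show ?thesis using killed_energy_inequality[OF b sym bpos R t, of ] A1 by (simp add: W_def)
  qed
  have c0: "0 \<le> c s" for s unfolding c_def by (intro Bochner_Integration.integral_nonneg) simp
  have W0: "0 \<le> W s" for s unfolding W_def by (intro Bochner_Integration.integral_nonneg bpos)
  have TT: "0 \<le> T" "T \<le> T" using T by auto
  note FW = killed_function_fubini[OF cW R TT] and FC = killed_function_fubini[OF cC R TT]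
  have ic: "set_integrable lborel {0..t} c" if "t \<le> T" for t
    by (rule set_integrable_subset[of _ "{0..T}"]) (use FC(3) that in \<open>auto simp: c_def[abs_def]\<close>)
  \<comment> \<open>Capping at \<open>T\<close> makes \<open>G\<close> monotone on the whole line,
    and a monotone function is Borel measurable.\<close>
  define G where "G t = (LINT s:{0..min t T}|lborel. c s)" for t
  have G: "mono G"
  proof (rule monoI)
    fix t t' :: real assume tt: "t \<le> t'"
    show "G t \<le> G t'" unfolding G_def set_lebesgue_integral_def
    proof (rule integral_mono)
      show "integrable lborel (\<lambda>s. indicator {0..min t T} s *\<^sub>R c s)" "integrable lborel (\<lambda>s. indicator {0..min t' T} s *\<^sub>R c s)"
        using ic[of "min t T"] ic[of "min t' T"] by (simp_all add: set_integrable_def)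
    qed (use c0 tt in \<open>auto simp: indicator_def\<close>)
  qed
  have G0: "0 \<le> G t" for t
    unfolding G_def set_lebesgue_integral_def using c0 by (intro Bochner_Integration.integral_nonneg) auto
  have Gm: "G \<in> borel_measurable borel" using G by (rule borel_measurable_mono)
  have um: "u \<in> borel_measurable borel" by (rule u_measurable)
  have iaW: "set_integrable lborel {0..T} (\<lambda>s. a s * W s)" using FW(6) by (simp add: a_def W_def)
  have iaG: "set_integrable lborel {0..T} (\<lambda>s. a s * G s)"
  proof -
    have "set_integrable lborel {0..T} (\<lambda>s. a s * G T)" using u_integrable by (simp add: a_def)
    then show ?thesis unfolding set_integrable_def
    proof (rule Bochner_Integration.integrable_bound)
      show "(\<lambda>s. indicator {0..T} s *\<^sub>R (a s * G s)) \<in> borel_measurable lborel"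
        unfolding a_def using um Gm by measurable
      show "AE s in lborel. norm (indicator {0..T} s *\<^sub>R (a s * G s)) \<le> norm (indicator {0..T} s *\<^sub>R (a s * G T))"
        using G0 monoD[OF G, of _ T] by (intro AE_I2) (auto simp: indicator_def abs_mult a_def intro!: mult_left_mono)
    qed
  qed
  have iaf: "set_integrable lborel {0..T} (\<lambda>s. a s * (W s + G s))"
    using set_integral_add(1)[OF iaW iaG] by (simp add: distrib_left)
  \<comment> \<open>Gronwall's inequality for \<open>W\<close> alone would lose the output term.
    Since \<open>a s * G s\<close> is nonnegative it may be added on the right, so the sum of
    \<open>W\<close> and the accumulated output \<open>G\<close> satisfies an inequality of the same
    form.\<close>
  have "W T + G T \<le> ?v * exp (LINT s:{0..T}|lborel. a s)"
  proof (rule gronwall_integral[where f = "\<lambda>s. W s + G s"])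
    show "0 \<le> W s + G s" for s using W0 G0 by (simp add: add_nonneg_nonneg)
    show "W t + G t \<le> ?v + (LINT s:{0..t}|lborel. a s * (W s + G s))" if "t \<in> {0..T}" for t
    proof -
      have t: "0 \<le> t" "t \<le> T" using that by auto
      have "(LINT s:{0..t}|lborel. a s * W s) \<le> (LINT s:{0..t}|lborel. a s * (W s + G s))"
      proof (rule set_integral_mono)
        show "set_integrable lborel {0..t} (\<lambda>s. a s * W s)" by (rule set_integrable_subset[OF iaW]) (use t in auto)
        show "set_integrable lborel {0..t} (\<lambda>s. a s * (W s + G s))" by (rule set_integrable_subset[OF iaf]) (use t in auto)
        show "a s * W s \<le> a s * (W s + G s)" for s using G0 by (intro mult_left_mono) (auto simp: a_def)
      qed
      moreover have "G t = (LINT s:{0..t}|lborel. c s)" using t by (simp add: G_def min_absorb1)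
      ultimately show ?thesis using Wt[OF t] by simp
    qed
  qed (use T u_integrable iaf in \<open>auto simp: a_def\<close>)
  moreover have "G T = (LINT s:{0..T}|lborel. c s)" by (simp add: G_def)
  ultimately show ?thesis using W0[of T] by (simp add: c_def a_def b_def)
qed

text \<open>On each path the killed outputs equal the true one from some level on, a level that
  depends on the path. Fatou's lemma for nonnegative integrals carries the bound, which is uniform
  in the level, to the limit; finiteness of the expectation is thus part of the conclusion.\<close>

theorem output_bound:
  fixes C :: "real^'n^'p" and Q :: "real^'n^'n"
  assumes gram: "is_observability_gramian A N H C K Q" and pos: "\<And>y. 0 \<le> y \<bullet> (Q *v y)"
  shows "(\<integral>\<^sup>+w. (\<integral>\<^sup>+s\<in>{0..T}. ennreal ((norm (C *v x s w))\<^sup>2) \<partial>lborel) \<partial>P)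
    \<le> ennreal ((x0 \<bullet> (Q *v x0)) * exp (LINT s:{0..T}|lborel. (norm (u s))\<^sup>2))"
proof -
  have cC: "continuous_on UNIV (\<lambda>y. (norm (C *v y))\<^sup>2)"
    by (intro continuous_on_power continuous_on_norm linear_continuous_on matrix_vector_mul_bounded_linear)
  have TT: "0 \<le> T" "T \<le> T" using T by auto
  define f where "f n w = (\<integral>\<^sup>+s\<in>{0..T}. ennreal ((norm (C *v killed (real n) s w))\<^sup>2) \<partial>lborel)" for n w
  note FC = killed_function_fubini[OF cC of_nat_0_le_iff TT]
  have feq: "f n w = ennreal (LINT s:{0..T}|lborel. (norm (C *v killed (real n) s w))\<^sup>2)" if wP: "w \<in> space P" for n w
    unfolding f_def
  proof (rule set_nn_integral_ennreal)
    obtain c where c: "0 \<le> c" "\<And>y z. norm y \<le> real n \<Longrightarrow> norm (z :: real^'n) \<le> real n \<Longrightarrow> \<bar>(norm (C *v fst (y, z)))\<^sup>2\<bar> \<le> c"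
      using continuous_bounded_on_balls[OF continuous_on_compose2[OF cC continuous_on_fst[OF continuous_on_id]], where R = "real n"] by auto
    have bd: "(norm (C *v killed (real n) s w))\<^sup>2 \<le> c" for s
      using c(2)[of "killed (real n) s w" "killed (real n) s w"] norm_killed[of "real n" s w] by simp
    have "set_integrable lborel {0..T} (\<lambda>_. c)"
      unfolding set_integrable_def using T by (intro integrable_scaleR_left) (auto intro!: integrable_real_indicator)
    then show "set_integrable lborel {0..T} (\<lambda>s. (norm (C *v killed (real n) s w))\<^sup>2)"
      unfolding set_integrable_def
    proof (rule Bochner_Integration.integrable_bound)
      have "(\<lambda>s. (norm (C *v killed (real n) s w))\<^sup>2) \<in> borel_measurable lborel"
        using measurable_compose[OF measurable_Pair1'[OF wP] FC(1)] by simp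
      then show "(\<lambda>s. indicator {0..T} s *\<^sub>R (norm (C *v killed (real n) s w))\<^sup>2) \<in> borel_measurable lborel" by measurable
      show "AE s in lborel. norm (indicator {0..T} s *\<^sub>R (norm (C *v killed (real n) s w))\<^sup>2) \<le> norm (indicator {0..T} s *\<^sub>R c)"
        using bd by (intro AE_I2) (auto simp: indicator_def intro: order_trans[OF _ abs_ge_self])
    qed
  qed simp
  have fm: "f n \<in> borel_measurable P" for n
  proof -
    have "(\<lambda>w. ennreal (LINT s:{0..T}|lborel. (norm (C *v killed (real n) s w))\<^sup>2)) \<in> borel_measurable P"
      using borel_measurable_integrable[OF FC(4)] by measurable
    then show ?thesis by (subst measurable_cong[OF feq])
  qed
  have fb: "(\<integral>\<^sup>+w. f n w \<partial>P) \<le> ennreal ((x0 \<bullet> (Q *v x0)) * exp (LINT s:{0..T}|lborel. (norm (u s))\<^sup>2))" for n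
  proof -
    have "(\<integral>\<^sup>+w. f n w \<partial>P) = (\<integral>\<^sup>+w. ennreal (LINT s:{0..T}|lborel. (norm (C *v killed (real n) s w))\<^sup>2) \<partial>P)"
      by (intro nn_integral_cong feq)
    also have "\<dots> = ennreal (LINT w|P. (LINT s:{0..T}|lborel. (norm (C *v killed (real n) s w))\<^sup>2))"
      by (intro nn_integral_eq_integral FC(4) AE_I2)
        (auto simp: set_lebesgue_integral_def intro!: Bochner_Integration.integral_nonneg)
    also have "\<dots> \<le> ennreal ((x0 \<bullet> (Q *v x0)) * exp (LINT s:{0..T}|lborel. (norm (u s))\<^sup>2))"
      unfolding FC(5) by (intro ennreal_leI killed_output_bound[OF gram pos]) simp
    finally show ?thesis .
  qed
  have lim: "liminf (\<lambda>n. f n w) = (\<integral>\<^sup>+s\<in>{0..T}. ennreal ((norm (C *v x s w))\<^sup>2) \<partial>lborel)" if wP: "w \<in> space P" for w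
  proof -
    have "bounded ((\<lambda>t. x t w) ` {0..T})" by (rule cadlag_bounded[OF x_cadlag[OF wP]])
    then obtain R where R: "\<And>s. s \<in> {0..T} \<Longrightarrow> norm (x s w) \<le> R" unfolding bounded_iff by blast
    obtain n0 where n0: "R \<le> real n0" using real_arch_simple by blast
    have "f n w = (\<integral>\<^sup>+s\<in>{0..T}. ennreal ((norm (C *v x s w))\<^sup>2) \<partial>lborel)" if n: "n \<ge> n0" for n
      unfolding f_def
    proof (intro nn_integral_cong)
      fix s
      have "killed (real n) s w = x s w" if s: "s \<in> {0..T}"
      proof -
        have "norm (x r w) \<le> real n" if "r \<in> {0..s}" for r
          using R[of r] n0 n that s by (auto intro: order_trans)
        then show ?thesis using s by (simp add: killed_def stay_def)
      qed
      then show "ennreal ((norm (C *v killed (real n) s w))\<^sup>2) * indicator {0..T} s = ennreal ((norm (C *v x s w))\<^sup>2) * indicator {0..T} s"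
        by (auto simp: indicator_def)
    qed
    then have "(\<lambda>n. f n w) \<longlonglongrightarrow> (\<integral>\<^sup>+s\<in>{0..T}. ennreal ((norm (C *v x s w))\<^sup>2) \<partial>lborel)"
      by (intro tendsto_eventually eventually_sequentiallyI)
    then show ?thesis by (intro lim_imp_Liminf) auto
  qed
  have "(\<integral>\<^sup>+w. (\<integral>\<^sup>+s\<in>{0..T}. ennreal ((norm (C *v x s w))\<^sup>2) \<partial>lborel) \<partial>P) = (\<integral>\<^sup>+w. liminf (\<lambda>n. f n w) \<partial>P)"
    by (intro nn_integral_cong lim[symmetric])
  also have "\<dots> \<le> liminf (\<lambda>n. \<integral>\<^sup>+w. f n w \<partial>P)" by (rule nn_integral_liminf[OF fm])
  also have "\<dots> \<le> ennreal ((x0 \<bullet> (Q *v x0)) * exp (LINT s:{0..T}|lborel. (norm (u s))\<^sup>2))"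
  proof -
    have "liminf (\<lambda>n. \<integral>\<^sup>+w. f n w \<partial>P) \<le> limsup (\<lambda>n. \<integral>\<^sup>+w. f n w \<partial>P)" by (rule Liminf_le_Limsup) simp
    also have "\<dots> \<le> ennreal ((x0 \<bullet> (Q *v x0)) * exp (LINT s:{0..T}|lborel. (norm (u s))\<^sup>2))"
      by (rule Limsup_bounded) (use fb in auto)
    finally show ?thesis .
  qed
  finally show ?thesis .
qed

end

section \<open>From Borel to Lebesgue measurable controls\<close>

lemma cadlag_measurable:
  fixes f :: "real \<Rightarrow> 'b::real_normed_vector"
  assumes "cadlag f"
  shows "(\<lambda>s. indicator {0..} s *\<^sub>R f s) \<in> borel_measurable borel"
proof (rule borel_measurable_continuous_countable_exceptions)
  \<comment> \<open>The point 0 is exceptional because the cut-off may create a jump there.\<close>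
  let ?X = "insert 0 {s. 0 < s \<and> \<not> isCont f s}"
  show "countable ?X" using cadlag_countable_discontinuities[OF assms] by simp
  show "continuous_on (- ?X) (\<lambda>s. indicator {0..} s *\<^sub>R f s)"
  proof (rule continuous_at_imp_continuous_on, rule ballI)
    fix s assume s: "s \<in> - ?X"
    show "isCont (\<lambda>s. indicator {0..} s *\<^sub>R f s) s"
    proof (cases "0 < s")
      case True
      then have "isCont f s" using s by auto
      moreover have "eventually (\<lambda>r. indicator {0..} r *\<^sub>R f r = f r) (nhds s)"
        using eventually_nhds_in_open[of "{0<..}" s] True by (auto elim!: eventually_mono)
      ultimately show ?thesis by (subst isCont_cong)
    next
      case False
      then have "s < 0" using s by auto
      then have "eventually (\<lambda>r. indicator {0..} r *\<^sub>R f r = 0) (nhds s)"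
        using eventually_nhds_in_open[of "{..<0}" s] by (auto elim!: eventually_mono)
      then have "isCont (\<lambda>s. indicator {0..} s *\<^sub>R f s) s \<longleftrightarrow> isCont (\<lambda>_. 0 :: 'b) s" by (rule isCont_cong)
      then show ?thesis by simp
    qed
  qed
qed

text \<open>Each coordinate agrees almost everywhere with a Borel function, and finitely many null
  sets are discarded.\<close>

lemma lebesgue_borel_version:
  fixes f :: "real \<Rightarrow> real^'m"
  assumes f: "f \<in> borel_measurable lebesgue"
  obtains f' where "f' \<in> borel_measurable borel" "AE s in lborel. f s = f' s"
proof -
  have "\<exists>g\<in>borel_measurable lborel. AE s in lborel. f s $ k = g s" for k
  proof (rule completion_ex_borel_measurable_real)
    show "(\<lambda>s. f s $ k) \<in> borel_measurable lebesgue"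
      by (rule borel_measurable_continuous_on[OF _ f]) (intro continuous_intros)
  qed
  then obtain g where g: "\<And>k. g k \<in> borel_measurable lborel" "\<And>k. AE s in lborel. f s $ k = g k s" by metis
  define f' where "f' s = (\<Sum>k\<in>UNIV. g k s *\<^sub>R axis k (1::real))" for s
  have "f' \<in> borel_measurable borel"
    unfolding f'_def using g(1) by (intro borel_measurable_sum borel_measurable_scaleR) auto
  moreover
  have "AE s in lborel. \<forall>k\<in>UNIV. f s $ k = g k s"
    by (rule AE_finite_allI) (use g(2) in auto)
  then have "AE s in lborel. f s = f' s"
    by (rule eventually_mono) (simp add: f'_def vec_eq_iff axis_def if_distrib cong: if_cong)
  ultimately show ?thesis by (rule that)
qed

lemma lebesgue_integral_eq_lborel:
  fixes f :: "real \<Rightarrow> 'b::euclidean_space"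
  assumes "f \<in> borel_measurable lebesgue" "f' \<in> borel_measurable borel" "AE s in lborel. f s = f' s"
  shows "integrable lebesgue f \<longleftrightarrow> integrable lborel f'" "(LINT s|lebesgue. f s) = (LINT s|lborel. f' s)"
proof -
  have f': "f' \<in> borel_measurable lborel" using assms(2) by simp
  have f'2: "f' \<in> borel_measurable lebesgue" using f' by (rule measurable_completion)
  have ae: "AE s in lebesgue. f s = f' s" using assms(3) by (rule AE_completion)
  have "integrable lebesgue f \<longleftrightarrow> integrable lebesgue f'" by (rule integrable_cong_AE[OF assms(1) f'2 ae])
  then show "integrable lebesgue f \<longleftrightarrow> integrable lborel f'" using integrable_completion[OF f'] by simp
  have "(LINT s|lebesgue. f s) = (LINT s|lebesgue. f' s)" by (rule integral_cong_AE[OF assms(1) f'2 ae])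
  then show "(LINT s|lebesgue. f s) = (LINT s|lborel. f' s)" using integral_completion[OF f'] by simp
qed

theorem mainTheorem4:
  fixes P :: "'a measure"
    and F :: "real \<Rightarrow> 'a measure"
    and M :: "real \<Rightarrow> 'a \<Rightarrow> real^'v"
    and K :: "real^'v^'v"
    and A :: "real^'n^'n"
    and N :: "'m::finite \<Rightarrow> real^'n^'n"
    and H :: "'v::finite \<Rightarrow> real^'n^'n"
    and C :: "real^'n^'p"
    and Q :: "real^'n^'n"
    and u :: "real \<Rightarrow> real^'m"
    and x0 :: "real^'n"
    and x :: "real \<Rightarrow> 'a \<Rightarrow> real^'n"
    and T :: real
  assumes "prob_space P"
    and "filtered P F"
    and "levy_process P F M"
    and "\<And>t. t \<ge> 0 \<Longrightarrow> integrable P (\<lambda>\<omega>. (norm (M t \<omega>))\<^sup>2)"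
    and "\<And>t. t \<ge> 0 \<Longrightarrow> (LINT \<omega>|P. M t \<omega>) = 0"
    and "\<And>t i j. t \<ge> 0 \<Longrightarrow> (LINT \<omega>|P. M t \<omega> $ i * M t \<omega> $ j) = K $ i $ j * t"
    and "mean_square_asymptotically_stable A N H K"
    and "is_observability_gramian A N H C K Q"
    and "positive_definite Q"
    and "is_control u"
    and "is_solution P F M A N H u x0 x"
    and "T > 0"
  shows "(\<integral>\<^sup>+\<omega>. (\<integral>\<^sup>+s\<in>{0..T}. ennreal ((norm (C *v x s \<omega>))\<^sup>2) \<partial>lborel) \<partial>P)
    \<le> ennreal ((x0 \<bullet> (Q *v x0)) * exp (LINT s:{0..T}|lebesgue. (norm (u s))\<^sup>2))"
proof -
  interpret levy: square_integrable_levy P F M K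
    by (rule square_integrable_levy.intro[OF assms(1)], rule square_integrable_levy_axioms.intro) (fact assms)+
  \<comment> \<open>A control is measurable only on \<open>{0..}\<close>; its values at negative
    times are replaced by 0.\<close>
  let ?u = "\<lambda>s. indicator {0..} s *\<^sub>R u s"
  have um: "?u \<in> borel_measurable lebesgue"
    using assms(10) by (simp add: is_control_def set_borel_measurable_def)
  obtain u' where u': "u' \<in> borel_measurable borel" "AE s in lborel. ?u s = u' s"
    using lebesgue_borel_version[OF um] by blast
  have norm_u: "set_integrable lebesgue {0..T} (\<lambda>s. (norm (u s))\<^sup>2) \<longleftrightarrow> set_integrable lborel {0..T} (\<lambda>s. (norm (u' s))\<^sup>2)"
    "(LINT s:{0..T}|lebesgue. (norm (u s))\<^sup>2) = (LINT s:{0..T}|lborel. (norm (u' s))\<^sup>2)"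
  proof -
    have eq: "indicator {0..T} s *\<^sub>R (norm (u s))\<^sup>2 = indicator {0..T} s *\<^sub>R (norm (?u s))\<^sup>2" for s
      by (auto simp: indicator_def)
    have m: "(\<lambda>s. indicator {0..T} s *\<^sub>R (norm (u s))\<^sup>2) \<in> borel_measurable lebesgue"
      unfolding eq by (intro borel_measurable_scaleR borel_measurable_power borel_measurable_indicator
          measurable_compose[OF um borel_measurable_norm]) simp
    have m': "(\<lambda>s. indicator {0..T} s *\<^sub>R (norm (u' s))\<^sup>2) \<in> borel_measurable borel" using u'(1) by measurable
    have "AE s in lborel. indicator {0..T} s *\<^sub>R (norm (u s))\<^sup>2 = indicator {0..T} s *\<^sub>R (norm (u' s))\<^sup>2"
      using u'(2) by (rule eventually_mono) (simp only: eq)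
    from lebesgue_integral_eq_lborel[OF m m' this]
    show "set_integrable lebesgue {0..T} (\<lambda>s. (norm (u s))\<^sup>2) \<longleftrightarrow> set_integrable lborel {0..T} (\<lambda>s. (norm (u' s))\<^sup>2)"
      "(LINT s:{0..T}|lebesgue. (norm (u s))\<^sup>2) = (LINT s:{0..T}|lborel. (norm (u' s))\<^sup>2)"
      by (simp_all only: set_integrable_def set_lebesgue_integral_def)
  qed
  obtain J where J: "\<And>i t. 0 \<le> t \<Longrightarrow>
      has_stoch_integral P F (\<lambda>s w. M s w $ i) (\<lambda>s w. H i *v left_lim x s w) t (J i t)"
    and eq: "\<And>t. 0 \<le> t \<Longrightarrow> AE w in P. x t w = x0
      + (LINT s:{0..t}|lebesgue. A *v x s w + (\<Sum>k\<in>UNIV. (u s $ k) *\<^sub>R (N k *v x s w))) + (\<Sum>i\<in>UNIV. J i t w)"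
    using assms(11) unfolding is_solution_def by blast
  have cad: "cadlag (\<lambda>t. x t w)" if "w \<in> space P" for w using assms(11) that by (simp add: is_solution_def)
  \<comment> \<open>Changing the control on a null set of times leaves the drift integral of every
    path unchanged; \<open>cadlag_measurable\<close> supplies the measurability in time of the
    path.\<close>
  have drift_eq: "(LINT s:{0..t}|lebesgue. A *v x s w + (\<Sum>k\<in>UNIV. (u s $ k) *\<^sub>R (N k *v x s w)))
      = (LINT s:{0..t}|lborel. A *v x s w + (\<Sum>k\<in>UNIV. (u' s $ k) *\<^sub>R (N k *v x s w)))" if wP: "w \<in> space P" for t w
  proof -
    let ?x = "\<lambda>s. indicator {0..} s *\<^sub>R x s w"
    let ?h = "\<lambda>u s. indicator {0..t} s *\<^sub>R (A *v ?x s + (\<Sum>k\<in>UNIV. (u s $ k) *\<^sub>R (N k *v ?x s)))"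
    have xm: "?x \<in> borel_measurable borel" by (rule cadlag_measurable[OF cad[OF wP]])
    have mat: "(\<lambda>s. B *v f s) \<in> borel_measurable L" if "f \<in> borel_measurable L" for B :: "real^'n^'n" and f and L :: "real measure"
      by (rule borel_measurable_continuous_on[OF _ that]) (intro linear_continuous_on matrix_vector_mul_bounded_linear)
    have comp: "(\<lambda>s. f s $ k) \<in> borel_measurable L" if "f \<in> borel_measurable L" for k and f :: "real \<Rightarrow> real^'m" and L
      by (rule borel_measurable_continuous_on[OF _ that]) (intro continuous_intros)
    have hm: "?h v \<in> borel_measurable L"
      if "v \<in> borel_measurable L" "?x \<in> borel_measurable L" "{0..t} \<in> sets L" for v and L :: "real measure"
      by (intro borel_measurable_scaleR borel_measurable_add borel_measurable_sum borel_measurable_indicator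
          mat[OF that(2)] comp[OF that(1)] that(3))
    have xl: "?x \<in> borel_measurable lebesgue" by (rule measurable_completion) (use xm in simp)
    have m1: "?h ?u \<in> borel_measurable lebesgue" by (rule hm[OF um xl]) simp
    have m2: "?h u' \<in> borel_measurable borel" by (rule hm[OF u'(1) xm]) simp
    have "AE s in lborel. ?h ?u s = ?h u' s" using u'(2) by (rule eventually_mono) (simp only:)
    from lebesgue_integral_eq_lborel(2)[OF m1 m2 this]
    have h: "(LINT s|lebesgue. ?h ?u s) = (LINT s|lborel. ?h u' s)" .
    have hu: "?h ?u s = indicator {0..t} s *\<^sub>R (A *v x s w + (\<Sum>k\<in>UNIV. (u s $ k) *\<^sub>R (N k *v x s w)))" for s
      by (cases "s \<in> {0..t}") auto
    have hu': "?h u' s = indicator {0..t} s *\<^sub>R (A *v x s w + (\<Sum>k\<in>UNIV. (u' s $ k) *\<^sub>R (N k *v x s w)))" for s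
      by (cases "s \<in> {0..t}") auto
    show ?thesis using h unfolding hu hu' set_lebesgue_integral_def .
  qed
  interpret sys: bilinear_system P F M K A N H u' x0 x J T
  proof (intro bilinear_system.intro levy.square_integrable_levy_axioms bilinear_system_axioms.intro)
    show "set_integrable lborel {0..T} (\<lambda>s. (norm (u' s))\<^sup>2)"
      using assms(10,12) norm_u(1) by (simp add: is_control_def)
    show "adapted F x" using assms(11) by (simp add: is_solution_def)
    fix t assume "t \<in> {0..T}"
    then have "0 \<le> t" by simp
    from eq[OF this] AE_space
    show "AE w in P. x t w = x0
      + (LINT s:{0..t}|lborel. A *v x s w + (\<Sum>k\<in>UNIV. (u' s $ k) *\<^sub>R (N k *v x s w))) + (\<Sum>i\<in>UNIV. J i t w)"
      by eventually_elim (simp only: drift_eq)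
  qed (use assms(12) u'(1) J cad in auto)
  \<comment> \<open>Definiteness speaks of nonzero vectors only; at 0 the form vanishes.\<close>
  have pos: "0 \<le> y \<bullet> (Q *v y)" for y
    using assms(9) by (cases "y = 0") (auto simp: positive_definite_def less_imp_le)
  show ?thesis
    using sys.output_bound[OF assms(8) pos] unfolding norm_u(2) .
qed

end
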